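(* Let $k\geq 1$ and let $(G_1,\dots,G_k)$ be a random vector with distribution $\gamma_k$. Then $$(G_1,\dots,G_k)\overset{(d)}{=}\Big(\frac{E_1}{C_1},\frac{E_2}{C_2},\dots,\frac{E_k}{C_k}\Big),$$ where $E_1,\dots,E_k$ are i.i.d. exponential random variables with parameter $1$, independent of the random vector $(C_1,\dots,C_k)$, which has law $\nu_k$.
   Context: Let $B_1,B_2,\dots$ be i.i.d. two-sided standard Brownian motions (i.e. $(B(t))_{t\ge0}$ and $(B(-t))_{t\ge0}$ are independent standard linear Brownian motions) and $I^{(n)}=B_n\circ\cdots\circ B_1$. It is known that for any $m\ge1$ and any distinct nonzero reals $t_1,\dots,t_m$, $(I^{(n)}(t_1),\dots,I^{(n)}(t_m))$ converges in distribution as $n\to\infty$ to a law $\mu_m$ not depending on the $t_i$'s. For a finite sequence $\ell_0,\dots,\ell_k$ with increasing rearrangement $\hat\ell_0\le\dots\le\hat\ell_k$, its gaps sequence is $(\hat\ell_i-\hat\ell_{i-1})_{1\le i\le k}$. $\gamma_k$ denotes the law of the gaps sequence of a $\mu_{k+1}$-distributed vector $(I_1,\dots,I_{k+1})$. For $x_1,\dots,x_k$ put $\bar x_0=0$, $\bar x_i=x_1+\dots+x_i$. For a permutation $\tau$ of $\{0,1,\dots,k\}$ and $c=(c_1,\dots,c_k)\in(0,\infty)^k$, let, for $i\in\{1,\dots,k\}$, $E_{\tau,i}=\{j\in\{1,\dots,k\}:\min(\tau(j-1),\tau(j))<i\le\max(\tau(j-1),\tau(j))\}$, $F_{\tau,i}(c)=\sum_{j\in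 E_{\tau,i}}\sqrt{2c_j}$, $F_\tau(c)=(F_{\tau,1}(c),\dots,F_{\tau,k}(c))$, and $w_\tau(c)=2^{-k}\prod_{i=1}^k \sqrt{2c_i}/F_{\tau,i}(c)$. Let $Q$ be the Markov kernel on $(0,\infty)^k$ given by $Q(c,\cdot)=\sum_{\tau}w_\tau(c)\,\delta_{F_\tau(c)}$ (sum over all permutations $\tau$ of $\{0,\dots,k\}$). For any probability measure $\nu^{(0)}$ supported in $[2,2k^2]^k$, $\nu^{(0)}Q^n$ converges weakly as $n\to\infty$ to a probability measure $\nu_k$ not depending on $\nu^{(0)}$; this is the $\nu_k$ of the statement. *)

theory Defs
  imports "HOL-Probability.Probability" "HOL-Combinatorics.Permutations"
begin

text \<open>A two-sided standard Brownian motion on the probability space M: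
  continuous paths, value 0 at time 0, and for every finite increasing
  sequence of times t 0 < t 1 < ... < t n (arbitrary reals) the increments
  are independent and X(t (i+1)) - X(t i) is centered Gaussian with variance
  t (i+1) - t i. (This is equivalent to: (X t) for t >= 0 and (X (-t)) for
  t >= 0 are independent standard linear Brownian motions.)\<close>

definition two_sided_BM :: "'a measure \<Rightarrow> ('a \<Rightarrow> real \<Rightarrow> real) \<Rightarrow> bool" where
  "two_sided_BM M X \<longleftrightarrow>
     (\<forall>\<omega>\<in>space M. X \<omega> 0 = 0 \<and> continuous_on UNIV (X \<omega>)) \<and>
     (\<forall>t. (\<lambda>\<omega>. X \<omega> t) \<in> borel_measurable M) \<and>
     (\<forall>(n::nat) (t::nat \<Rightarrow> real). (\<forall>i<n. t i < t (Suc i)) \<longrightarrow>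
        prob_space.indep_vars M (\<lambda>_. borel) (\<lambda>i \<omega>. X \<omega> (t (Suc i)) - X \<omega> (t i)) {..<n} \<and>
        (\<forall>i<n. distributed M lborel (\<lambda>\<omega>. X \<omega> (t (Suc i)) - X \<omega> (t i))
                 (normal_density 0 (sqrt (t (Suc i) - t i)))))"

primrec Icomp :: "(nat \<Rightarrow> 'a \<Rightarrow> real \<Rightarrow> real) \<Rightarrow> nat \<Rightarrow> 'a \<Rightarrow> real \<Rightarrow> real" where
  "Icomp B 0 \<omega> = id"
| "Icomp B (Suc n) \<omega> = B (Suc n) \<omega> \<circ> Icomp B n \<omega>"

text \<open>Vectors in R^I (I a finite index set) are the extensional functions in
  PiE I (\<lambda>_. UNIV), carrying the measurable space PiM I (\<lambda>_. borel) and
  the (product) topology of nat \<Rightarrow> real. Test functions for weak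
  convergence: bounded continuous real functions on R^I.\<close>

definition bcont :: "nat set \<Rightarrow> ((nat \<Rightarrow> real) \<Rightarrow> real) \<Rightarrow> bool" where
  "bcont I f \<longleftrightarrow> continuous_on (PiE I (\<lambda>_. UNIV)) f \<and>
                  (\<exists>K. \<forall>x\<in>PiE I (\<lambda>_. UNIV). \<bar>f x\<bar> \<le> K)"

definition gaps :: "nat \<Rightarrow> (nat \<Rightarrow> real) \<Rightarrow> (nat \<Rightarrow> real)" where
  "gaps k x = (let s = sort (map x [1..<k+2]) in (\<lambda>i\<in>{1..k}. s ! i - s ! (i - 1)))"

definition Eset :: "nat \<Rightarrow> (nat \<Rightarrow> nat) \<Rightarrow> nat \<Rightarrow> nat set" where
  "Eset k \<tau> i = {j\<in>{1..k}. min (\<tau> (j - 1)) (\<tau> j) < i \<and> i \<le> max (\<tau> (j - 1)) (\<tau> j)}"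

definition Fcomp :: "nat \<Rightarrow> (nat \<Rightarrow> nat) \<Rightarrow> (nat \<Rightarrow> real) \<Rightarrow> nat \<Rightarrow> real" where
  "Fcomp k \<tau> c i = (\<Sum>j\<in>Eset k \<tau> i. sqrt (2 * c j))"

definition Fvec :: "nat \<Rightarrow> (nat \<Rightarrow> nat) \<Rightarrow> (nat \<Rightarrow> real) \<Rightarrow> (nat \<Rightarrow> real)" where
  "Fvec k \<tau> c = (\<lambda>i\<in>{1..k}. Fcomp k \<tau> c i)"

definition wt :: "nat \<Rightarrow> (nat \<Rightarrow> nat) \<Rightarrow> (nat \<Rightarrow> real) \<Rightarrow> real" where
  "wt k \<tau> c = (1 / 2 ^ k) * (\<Prod>i\<in>{1..k}. sqrt (2 * c i) / Fcomp k \<tau> c i)"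

text \<open>Action of Q on test functions: (Q f)(c) = \<Sum>_\<tau> w_\<tau>(c) f(F_\<tau>(c)).
  Hence for an initial law \<nu>0, the integral of f against \<nu>0 Q^n equals the
  integral of (Qop k ^^ n) f against \<nu>0.\<close>

definition Qop :: "nat \<Rightarrow> ((nat \<Rightarrow> real) \<Rightarrow> real) \<Rightarrow> (nat \<Rightarrow> real) \<Rightarrow> real" where
  "Qop k f c = (\<Sum>\<tau>\<in>{\<tau>. \<tau> permutes {0..k}}. wt k \<tau> c * f (Fvec k \<tau> c))"

end

theory Submission
  imports Defs "HOL-Real_Asymp.Real_Asymp"
begin

text \<open>
  A Brownian motion run over an independent exponential time of rate \<open>c\<close> has the Laplace law with
  parameter \<open>sqrt (2 c)\<close>. So if the gaps of \<open>k + 1\<close> points are independent exponentials with rates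
  \<open>c\<close>, the images of the points under a Brownian motion form a walk with independent Laplace steps.
  On the event that the ranks of the walk are given by a permutation \<open>\<tau>\<close>, the absolute steps are sums of
  the new gaps, the change of variables is unimodular, and the new gaps have density
  \<open>w\<^sub>\<tau>(c)\<close> times that of independent exponentials with rates \<open>F\<^sub>\<tau>(c)\<close>. Hence the map sending \<open>c\<close> to
  the exponential law intertwines the kernel \<open>Q\<close> with the transition kernel \<open>P\<close> of the gaps of
  \<open>I\<^sup>(\<^sup>n\<^sup>)\<close>. As the limit law does not depend on the starting points, one may start from
  points with exponential gaps of rates \<open>(2, \<dots>, 2)\<close>: the gaps after \<open>n\<close> steps are then a mixture
  of exponentials over \<open>\<delta>\<^sub>2 Q\<^sup>n\<close>, and both sides converge.
\<close>

section \<open>Order statistics and gaps\<close>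

text \<open>The hypotheses speak only of fixed starting points and of bounded continuous test
  functions, so both kernels are made to act on functions, and the exponential start is never
  realised by random points: \<open>(Pop k ^^ n) h g\<close> has the same limit for every vector
  \<open>g\<close> of positive gaps, and this is integrated against the exponential law by dominated
  convergence. For one step the law of the sorted walk is needed. A walk pinned at 0 is not
  symmetric under relabelling its points; a starting position spread over an interval of length 1
  restores this symmetry and costs no mass. The factor \<open>2 ^ k\<close> in \<open>wt\<close>
  comes from the normalisation of the two-sided Laplace densities. The number 2 is the positive
  fixed point of the map from u to \<open>sqrt (2 * u)\<close>: every new rate is a nonempty sum of
  such roots, so rates that start at 2 or more stay there. This bound is what makes the mixing
  function, whose rates sit in a denominator, usable as a continuous test function.\<close>

lemma sort_nth_le_iff:
  fixes xs :: "'a::linorder list"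
  assumes "i < length xs"
  shows "sort xs ! i \<le> a \<longleftrightarrow> i < length (filter (\<lambda>x. x \<le> a) xs)"
proof -
  define ys where "ys = sort xs"
  have ys: "sorted ys" "length ys = length xs" by (simp_all add: ys_def)
  have "mset (filter (\<lambda>x. x \<le> a) xs) = mset (filter (\<lambda>x. x \<le> a) ys)"
    by (simp add: ys_def)
  then have "length (filter (\<lambda>x. x \<le> a) xs) = length (filter (\<lambda>x. x \<le> a) ys)"
    by (metis size_mset)
  also have "\<dots> = card {j. j < length ys \<and> ys ! j \<le> a}"
    by (rule length_filter_conv_card)
  finally have len: "length (filter (\<lambda>x. x \<le> a) xs) = card {j. j < length ys \<and> ys ! j \<le> a}" .
  \<comment> \<open>In a sorted list the entries at most \<open>a\<close> form an initial segment,
    so its length, the count in \<open>len\<close>, decides whether index \<open>i\<close> belongs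
    to it.\<close>
  show ?thesis
  proof (cases "ys ! i \<le> a")
    case True
    have "{..i} \<subseteq> {j. j < length ys \<and> ys ! j \<le> a}"
      using assms ys True by (auto intro: order_trans[OF sorted_nth_mono])
    then have "card {..i} \<le> card {j. j < length ys \<and> ys ! j \<le> a}"
      by (intro card_mono) auto
    then show ?thesis using True len by (simp add: ys_def)
  next
    case False
    have "{j. j < length ys \<and> ys ! j \<le> a} \<subseteq> {..<i}"
    proof safe
      fix j assume "j < length ys" "ys ! j \<le> a"
      then show "j < i" using False ys sorted_nth_mono[of ys i j] by force
    qed
    then have "card {j. j < length ys \<and> ys ! j \<le> a} \<le> i"
      using card_mono[of "{..<i}"] by fastforce
    then show ?thesis using False len by (simp add: ys_def)
  qed
qed

definition ordstat :: "nat \<Rightarrow> nat \<Rightarrow> (nat \<Rightarrow> real) \<Rightarrow> real" where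
  "ordstat k i x = sort (map x [1..<k+2]) ! i"

lemma gaps_ordstat: "gaps k x = (\<lambda>i\<in>{1..k}. ordstat k i x - ordstat k (i - 1) x)"
  by (simp add: gaps_def ordstat_def Let_def)

text \<open>Counting replaces sorting: invariance under relabelling, the Lipschitz bound and
  measurability are all read off from this criterion. Index 0 is the smallest value.\<close>

lemma ordstat_le_iff:
  assumes "i \<le> k"
  shows "ordstat k i x \<le> a \<longleftrightarrow> i < card {j\<in>{1..Suc k}. x j \<le> a}"
proof -
  have "length (filter (\<lambda>u. u \<le> a) (map x [1..<k+2])) = length (filter (\<lambda>j. x j \<le> a) [1..<k+2])"
    by (simp add: filter_map comp_def)
  also have "\<dots> = card (set (filter (\<lambda>j. x j \<le> a) [1..<k+2]))"
    by (intro distinct_card[symmetric] distinct_filter) simp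
  also have "set (filter (\<lambda>j. x j \<le> a) [1..<k+2]) = {j\<in>{1..Suc k}. x j \<le> a}"
    by (auto simp del: upt_Suc)
  finally show ?thesis
    using assms unfolding ordstat_def by (subst sort_nth_le_iff) auto
qed

lemma real_eq_by_upper_bounds:
  fixes x y :: real
  assumes "\<And>a. x \<le> a \<longleftrightarrow> y \<le> a"
  shows "x = y"
  using assms[of x] assms[of y] by linarith

text \<open>The criterion \<open>ordstat_le_iff\<close> sees only how many values lie below a
  threshold; \<open>\<sigma>\<close> matches the counted index sets and \<open>c\<close> moves the
  threshold.\<close>

lemma ordstat_permute_shift:
  assumes "i \<le> k" and \<sigma>: "bij_betw \<sigma> {1..Suc k} {1..Suc k}"
    and y: "\<And>j. j \<in> {1..Suc k} \<Longrightarrow> y j = x (\<sigma> j) + c"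
  shows "ordstat k i y = ordstat k i x + c"
proof (rule real_eq_by_upper_bounds)
  fix a
  have "bij_betw \<sigma> {j\<in>{1..Suc k}. y j \<le> a} {j\<in>{1..Suc k}. x j \<le> a - c}"
  proof (rule bij_betw_subset[OF \<sigma>])
    have im: "\<sigma> ` {1..Suc k} = {1..Suc k}" using \<sigma> by (simp add: bij_betw_def)
    show "\<sigma> ` {j\<in>{1..Suc k}. y j \<le> a} = {j\<in>{1..Suc k}. x j \<le> a - c}"
    proof (intro equalityI subsetI)
      fix m assume "m \<in> \<sigma> ` {j\<in>{1..Suc k}. y j \<le> a}"
      then obtain j where j: "j \<in> {1..Suc k}" "y j \<le> a" "m = \<sigma> j" by blast
      moreover have "\<sigma> j \<in> {1..Suc k}" using im j(1) by blast
      ultimately show "m \<in> {j\<in>{1..Suc k}. x j \<le> a - c}" using y[OF j(1)] by simp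
    next
      fix m assume m: "m \<in> {j\<in>{1..Suc k}. x j \<le> a - c}"
      then obtain j where j: "j \<in> {1..Suc k}" "m = \<sigma> j" using im by blast
      then show "m \<in> \<sigma> ` {j\<in>{1..Suc k}. y j \<le> a}" using m y[OF j(1)] by auto
    qed
  qed auto
  then have "card {j\<in>{1..Suc k}. y j \<le> a} = card {j\<in>{1..Suc k}. x j \<le> a - c}"
    by (rule bij_betw_same_card)
  moreover have "ordstat k i x + c \<le> a \<longleftrightarrow> ordstat k i x \<le> a - c" by linarith
  ultimately show "ordstat k i y \<le> a \<longleftrightarrow> ordstat k i x + c \<le> a"
    using assms(1) by (simp only: ordstat_le_iff)
qed

text \<open>The common shift cancels in differences. This is what lets a Brownian image of points be
  replaced by the walk of its increments over the sorted points.\<close>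

lemma gaps_permute_shift:
  assumes \<sigma>: "bij_betw \<sigma> {1..Suc k} {1..Suc k}"
    and y: "\<And>j. j \<in> {1..Suc k} \<Longrightarrow> y j = x (\<sigma> j) + c"
  shows "gaps k y = gaps k x"
  unfolding gaps_ordstat
proof (rule restrict_ext)
  fix i assume "i \<in> {1..k}"
  then have "i \<le> k" "i - 1 \<le> k" by auto
  then show "ordstat k i y - ordstat k (i - 1) y = ordstat k i x - ordstat k (i - 1) x"
    using ordstat_permute_shift[where y=y and x=x and c=c, OF _ \<sigma> y] by simp
qed

lemma gaps_shift:
  assumes "\<And>j. j \<in> {1..Suc k} \<Longrightarrow> y j = x j + c"
  shows "gaps k y = gaps k x"
  using assms by (intro gaps_permute_shift[where \<sigma>=id and c=c]) auto

lemma gaps_cong: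
  assumes "\<And>j. j \<in> {1..Suc k} \<Longrightarrow> y j = x j"
  shows "gaps k y = gaps k x"
  using assms by (intro gaps_shift[where c=0]) auto

lemma ordstat_increasing:
  assumes "i \<le> k" and mono: "\<And>i j. i \<in> {1..Suc k} \<Longrightarrow> j \<in> {1..Suc k} \<Longrightarrow> i \<le> j \<Longrightarrow> x i \<le> x j"
  shows "ordstat k i x = x (Suc i)"
proof -
  have "sorted (map x [1..<k+2])"
    unfolding sorted_map using mono
    by (intro sorted_wrt_mono_rel[OF _ sorted_upt]) auto
  then show ?thesis
    using assms(1) by (simp add: ordstat_def sorted_sort_id del: upt_Suc)
qed

lemma gaps_increasing:
  assumes mono: "\<And>i j. i \<in> {1..Suc k} \<Longrightarrow> j \<in> {1..Suc k} \<Longrightarrow> i \<le> j \<Longrightarrow> x i \<le> x j"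
  shows "gaps k x = (\<lambda>i\<in>{1..k}. x (Suc i) - x i)"
  unfolding gaps_ordstat
proof (rule restrict_ext)
  fix i assume "i \<in> {1..k}"
  then have "i \<le> k" "i - 1 \<le> k" "Suc (i - 1) = i" by auto
  then show "ordstat k i x - ordstat k (i - 1) x = x (Suc i) - x i"
    using ordstat_increasing[OF _ mono] by simp
qed

text \<open>If every coordinate moves by at most \<open>e\<close>, all coordinates of
  \<open>y\<close> below a threshold become coordinates of \<open>x\<close> below the threshold
  raised by \<open>e\<close>, so the count cannot drop.\<close>

lemma ordstat_lipschitz:
  assumes "i \<le> k" and e: "\<And>j. j \<in> {1..Suc k} \<Longrightarrow> \<bar>x j - y j\<bar> \<le> e"
  shows "\<bar>ordstat k i x - ordstat k i y\<bar> \<le> e"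
proof -
  have *: "ordstat k i x \<le> ordstat k i y + e" if e: "\<And>j. j \<in> {1..Suc k} \<Longrightarrow> \<bar>x j - y j\<bar> \<le> e" for x y
  proof -
    have "i < card {j\<in>{1..Suc k}. y j \<le> ordstat k i y}"
      using ordstat_le_iff[OF assms(1), of y "ordstat k i y"] by simp
    also have "\<dots> \<le> card {j\<in>{1..Suc k}. x j \<le> ordstat k i y + e}"
      using e by (intro card_mono) force+
    finally show ?thesis by (simp add: ordstat_le_iff[OF assms(1)])
  qed
  show ?thesis using *[of x y] *[of y x] e by (force simp: abs_minus_commute)
qed

lemma continuous_on_coordinate [continuous_intros]:
  "continuous_on A (\<lambda>x::'i \<Rightarrow> real. x i)"
  by (rule continuous_on_subset[OF continuous_on_product_coordinates]) simp

lemma continuous_on_ordstat: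
  assumes "i \<le> k"
  shows "continuous_on A (ordstat k i)"
  unfolding continuous_on_def
proof safe
  fix x :: "nat \<Rightarrow> real" assume "x \<in> A"
  show "(ordstat k i \<longlongrightarrow> ordstat k i x) (at x within A)"
  proof (rule tendstoI)
    fix e :: real assume "e > 0"
    \<comment> \<open>Half of \<open>e\<close>, because the Lipschitz bound is not strict; the
      product topology controls finitely many coordinates at once.\<close>
    have "\<forall>j\<in>{1..Suc k}. eventually (\<lambda>y. dist (y j) (x j) < e/2) (at x within A)"
    proof
      fix j
      show "eventually (\<lambda>y. dist (y j) (x j) < e/2) (at x within A)"
        using continuous_on_coordinate[of A j] \<open>x \<in> A\<close> \<open>e > 0\<close>
        unfolding continuous_on_def by (intro tendstoD) auto
    qed
    then have "eventually (\<lambda>y. \<forall>j\<in>{1..Suc k}. dist (y j) (x j) < e/2) (at x within A)"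
      by (intro eventually_ball_finite) auto
    then show "eventually (\<lambda>y. dist (ordstat k i y) (ordstat k i x) < e) (at x within A)"
    proof (rule eventually_mono)
      fix y assume "\<forall>j\<in>{1..Suc k}. dist (y j) (x j) < e/2"
      then have "\<bar>ordstat k i y - ordstat k i x\<bar> \<le> e/2"
        by (intro ordstat_lipschitz assms) (auto simp: dist_real_def less_imp_le)
      then show "dist (ordstat k i y) (ordstat k i x) < e"
        using \<open>e > 0\<close> by (simp add: dist_real_def)
    qed
  qed
qed

text \<open>Makes \<open>h\<close> composed with \<open>gaps k\<close> an admissible test function
  for the limit law of the positions whenever \<open>h\<close> is bounded and continuous.\<close>

lemma continuous_on_gaps: "continuous_on A (gaps k)"
proof (rule continuous_on_coordinatewise_then_product)
  fix i
  show "continuous_on A (\<lambda>x. gaps k x i)"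
    by (cases "i \<in> {1..k}")
       (auto simp: gaps_ordstat intro!: continuous_intros continuous_on_ordstat)
qed

lemma borel_measurable_ordstat [measurable]:
  assumes "i \<le> k"
  shows "ordstat k i \<in> borel_measurable (PiM {1..Suc k} (\<lambda>_. borel))"
proof (rule borel_measurableI_le)
  fix a
  have eq: "card {j\<in>{1..Suc k}. x j \<le> a} = (\<Sum>j\<in>{1..Suc k}. of_bool (x j \<le> a))" for x :: "nat \<Rightarrow> real"
    by (simp only: card_eq_sum sum.inter_filter[OF finite_atLeastAtMost] of_bool_def)
  show "{x \<in> space (PiM {1..Suc k} (\<lambda>_. borel)). ordstat k i x \<le> a} \<in> sets (PiM {1..Suc k} (\<lambda>_. borel))"
    unfolding ordstat_le_iff[OF assms] eq by measurable
qed

lemma measurable_gaps [measurable]: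
  "gaps k \<in> PiM {1..Suc k} (\<lambda>_. borel) \<rightarrow>\<^sub>M PiM {1..k} (\<lambda>_. borel)"
  unfolding gaps_ordstat by (intro measurable_restrict borel_measurable_diff borel_measurable_ordstat) auto

section \<open>Rank permutations of distinct reals\<close>

definition rank_perm :: "nat \<Rightarrow> (nat \<Rightarrow> real) \<Rightarrow> (nat \<Rightarrow> nat) \<Rightarrow> bool" where
  "rank_perm k z \<tau> \<longleftrightarrow> (\<forall>i\<in>{0..k}. \<forall>j\<in>{0..k}. z i < z j \<longleftrightarrow> \<tau> i < \<tau> j)"

text \<open>The rank of index \<open>i\<close> is the number of smaller values, counted from 0.
  Uniqueness holds because any such permutation maps the indices of smaller values onto
  \<open>{..<\<tau> i}\<close>, which forces its value at \<open>i\<close>.\<close>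

lemma ex1_rank_perm:
  assumes "inj_on z {0..k}"
  shows "\<exists>!\<tau>. \<tau> permutes {0..k} \<and> rank_perm k z \<tau>"
proof -
  \<comment> \<open>Identity outside \<open>{0..k}\<close>, as \<open>permutes\<close>
    demands.\<close>
  define r where "r = (\<lambda>i. if i \<in> {0..k} then card {l\<in>{0..k}. z l < z i} else i)"
  have mono: "card {l\<in>{0..k}. z l < z i} < card {l\<in>{0..k}. z l < z j}"
    if "i \<in> {0..k}" "j \<in> {0..k}" "z i < z j" for i j
    using that by (intro psubset_card_mono) auto
  have iff: "z i < z j \<longleftrightarrow> r i < r j" if "i \<in> {0..k}" "j \<in> {0..k}" for i j
    using that mono[of i j] mono[of j i] inj_onD[OF assms, of i j]
    by (cases "z i" "z j" rule: linorder_cases) (auto simp: r_def)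
  have inj: "inj_on r {0..k}"
  proof (rule inj_onI)
    fix i j assume "i \<in> {0..k}" "j \<in> {0..k}" "r i = r j"
    then have "\<not> z i < z j" "\<not> z j < z i" using iff[of i j] iff[of j i] by simp_all
    then have "z i = z j" by simp
    then show "i = j" using inj_onD[OF assms] \<open>i \<in> {0..k}\<close> \<open>j \<in> {0..k}\<close> by blast
  qed
  have "r ` {0..k} \<subseteq> {0..k}"
  proof safe
    fix i assume i: "i \<in> {0..k}"
    have "{l\<in>{0..k}. z l < z i} \<subseteq> {0..k} - {i}" by auto
    then have "card {l\<in>{0..k}. z l < z i} \<le> card ({0..k} - {i})" by (intro card_mono) auto
    then show "r i \<in> {0..k}" using i by (simp add: r_def)
  qed
  then have "r ` {0..k} = {0..k}"
    using inj by (intro endo_inj_surj) auto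
  then have "bij_betw r {0..k} {0..k}" using inj by (simp add: bij_betw_def)
  then have perm: "r permutes {0..k}" by (rule bij_imp_permutes) (simp add: r_def)
  show ?thesis
  proof (rule ex1I[of _ r])
    show "r permutes {0..k} \<and> rank_perm k z r" using perm iff by (auto simp: rank_perm_def)
    fix \<tau> assume \<tau>: "\<tau> permutes {0..k} \<and> rank_perm k z \<tau>"
    show "\<tau> = r"
    proof (rule ext)
      fix i show "\<tau> i = r i"
      proof (cases "i \<in> {0..k}")
        case True
        have "bij_betw \<tau> {l\<in>{0..k}. z l < z i} {..<\<tau> i}"
        proof (rule bij_betw_subset[OF permutes_imp_bij[of \<tau> "{0..k}"]])
          show "\<tau> permutes {0..k}" using \<tau> by simp
          have ti: "\<tau> i \<le> k" using permutes_in_image[of \<tau> "{0..k}" i] \<tau> True by simp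
          show "\<tau> ` {l\<in>{0..k}. z l < z i} = {..<\<tau> i}"
          proof safe
            fix l assume "l \<in> {0..k}" "z l < z i"
            then show "\<tau> l < \<tau> i" using \<tau> True by (auto simp: rank_perm_def)
          next
            fix m assume m: "m < \<tau> i"
            then have "m \<in> \<tau> ` {0..k}" using ti permutes_image[of \<tau> "{0..k}"] \<tau> by auto
            then show "m \<in> \<tau> ` {l\<in>{0..k}. z l < z i}"
              using m \<tau> True by (auto simp: rank_perm_def)
          qed
        qed auto
        then have "card {l\<in>{0..k}. z l < z i} = \<tau> i"
          by (metis bij_betw_same_card card_lessThan)
        then show ?thesis using True by (simp add: r_def)
      next
        case False
        then show ?thesis using \<tau> by (auto simp: r_def permutes_not_in)
      qed
    qed
  qed
qed

section \<open>Exponential mixtures of centred Gaussian laws\<close>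

lemma has_derivative_std_normal_cdf:
  "(cdf std_normal_distribution has_real_derivative std_normal_density x) (at x)"
proof -
  interpret real_distribution std_normal_distribution by (rule real_dist_normal_dist)
  \<comment> \<open>A base point strictly to the left of \<open>x\<close>: near \<open>x\<close> the
    distribution function is then a constant plus the integral from \<open>a\<close>.\<close>
  define a where "a = x - 1"
  have cont: "continuous_on A std_normal_density" for A
    unfolding std_normal_density_def by (intro continuous_intros) auto
  have "((\<lambda>u. LBINT y=a..u. std_normal_density y) has_vector_derivative std_normal_density x)
          (at x within {x-1..x+1})"
    by (rule interval_integral_FTC2) (auto simp: a_def cont)
  then have "((\<lambda>u. LBINT y=a..u. std_normal_density y) has_vector_derivative std_normal_density x) (at x)"
    by (rule has_vector_derivative_within_open[THEN iffD1, rotated 2, OF has_vector_derivative_within_subset[of _ _ _ _ "{x-1<..<x+1}"]]) auto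
  then have "((\<lambda>u. cdf std_normal_distribution a + (LBINT y=a..u. std_normal_density y))
      has_real_derivative std_normal_density x) (at x)"
    unfolding has_real_derivative_iff_has_vector_derivative[symmetric]
    by (auto intro!: derivative_eq_intros)
  then show ?thesis
  proof (rule DERIV_cong_ev[THEN iffD1, rotated 3, OF _ refl _ refl])
    have "eventually (\<lambda>u. a < u) (nhds x)"
      by (intro eventually_nhds_in_open[of "{a<..}", simplified]) (auto simp: a_def)
    then show "eventually (\<lambda>u. cdf std_normal_distribution a + (LBINT y=a..u. std_normal_density y)
        = cdf std_normal_distribution u) (nhds x)"
    proof (rule eventually_mono)
      fix u assume u: "a < u"
      have "cdf std_normal_distribution u - cdf std_normal_distribution a
          = measure std_normal_distribution {a<..u}"
        using cdf_diff_eq[OF u] .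
      also have "\<dots> = (LBINT y:{a<..u}. std_normal_density y)"
      proof -
        have "measure std_normal_distribution {a<..u} = (LINT y|std_normal_distribution. indicator {a<..u} y)"
          by simp
        also have "\<dots> = (LBINT y. std_normal_density y *\<^sub>R indicator {a<..u} y)"
          by (subst integral_density) (auto simp: mult.commute)
        finally show ?thesis by (simp add: set_lebesgue_integral_def mult.commute)
      qed
      also have "\<dots> = (LBINT y=a..u. std_normal_density y)"
        using u by (simp add: interval_integral_Ioc)
      finally show "cdf std_normal_distribution a + (LBINT y=a..u. std_normal_density y)
        = cdf std_normal_distribution u" by simp
    qed
  qed
qed

definition laplace_density :: "real \<Rightarrow> real \<Rightarrow> real" where
  "laplace_density a x = a / 2 * exp (- a * \<bar>x\<bar>)"

text \<open>In the variable \<open>t\<close> the integrand has an explicit primitive built from the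
  normal distribution function. At infinity both of its terms survive, at 0 only the one with
  \<open>exp (a * b)\<close> does, and the difference is the Laplace density. Here
  \<open>x \<noteq> 0\<close> matters: it drives \<open>b / sqrt t\<close> to infinity at 0.\<close>

lemma exponential_mixture_of_normal_density:
  fixes c x :: real
  assumes c: "c > 0" and x: "x \<noteq> 0"
  shows "(\<integral>\<^sup>+t. ennreal (exponential_density c t * normal_density 0 (sqrt t) x) \<partial>lborel)
       = ennreal (laplace_density (sqrt (2 * c)) x)"
proof -
  define a b where "a = sqrt (2 * c)" and "b = \<bar>x\<bar>"
  have a: "a > 0" "a^2 = 2 * c" and b: "b > 0" "b^2 = x^2" using c x by (auto simp: a_def b_def)
  define \<Phi> where "\<Phi> = cdf std_normal_distribution"
  \<comment> \<open>\<open>a sqrt t \<plusminus> b / sqrt t\<close> are the two completions of the square of \<open>2 c t + b\<^sup>2 / t\<close>.\<close>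
  define G where "G = (\<lambda>t. a / 2 * (exp (a * b) * \<Phi> (a * sqrt t + b / sqrt t)
                                + exp (- (a * b)) * \<Phi> (a * sqrt t - b / sqrt t)))"
  define f where "f = (\<lambda>t. exponential_density c t * normal_density 0 (sqrt t) x)"
  interpret real_distribution std_normal_distribution by (rule real_dist_normal_dist)
  have top: "(\<Phi> \<longlongrightarrow> 1) at_top" and bot: "(\<Phi> \<longlongrightarrow> 0) at_bot"
    unfolding \<Phi>_def by (rule cdf_lim_at_top_prob cdf_lim_at_bot)+
  have deriv: "DERIV G t :> f t" if "t > 0" for t
  proof -
    have e1: "std_normal_density (a * sqrt t + b / sqrt t) = exp (- (a * b)) * exp (- c * t - b^2 / (2 * t)) / sqrt (2 * pi)"
    proof -
      have "(a * sqrt t + b / sqrt t)^2 / 2 = a * b + c * t + b^2 / (2 * t)"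
        using that a by (simp add: power2_sum power_mult_distrib power_divide field_simps power2_eq_square)
      then have "- ((a * sqrt t + b / sqrt t)^2) / 2 = - (a * b) + (- c * t - b^2 / (2 * t))" by linarith
      then show ?thesis unfolding std_normal_density_def by (simp add: exp_add[symmetric] algebra_simps)
    qed
    have e2: "std_normal_density (a * sqrt t - b / sqrt t) = exp (a * b) * exp (- c * t - b^2 / (2 * t)) / sqrt (2 * pi)"
    proof -
      have "(a * sqrt t - b / sqrt t)^2 / 2 = - (a * b) + c * t + b^2 / (2 * t)"
        using that a by (simp add: power2_diff power_mult_distrib power_divide field_simps power2_eq_square)
      then have "- ((a * sqrt t - b / sqrt t)^2) / 2 = (a * b) + (- c * t - b^2 / (2 * t))" by linarith
      then show ?thesis unfolding std_normal_density_def by (simp add: exp_add[symmetric] algebra_simps)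
    qed
    have d: "DERIV \<Phi> y :> std_normal_density y" for y
      unfolding \<Phi>_def by (rule has_derivative_std_normal_cdf)
    have ds: "DERIV sqrt t :> inverse (sqrt t) / 2"
      by (rule DERIV_real_sqrt[OF that])
    have dq: "DERIV (\<lambda>t. b / sqrt t) t :> - (b * (inverse (sqrt t) / 2) / t)"
      by (rule DERIV_cong[OF DERIV_divide[OF DERIV_const ds]]) (use that in auto)
    have d1: "DERIV (\<lambda>t. a * sqrt t + b / sqrt t) t :> a * (inverse (sqrt t) / 2) - b * (inverse (sqrt t) / 2) / t"
      by (rule DERIV_cong[OF DERIV_add[OF DERIV_cmult[OF ds] dq]]) simp
    have d2: "DERIV (\<lambda>t. a * sqrt t - b / sqrt t) t :> a * (inverse (sqrt t) / 2) + b * (inverse (sqrt t) / 2) / t"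
      by (rule DERIV_cong[OF DERIV_diff[OF DERIV_cmult[OF ds] dq]]) simp
    have "DERIV G t :> a / 2 * (exp (a * b) * (std_normal_density (a * sqrt t + b / sqrt t) * (a * (inverse (sqrt t) / 2) - b * (inverse (sqrt t) / 2) / t))
           + exp (- (a * b)) * (std_normal_density (a * sqrt t - b / sqrt t) * (a * (inverse (sqrt t) / 2) + b * (inverse (sqrt t) / 2) / t)))"
      unfolding G_def
      by (intro DERIV_cmult DERIV_add DERIV_chain2[OF d] d1 d2)
    also have "a / 2 * (exp (a * b) * (std_normal_density (a * sqrt t + b / sqrt t) * (a * (inverse (sqrt t) / 2) - b * (inverse (sqrt t) / 2) / t))
           + exp (- (a * b)) * (std_normal_density (a * sqrt t - b / sqrt t) * (a * (inverse (sqrt t) / 2) + b * (inverse (sqrt t) / 2) / t)))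
        = a / 2 * (exp (- c * t - b^2 / (2 * t)) / sqrt (2 * pi)) * ((exp (a * b) * exp (- (a * b))) * (a * inverse (sqrt t)))"
    proof -
      \<comment> \<open>\<open>A\<close> and \<open>Y\<close> come, up to sign, from the derivatives
        of \<open>a * sqrt t\<close> and \<open>b / sqrt t\<close>. The two completed squares carry
        inverse exponential factors, so the \<open>Y\<close> terms cancel and the \<open>A\<close>
        terms add up.\<close>
      have ring: "K * (P * (N * X / S * (A - Y)) + N * (P * X / S * (A + Y))) = K * (X / S) * (P * N * (2 * A))"
        for K P N X S A Y :: real by (simp add: algebra_simps add_divide_distrib diff_divide_distrib)
      show ?thesis unfolding e1 e2 ring by simp
    qed
    also have "exp (a * b) * exp (- (a * b)) = 1" by (simp add: exp_minus)
    also have "a / 2 * (exp (- c * t - b^2 / (2 * t)) / sqrt (2 * pi)) * (1 * (a * inverse (sqrt t)))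
        = a^2 / 2 * exp (- c * t - b^2 / (2 * t)) / (sqrt (2 * pi) * sqrt t)"
      by (simp add: power2_eq_square field_simps)
    also have "\<dots> = f t"
    proof -
      have e: "exp (- c * t - b^2 / (2 * t)) = exp (- t * c) * exp (- (x^2 / (2 * t)))"
        by (simp add: exp_add[symmetric] b mult.commute)
      show ?thesis
        using that unfolding f_def exponential_density_def normal_density_def a e
        by (simp add: real_sqrt_mult)
    qed
    finally show ?thesis .
  qed
  have cont: "isCont f t" if "t > 0" for t
  proof -
    have "isCont (\<lambda>t. c * exp (- t * c) * normal_density 0 (sqrt t) x) t"
      unfolding normal_density_def using that by (auto intro!: continuous_intros)
    moreover have "eventually (\<lambda>t. f t = c * exp (- t * c) * normal_density 0 (sqrt t) x) (nhds t)"
      using eventually_nhds_in_open[of "{0<..}" t] that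
      by (auto elim!: eventually_mono simp: f_def exponential_density_def)
    ultimately show ?thesis using isCont_cong by force
  qed
  have nonneg: "0 \<le> f t" for t
    using c by (auto simp: f_def exponential_density_def)
  have A: "((G \<circ> real_of_ereal) \<longlongrightarrow> a / 2 * (exp (a * b) * 1 + exp (- (a * b)) * 0)) (at_right 0)"
  proof -
    have "filterlim (\<lambda>t. a * sqrt t + b / sqrt t) at_top (at_right 0)" using a b by real_asymp
    moreover have "filterlim (\<lambda>t. a * sqrt t - b / sqrt t) at_bot (at_right 0)" using a b by real_asymp
    ultimately have "(G \<longlongrightarrow> a / 2 * (exp (a * b) * 1 + exp (- (a * b)) * 0)) (at_right 0)"
      unfolding G_def by (intro tendsto_intros filterlim_compose[OF top] filterlim_compose[OF bot])
    then show ?thesis by (simp add: zero_ereal_def ereal_tendsto_simps1)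
  qed
  have B: "((G \<circ> real_of_ereal) \<longlongrightarrow> a / 2 * (exp (a * b) * 1 + exp (- (a * b)) * 1)) (at_left \<infinity>)"
  proof -
    have "filterlim (\<lambda>t. a * sqrt t + b / sqrt t) at_top at_top" using a b by real_asymp
    moreover have "filterlim (\<lambda>t. a * sqrt t - b / sqrt t) at_top at_top" using a b by real_asymp
    ultimately have "(G \<longlongrightarrow> a / 2 * (exp (a * b) * 1 + exp (- (a * b)) * 1)) at_top"
      unfolding G_def by (intro tendsto_intros filterlim_compose[OF top])
    then show ?thesis by (simp add: ereal_tendsto_simps1)
  qed
  have deriv': "\<And>t. 0 < ereal t \<Longrightarrow> ereal t < \<infinity> \<Longrightarrow> DERIV G t :> f t" using deriv by (simp add: zero_ereal_def)
  have cont': "\<And>t. 0 < ereal t \<Longrightarrow> ereal t < \<infinity> \<Longrightarrow> isCont f t" using cont by (simp add: zero_ereal_def)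
  have nonneg': "AE t in lborel. 0 < ereal t \<longrightarrow> ereal t < \<infinity> \<longrightarrow> 0 \<le> f t" by (simp add: nonneg)
  have lt: "(0::ereal) < \<infinity>" by simp
  note FTC = interval_integral_FTC_nonneg[OF lt deriv' cont' nonneg' A B]
  have set_eq: "einterval 0 \<infinity> = {0<..}" by (auto simp: einterval_def zero_ereal_def)
  have int: "set_integrable lborel {0<..} f" using FTC(1) by (simp only: set_eq)
  have val: "(LBINT t:{0<..}. f t) = laplace_density a x"
    using FTC(2) by (simp add: interval_lebesgue_integral_def set_eq laplace_density_def b_def algebra_simps)
  have "(\<integral>\<^sup>+t. ennreal (f t) \<partial>lborel) = (\<integral>\<^sup>+t. ennreal (indicator {0<..} t *\<^sub>R f t) \<partial>lborel)"
  proof (rule nn_integral_cong_AE)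
    have "AE t in lborel. t \<noteq> (0::real)" by (rule AE_lborel_singleton)
    then show "AE t in lborel. ennreal (f t) = ennreal (indicator {0<..} t *\<^sub>R f t)"
      by eventually_elim (auto simp: f_def exponential_density_def split: split_indicator)
  qed
  also have "\<dots> = ennreal (LBINT t:{0<..}. f t)"
    unfolding set_lebesgue_integral_def
    using int nonneg by (intro nn_integral_eq_integral) (auto simp: set_integrable_def)
  also note val
  finally show ?thesis unfolding f_def a_def .
qed

text \<open>By Brownian scaling, \<open>sqrt t * z\<close> with \<open>z\<close> standard normal has
  the law of the value at time \<open>t\<close>, so this is Brownian motion at an exponential time.
  Tonelli exchanges time and space, and the density identity applies off
  \<open>x = 0\<close>.\<close>

lemma exponential_mixture_of_normal:
  fixes c :: real
  assumes c: "c > 0" and [measurable]: "g \<in> borel_measurable borel"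
  shows "(\<integral>\<^sup>+t. (\<integral>\<^sup>+z. g (sqrt t * z) \<partial>density lborel (std_normal_density)) \<partial>density lborel (exponential_density c))
       = (\<integral>\<^sup>+x. g x \<partial>density lborel (laplace_density (sqrt (2 * c))))"
proof -
  have [measurable]: "laplace_density a \<in> borel_measurable borel" for a
    unfolding laplace_density_def[abs_def] by measurable
  interpret std_normal: prob_space std_normal_distribution by (rule prob_space_normal_density) simp
  have inner: "(\<integral>\<^sup>+z. g (sqrt t * z) \<partial>density lborel (std_normal_density))
      = (\<integral>\<^sup>+x. ennreal (normal_density 0 (sqrt t) x) * g x \<partial>lborel)" if "t > 0" for t
  proof -
    have "(\<integral>\<^sup>+x. ennreal (normal_density 0 (sqrt t) x) * g x \<partial>lborel)
      = ennreal \<bar>sqrt t\<bar> * (\<integral>\<^sup>+z. ennreal (normal_density 0 (sqrt t) (0 + sqrt t * z)) * g (0 + sqrt t * z) \<partial>lborel)"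
      using that by (intro nn_integral_real_affine) auto
    also have "\<dots> = (\<integral>\<^sup>+z. ennreal (sqrt t) * (ennreal (normal_density 0 (sqrt t) (sqrt t * z)) * g (sqrt t * z)) \<partial>lborel)"
      using that by (subst nn_integral_cmult) auto
    also have "\<dots> = (\<integral>\<^sup>+z. ennreal (std_normal_density z) * g (sqrt t * z) \<partial>lborel)"
    proof (rule nn_integral_cong)
      fix z
      have "sqrt t * normal_density 0 (sqrt t) (sqrt t * z) = std_normal_density z"
        using that by (simp add: normal_density_def power_mult_distrib real_sqrt_mult)
      then show "ennreal (sqrt t) * (ennreal (normal_density 0 (sqrt t) (sqrt t * z)) * g (sqrt t * z))
          = ennreal (std_normal_density z) * g (sqrt t * z)"
        using that by (simp add: mult.assoc[symmetric] ennreal_mult[symmetric])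
    qed
    also have "\<dots> = (\<integral>\<^sup>+z. g (sqrt t * z) \<partial>density lborel (std_normal_density))"
      by (subst nn_integral_density) auto
    finally show ?thesis ..
  qed
  have m: "(\<lambda>(t, x). normal_density 0 (sqrt t) x) \<in> borel_measurable (borel \<Otimes>\<^sub>M borel)"
    unfolding normal_density_def by measurable
  then have [measurable]: "(\<lambda>(t, x). normal_density 0 (sqrt t) x) \<in> borel_measurable (lborel \<Otimes>\<^sub>M lborel)"
    by (simp cong: measurable_cong_sets add: sets_pair_measure_cong[OF sets_lborel sets_lborel])
  have "(\<integral>\<^sup>+t. (\<integral>\<^sup>+z. g (sqrt t * z) \<partial>density lborel (std_normal_density)) \<partial>density lborel (exponential_density c))
     = (\<integral>\<^sup>+t. ennreal (exponential_density c t) * (\<integral>\<^sup>+z. g (sqrt t * z) \<partial>density lborel (std_normal_density)) \<partial>lborel)"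
    by (subst nn_integral_density) (auto intro!: std_normal.borel_measurable_nn_integral)
  also have "\<dots> = (\<integral>\<^sup>+t. ennreal (exponential_density c t) * (\<integral>\<^sup>+x. ennreal (normal_density 0 (sqrt t) x) * g x \<partial>lborel) \<partial>lborel)"
  proof (rule nn_integral_cong_AE)
    \<comment> \<open>The point 0 is discarded; for negative \<open>t\<close> the exponential
      density annihilates both sides.\<close>
    have "AE t in lborel. t \<noteq> (0::real)" by (rule AE_lborel_singleton)
    then show "AE t in lborel. ennreal (exponential_density c t) * (\<integral>\<^sup>+z. g (sqrt t * z) \<partial>density lborel (std_normal_density))
      = ennreal (exponential_density c t) * (\<integral>\<^sup>+x. ennreal (normal_density 0 (sqrt t) x) * g x \<partial>lborel)"
      by eventually_elim (metis exponential_density_def inner ennreal_0 mult_zero_left not_less_iff_gr_or_eq)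
  qed
  also have "\<dots> = (\<integral>\<^sup>+t. (\<integral>\<^sup>+x. ennreal (exponential_density c t) * (ennreal (normal_density 0 (sqrt t) x) * g x) \<partial>lborel) \<partial>lborel)"
    by (intro nn_integral_cong nn_integral_cmult[symmetric]) measurable
  also have "\<dots> = (\<integral>\<^sup>+x. (\<integral>\<^sup>+t. ennreal (exponential_density c t) * (ennreal (normal_density 0 (sqrt t) x) * g x) \<partial>lborel) \<partial>lborel)"
    by (rule lborel_pair.Fubini'[symmetric]) measurable
  also have "\<dots> = (\<integral>\<^sup>+x. ennreal (laplace_density (sqrt (2 * c)) x) * g x \<partial>lborel)"
  proof (rule nn_integral_cong_AE)
    have "AE x in lborel. x \<noteq> (0::real)" by (rule AE_lborel_singleton)
    then show "AE x in lborel. (\<integral>\<^sup>+t. ennreal (exponential_density c t) * (ennreal (normal_density 0 (sqrt t) x) * g x) \<partial>lborel)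
      = ennreal (laplace_density (sqrt (2 * c)) x) * g x"
    proof eventually_elim
      fix x :: real assume x: "x \<noteq> 0"
      have "(\<integral>\<^sup>+t. ennreal (exponential_density c t) * (ennreal (normal_density 0 (sqrt t) x) * g x) \<partial>lborel)
          = (\<integral>\<^sup>+t. ennreal (exponential_density c t * normal_density 0 (sqrt t) x) * g x \<partial>lborel)"
        using c by (intro nn_integral_cong) (simp add: ennreal_mult exponential_density_nonneg mult.assoc)
      also have "\<dots> = (\<integral>\<^sup>+t. ennreal (exponential_density c t * normal_density 0 (sqrt t) x) \<partial>lborel) * g x"
        by (intro nn_integral_multc) measurable
      finally show "(\<integral>\<^sup>+t. ennreal (exponential_density c t) * (ennreal (normal_density 0 (sqrt t) x) * g x) \<partial>lborel)
          = ennreal (laplace_density (sqrt (2 * c)) x) * g x"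
        by (simp only: exponential_mixture_of_normal_density[OF c x])
    qed
  qed
  also have "\<dots> = (\<integral>\<^sup>+x. g x \<partial>density lborel (laplace_density (sqrt (2 * c))))"
    by (subst nn_integral_density) auto
  finally show ?thesis .
qed

section \<open>Lebesgue measure under partial sums and permutations\<close>

lemma borel_measurable_laplace_density [measurable]: "laplace_density a \<in> borel_measurable borel"
  unfolding laplace_density_def[abs_def] by measurable

lemma product_sigma_finite_density_lborel:
  fixes f :: "'i \<Rightarrow> real \<Rightarrow> real"
  assumes [measurable]: "\<And>i. f i \<in> borel_measurable borel"
  shows "product_sigma_finite (\<lambda>i. density lborel (\<lambda>x. ennreal (f i x)))"
proof (rule product_sigma_finite.intro)
  show "sigma_finite_measure (density lborel (\<lambda>x. ennreal (f i x)))" for i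
    by (subst sigma_finite_measure.sigma_finite_iff_density_finite[OF sigma_finite_lborel]) auto
qed

lemma PiM_density_lborel:
  fixes f :: "'i \<Rightarrow> real \<Rightarrow> real"
  assumes [simp]: "finite I" and [measurable]: "\<And>i. f i \<in> borel_measurable borel"
  shows "PiM I (\<lambda>i. density lborel (\<lambda>x. ennreal (f i x)))
       = density (PiM I (\<lambda>_. lborel)) (\<lambda>x. \<Prod>i\<in>I. ennreal (f i (x i)))"
proof -
  interpret D: product_sigma_finite "\<lambda>i. density lborel (\<lambda>x. ennreal (f i x))"
    by (rule product_sigma_finite_density_lborel) measurable
  interpret L: product_sigma_finite "\<lambda>_::'i. lborel :: real measure" by standard
  show ?thesis
  proof (rule D.PiM_eqI[symmetric])
    show "sets (density (PiM I (\<lambda>_. lborel)) (\<lambda>x. \<Prod>i\<in>I. ennreal (f i (x i))))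
        = sets (PiM I (\<lambda>i. density lborel (\<lambda>x. ennreal (f i x))))"
      by (simp add: sets_density cong: sets_PiM_cong)
    fix A :: "'i \<Rightarrow> real set"
    assume "\<And>i. i \<in> I \<Longrightarrow> A i \<in> sets (density lborel (\<lambda>x. ennreal (f i x)))"
    then have A [measurable]: "i \<in> I \<Longrightarrow> A i \<in> sets borel" for i by simp
    have "emeasure (density (PiM I (\<lambda>_. lborel)) (\<lambda>x. \<Prod>i\<in>I. ennreal (f i (x i)))) (Pi\<^sub>E I A)
        = (\<integral>\<^sup>+x. (\<Prod>i\<in>I. ennreal (f i (x i))) * indicator (Pi\<^sub>E I A) x \<partial>PiM I (\<lambda>_. lborel))"
      by (subst emeasure_density) (auto intro!: sets_PiM_I_finite)
    also have "\<dots> = (\<integral>\<^sup>+x. (\<Prod>i\<in>I. ennreal (f i (x i)) * indicator (A i) (x i)) \<partial>PiM I (\<lambda>_. lborel))"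
    proof (rule nn_integral_cong)
      fix x assume "x \<in> space (PiM I (\<lambda>_. lborel :: real measure))"
      then have "x \<in> extensional I" by (simp add: space_PiM PiE_def)
      then have "indicator (Pi\<^sub>E I A) x = (\<Prod>i\<in>I. indicator (A i) (x i) :: ennreal)"
        by (auto simp: PiE_def indicator_def Pi_def intro!: prod.neutral[symmetric] prod.neutral)
      then show "(\<Prod>i\<in>I. ennreal (f i (x i))) * indicator (Pi\<^sub>E I A) x
          = (\<Prod>i\<in>I. ennreal (f i (x i)) * indicator (A i) (x i))"
        by (simp add: prod.distrib)
    qed
    also have "\<dots> = (\<Prod>i\<in>I. \<integral>\<^sup>+x. ennreal (f i x) * indicator (A i) x \<partial>lborel)"
      by (rule L.product_nn_integral_prod) auto
    also have "\<dots> = (\<Prod>i\<in>I. emeasure (density lborel (\<lambda>x. ennreal (f i x))) (A i))"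
      by (intro prod.cong refl emeasure_density[symmetric]) auto
    finally show "emeasure (density (PiM I (\<lambda>_. lborel)) (\<lambda>x. \<Prod>i\<in>I. ennreal (f i (x i)))) (Pi\<^sub>E I A)
        = (\<Prod>i\<in>I. emeasure (density lborel (\<lambda>x. ennreal (f i x))) (A i))" .
  qed simp
qed

abbreviation lebesgue_PiM :: "nat \<Rightarrow> (nat \<Rightarrow> real) measure" where
  "lebesgue_PiM n \<equiv> PiM {0..n} (\<lambda>_. lborel)"

lemma measurable_PiM_lborel [measurable_cong]:
  "sets (PiM I (\<lambda>_. lborel)) = sets (PiM I (\<lambda>_. borel :: real measure))"
  by (intro sets_PiM_cong) auto

interpretation lborel_PiM: product_sigma_finite "\<lambda>_::nat. lborel :: real measure" by standard

text \<open>Coordinate 0 is a base height and the others are increments. The same map serves a walk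
  in time order and the sorted heights built from their gaps.\<close>

definition psum :: "nat \<Rightarrow> (nat \<Rightarrow> real) \<Rightarrow> nat \<Rightarrow> real" where
  "psum n y = (\<lambda>j\<in>{0..n}. \<Sum>i\<in>{0..j}. y i)"

lemma measurable_psum [measurable]:
  "psum n \<in> PiM {0..n} (\<lambda>_. borel) \<rightarrow>\<^sub>M PiM {0..n} (\<lambda>_. borel)"
  unfolding psum_def[abs_def] by (intro measurable_restrict borel_measurable_sum measurable_component_singleton) auto

text \<open>The map is triangular with unit diagonal. In the induction the last coordinate is merely
  translated by the sum of the earlier ones.\<close>

lemma nn_integral_psum:
  assumes "F \<in> borel_measurable (PiM {0..n} (\<lambda>_. borel))"
  shows "(\<integral>\<^sup>+y. F (psum n y) \<partial>lebesgue_PiM n) = (\<integral>\<^sup>+y. F y \<partial>lebesgue_PiM n)"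
  using assms
proof (induction n arbitrary: F)
  case 0
  have "psum 0 y = y" if "y \<in> space (lebesgue_PiM 0)" for y
    using that by (auto simp: psum_def space_PiM PiE_def extensional_def fun_eq_iff)
  then show ?case by (intro nn_integral_cong) simp
next
  case (Suc n)
  note [measurable] = Suc.prems
  have ins: "{0..Suc n} = insert (Suc n) {0..n}" by auto
  have [measurable]: "F \<in> borel_measurable (PiM (insert (Suc n) {0..n}) (\<lambda>_. borel))"
    using Suc.prems by (simp add: ins)
  have "(\<integral>\<^sup>+y. F (psum (Suc n) y) \<partial>lebesgue_PiM (Suc n))
      = (\<integral>\<^sup>+x. (\<integral>\<^sup>+y. F (psum (Suc n) (x(Suc n := y))) \<partial>lborel) \<partial>lebesgue_PiM n)"
    unfolding ins by (rule lborel_PiM.product_nn_integral_insert) (auto simp: ins[symmetric])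
  also have "\<dots> = (\<integral>\<^sup>+x. (\<integral>\<^sup>+y. F ((psum n x)(Suc n := y)) \<partial>lborel) \<partial>lebesgue_PiM n)"
  proof (rule nn_integral_cong)
    fix x assume x: "x \<in> space (lebesgue_PiM n)"
    have eq: "psum (Suc n) (x(Suc n := y)) = (psum n x)(Suc n := (\<Sum>i\<in>{0..n}. x i) + y)" for y
      by (auto simp: psum_def fun_eq_iff intro!: sum.cong)
    have *: "psum n x \<in> space (PiM {0..n} (\<lambda>_. borel))" by (simp add: psum_def space_PiM)
    have [measurable]: "(\<lambda>y. F ((psum n x)(Suc n := y))) \<in> borel_measurable borel"
      using * by measurable
    have "(\<integral>\<^sup>+y. F ((psum n x)(Suc n := y)) \<partial>lborel)
        = ennreal \<bar>1\<bar> * (\<integral>\<^sup>+y. F ((psum n x)(Suc n := (\<Sum>i\<in>{0..n}. x i) + 1 * y)) \<partial>lborel)"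
      by (rule nn_integral_real_affine) auto
    then show "(\<integral>\<^sup>+y. F (psum (Suc n) (x(Suc n := y))) \<partial>lborel)
        = (\<integral>\<^sup>+y. F ((psum n x)(Suc n := y)) \<partial>lborel)"
      by (simp add: eq)
  qed
  also have "\<dots> = (\<integral>\<^sup>+x. (\<integral>\<^sup>+y. F (x(Suc n := y)) \<partial>lborel) \<partial>lebesgue_PiM n)"
    by (rule Suc.IH) measurable
  also have "\<dots> = (\<integral>\<^sup>+y. F y \<partial>lebesgue_PiM (Suc n))"
    unfolding ins by (rule lborel_PiM.product_nn_integral_insert[symmetric]) auto
  finally show ?case .
qed

text \<open>Boxes pull back to boxes with permuted sides, which have the same volume.\<close>

lemma nn_integral_permute:
  assumes \<tau>: "\<tau> permutes {0..k}" and [measurable]: "F \<in> borel_measurable (PiM {0..k} (\<lambda>_. borel))"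
  shows "(\<integral>\<^sup>+w. F (\<lambda>j\<in>{0..k}. w (\<tau> j)) \<partial>lebesgue_PiM k) = (\<integral>\<^sup>+w. F w \<partial>lebesgue_PiM k)"
proof -
  have in_k: "\<tau> j \<in> {0..k} \<longleftrightarrow> j \<in> {0..k}" for j using permutes_in_image[OF \<tau>] .
  have in_k': "inv \<tau> j \<in> {0..k} \<longleftrightarrow> j \<in> {0..k}" for j using permutes_in_image[OF permutes_inv[OF \<tau>]] .
  have [measurable]: "(\<lambda>w. \<lambda>j\<in>{0..k}. w (\<tau> j)) \<in> PiM {0..k} (\<lambda>_. borel) \<rightarrow>\<^sub>M PiM {0..k} (\<lambda>_. borel :: real measure)"
    using in_k by (intro measurable_restrict measurable_component_singleton) auto
  have "distr (lebesgue_PiM k) (PiM {0..k} (\<lambda>_. borel)) (\<lambda>w. \<lambda>j\<in>{0..k}. w (\<tau> j)) = lebesgue_PiM k"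
  proof (rule lborel_PiM.PiM_eqI)
    fix A :: "nat \<Rightarrow> real set" assume "\<And>i. i \<in> {0..k} \<Longrightarrow> A i \<in> sets lborel"
    then have A [measurable]: "\<And>i. i \<in> {0..k} \<Longrightarrow> A i \<in> sets borel" by simp
    have vimage: "(\<lambda>w. \<lambda>j\<in>{0..k}. w (\<tau> j)) -` Pi\<^sub>E {0..k} A \<inter> space (lebesgue_PiM k)
        = Pi\<^sub>E {0..k} (\<lambda>i. A (inv \<tau> i))"
    proof (intro equalityI subsetI)
      fix w assume w: "w \<in> (\<lambda>w. \<lambda>j\<in>{0..k}. w (\<tau> j)) -` Pi\<^sub>E {0..k} A \<inter> space (lebesgue_PiM k)"
      show "w \<in> Pi\<^sub>E {0..k} (\<lambda>i. A (inv \<tau> i))"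
      proof
        fix i assume "i \<in> {0..k}"
        then have "inv \<tau> i \<in> {0..k}" using in_k' by blast
        then have "w (\<tau> (inv \<tau> i)) \<in> A (inv \<tau> i)" using w by (auto simp: PiE_iff)
        then show "w i \<in> A (inv \<tau> i)" by (simp add: permutes_inverses[OF \<tau>])
      qed (use w in \<open>auto simp: space_PiM PiE_def extensional_def\<close>)
    next
      fix w assume w: "w \<in> Pi\<^sub>E {0..k} (\<lambda>i. A (inv \<tau> i))"
      have "w (\<tau> j) \<in> A j" if "j \<in> {0..k}" for j
        using PiE_mem[OF w, of "\<tau> j"] that in_k by (simp add: permutes_inverses[OF \<tau>])
      then show "w \<in> (\<lambda>w. \<lambda>j\<in>{0..k}. w (\<tau> j)) -` Pi\<^sub>E {0..k} A \<inter> space (lebesgue_PiM k)"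
        using w by (auto simp: space_PiM PiE_def)
    qed
    have "emeasure (distr (lebesgue_PiM k) (PiM {0..k} (\<lambda>_. borel)) (\<lambda>w. \<lambda>j\<in>{0..k}. w (\<tau> j))) (Pi\<^sub>E {0..k} A)
        = emeasure (lebesgue_PiM k) (Pi\<^sub>E {0..k} (\<lambda>i. A (inv \<tau> i)))"
      by (subst emeasure_distr) (auto simp: vimage intro!: sets_PiM_I_finite)
    also have "\<dots> = (\<Prod>i\<in>{0..k}. emeasure lborel (A (inv \<tau> i)))"
      using in_k' A by (intro lborel_PiM.emeasure_PiM) auto
    also have "\<dots> = (\<Prod>i\<in>{0..k}. emeasure lborel (A i))"
      using prod.permute[OF permutes_inv[OF \<tau>], of "\<lambda>i. emeasure lborel (A i)"] by (simp add: comp_def)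
    finally show "emeasure (distr (lebesgue_PiM k) (PiM {0..k} (\<lambda>_. borel)) (\<lambda>w. \<lambda>j\<in>{0..k}. w (\<tau> j))) (Pi\<^sub>E {0..k} A)
        = (\<Prod>i\<in>{0..k}. emeasure lborel (A i))" .
  qed (auto simp: measurable_PiM_lborel)
  then have "(\<integral>\<^sup>+w. F w \<partial>lebesgue_PiM k)
      = (\<integral>\<^sup>+w. F w \<partial>distr (lebesgue_PiM k) (PiM {0..k} (\<lambda>_. borel)) (\<lambda>w. \<lambda>j\<in>{0..k}. w (\<tau> j)))" by simp
  also have "\<dots> = (\<integral>\<^sup>+w. F (\<lambda>j\<in>{0..k}. w (\<tau> j)) \<partial>lebesgue_PiM k)"
    by (rule nn_integral_distr) measurable
  finally show ?thesis by simp
qed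

text \<open>Once the other coordinates are fixed, \<open>h\<close> is constant and excludes a single
  value of coordinate \<open>i\<close>. This rules out ties between positions and gaps equal to
  0.\<close>

lemma AE_PiM_lborel_neq:
  fixes i :: nat and I :: "nat set"
  assumes I: "finite I" "i \<in> I" and [measurable]: "h \<in> borel_measurable (PiM I (\<lambda>_. borel))"
    and h: "\<And>x y. h (x(i := y)) = h x"
  shows "AE x in PiM I (\<lambda>_. lborel). x i \<noteq> (h x :: real)"
proof -
  define J where "J = I - {i}"
  have J: "finite J" "i \<notin> J" "I = insert i J" using I by (auto simp: J_def)
  have m [measurable]: "(\<lambda>x. x i) \<in> borel_measurable (PiM I (\<lambda>_. borel))"
    using I by (intro measurable_component_singleton)
  have [measurable]: "{x \<in> space (PiM I (\<lambda>_. lborel)). x i = h x} \<in> sets (PiM I (\<lambda>_. borel))"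
    using borel_measurable_eq[OF m assms(3)] by (simp add: space_PiM)
  have "emeasure (PiM I (\<lambda>_. lborel)) {x \<in> space (PiM I (\<lambda>_. lborel)). x i = h x}
     = (\<integral>\<^sup>+x. indicator {x \<in> space (PiM I (\<lambda>_. lborel)). x i = h x} x \<partial>PiM I (\<lambda>_. lborel))"
    by simp
  also have "\<dots> = (\<integral>\<^sup>+x. (\<integral>\<^sup>+y. indicator {x \<in> space (PiM I (\<lambda>_. lborel)). x i = h x} (x(i := y)) \<partial>lborel) \<partial>PiM J (\<lambda>_. lborel))"
    unfolding J(3) by (rule lborel_PiM.product_nn_integral_insert[OF J(1,2)]) (simp add: J(3)[symmetric])
  also have "\<dots> = (\<integral>\<^sup>+x. 0 \<partial>PiM J (\<lambda>_. lborel :: real measure))"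
  proof (rule nn_integral_cong)
    fix x
    have "(\<integral>\<^sup>+y. indicator {x \<in> space (PiM I (\<lambda>_. lborel)). x i = h x} (x(i := y)) \<partial>lborel)
        \<le> (\<integral>\<^sup>+y. indicator {h x} y \<partial>lborel)"
      by (intro nn_integral_mono) (auto simp: h split: split_indicator)
    then show "(\<integral>\<^sup>+y. indicator {x \<in> space (PiM I (\<lambda>_. lborel)). x i = h x} (x(i := y)) \<partial>lborel) = 0"
      by simp
  qed
  finally have "emeasure (PiM I (\<lambda>_. lborel)) {x \<in> space (PiM I (\<lambda>_. lborel)). x i = h x} = 0" by simp
  then show ?thesis
    by (intro AE_I[of _ _ "{x \<in> space (PiM I (\<lambda>_. lborel)). x i = h x}"]) auto
qed

lemma AE_inj_on_lebesgue_PiM: "AE z in lebesgue_PiM k. inj_on z {0..k}"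
proof -
  have *: "AE z in lebesgue_PiM k. z i \<noteq> z j" if "i \<in> {0..k}" "j \<in> {0..k}" "i \<noteq> j" for i j
    using that by (intro AE_PiM_lborel_neq) (auto intro!: measurable_component_singleton)
  have "AE z in lebesgue_PiM k. \<forall>i\<in>{0..k}. \<forall>j\<in>{0..k}. i \<noteq> j \<longrightarrow> z i \<noteq> z j"
    using * by (intro AE_finite_allI) (auto simp: AE_finite_allI)
  then show ?thesis by eventually_elim (auto simp: inj_on_def)
qed

section \<open>Crossed levels and the exchange of exponents\<close>

lemma Eset_nonempty:
  assumes \<tau>: "\<tau> permutes {0..k}" and i: "i \<in> {1..k}"
  shows "Eset k \<tau> i \<noteq> {}"
proof
  assume "Eset k \<tau> i = {}"
  then have step: "\<tau> (j - 1) < i \<longleftrightarrow> \<tau> j < i" if "j \<in> {1..k}" for j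
  proof -
    have "\<not> (min (\<tau> (j - 1)) (\<tau> j) < i \<and> i \<le> max (\<tau> (j - 1)) (\<tau> j))"
      using that \<open>Eset k \<tau> i = {}\<close> unfolding Eset_def by blast
    then show ?thesis by (auto simp: min_def max_def split: if_splits)
  qed
  \<comment> \<open>A discrete intermediate value argument: without a crossing between heights
    \<open>i - 1\<close> and \<open>i\<close>, the walk \<open>\<tau>\<close> stays on one side, yet
    a permutation attains both 0 and \<open>k\<close>.\<close>
  have all: "j \<le> k \<Longrightarrow> \<tau> j < i \<longleftrightarrow> \<tau> 0 < i" for j
    proof (induction j)
    case (Suc j)
    then show ?case using step[of "Suc j"] by simp
  qed simp
  have "0 \<in> \<tau> ` {0..k}" "k \<in> \<tau> ` {0..k}" using permutes_image[OF \<tau>] by auto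
  then obtain a b where "a \<le> k" "\<tau> a = 0" "b \<le> k" "\<tau> b = k" by auto
  then show False using all[of a] all[of b] i by auto
qed

lemma Fcomp_pos:
  assumes "\<tau> permutes {0..k}" "i \<in> {1..k}" "\<And>j. j \<in> {1..k} \<Longrightarrow> 0 < c j"
  shows "0 < Fcomp k \<tau> c i"
  unfolding Fcomp_def using Eset_nonempty[OF assms(1,2)] assms(3)
  by (intro sum_pos) (auto simp: Eset_def)

lemma wt_nonneg:
  assumes "\<tau> permutes {0..k}" "\<And>j. j \<in> {1..k} \<Longrightarrow> 0 < c j"
  shows "0 \<le> wt k \<tau> c"
  unfolding wt_def using Fcomp_pos[OF assms(1) _ assms(2)] assms(2)
  by (intro mult_nonneg_nonneg prod_nonneg) (auto intro!: divide_nonneg_pos less_imp_le)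

lemma psum_diff:
  assumes "a \<le> b" "b \<le> k"
  shows "psum k g b - psum k g a = (\<Sum>i\<in>{a<..b}. g i)"
proof -
  have "{0..b} = {0..a} \<union> {a<..b}" using assms by auto
  then have "(\<Sum>i\<in>{0..b}. g i) = (\<Sum>i\<in>{0..a}. g i) + (\<Sum>i\<in>{a<..b}. g i)"
    by (metis sum.union_disjoint[of "{0..a}" "{a<..b}" g] finite_atLeastAtMost
        finite_greaterThanAtMost ivl_disj_int_two(8))
  moreover have "psum k g b = (\<Sum>i\<in>{0..b}. g i)" "psum k g a = (\<Sum>i\<in>{0..a}. g i)"
    using assms by (simp_all add: psum_def)
  ultimately show ?thesis by linarith
qed

text \<open>The exponents are exchanged by writing each jump as the sum of the gaps it crosses.\<close>
lemma prod_laplace_density_eq: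
  assumes \<tau>: "\<tau> permutes {0..k}" and c: "\<And>j. j \<in> {1..k} \<Longrightarrow> 0 < c j"
    and g: "\<And>i. i \<in> {1..k} \<Longrightarrow> 0 < g i"
  shows "(\<Prod>j\<in>{1..k}. laplace_density (sqrt (2 * c j)) (psum k g (\<tau> j) - psum k g (\<tau> (j - 1))))
       = wt k \<tau> c * (\<Prod>i\<in>{1..k}. exponential_density (Fcomp k \<tau> c i) (g i))"
proof -
  \<comment> \<open>Gap \<open>i\<close> separates the heights \<open>i - 1\<close> and
    \<open>i\<close>, so \<open>Eset k \<tau> i\<close> is the set of jumps that pass over
    it.\<close>
  have jump: "\<bar>psum k g (\<tau> j) - psum k g (\<tau> (j - 1))\<bar> = (\<Sum>i\<in>{1..k}. if j \<in> Eset k \<tau> i then g i else 0)"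
    if j: "j \<in> {1..k}" for j
  proof -
    define a b where "a = min (\<tau> (j - 1)) (\<tau> j)" and "b = max (\<tau> (j - 1)) (\<tau> j)"
    have "\<tau> j \<in> {0..k}" "\<tau> (j - 1) \<in> {0..k}"
      using permutes_in_image[OF \<tau>, of j] permutes_in_image[OF \<tau>, of "j - 1"] j by auto
    then have ab: "a \<le> b" "b \<le> k" by (auto simp: a_def b_def)
    have "\<bar>psum k g (\<tau> j) - psum k g (\<tau> (j - 1))\<bar> = \<bar>psum k g b - psum k g a\<bar>"
      by (auto simp: a_def b_def min_def max_def)
    also have "\<dots> = (\<Sum>i\<in>{a<..b}. g i)"
      using ab g unfolding psum_diff[OF ab] by (intro abs_of_nonneg sum_nonneg less_imp_le g) auto
    also have "{a<..b} = {i\<in>{1..k}. j \<in> Eset k \<tau> i}"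
      using ab j by (auto simp: Eset_def a_def b_def)
    finally show ?thesis by (simp only: sum.inter_filter[OF finite_atLeastAtMost])
  qed
  have "(\<Sum>j\<in>{1..k}. sqrt (2 * c j) * \<bar>psum k g (\<tau> j) - psum k g (\<tau> (j - 1))\<bar>)
      = (\<Sum>j\<in>{1..k}. \<Sum>i\<in>{1..k}. if j \<in> Eset k \<tau> i then sqrt (2 * c j) * g i else 0)"
  proof (rule sum.cong[OF refl])
    fix j assume j: "j \<in> {1..k}"
    show "sqrt (2 * c j) * \<bar>psum k g (\<tau> j) - psum k g (\<tau> (j - 1))\<bar>
        = (\<Sum>i\<in>{1..k}. if j \<in> Eset k \<tau> i then sqrt (2 * c j) * g i else 0)"
      unfolding jump[OF j] sum_distrib_left by (intro sum.cong) auto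
  qed
  also have "\<dots> = (\<Sum>i\<in>{1..k}. \<Sum>j\<in>{1..k}. if j \<in> Eset k \<tau> i then sqrt (2 * c j) * g i else 0)"
    by (rule sum.swap)
  also have "\<dots> = (\<Sum>i\<in>{1..k}. Fcomp k \<tau> c i * g i)"
  proof (rule sum.cong[OF refl])
    fix i
    have "(\<Sum>j\<in>{1..k}. if j \<in> Eset k \<tau> i then sqrt (2 * c j) * g i else 0)
        = (\<Sum>j\<in>{j\<in>{1..k}. j \<in> Eset k \<tau> i}. sqrt (2 * c j) * g i)"
      by (simp only: sum.inter_filter[OF finite_atLeastAtMost])
    also have "{j\<in>{1..k}. j \<in> Eset k \<tau> i} = Eset k \<tau> i" by (auto simp: Eset_def)
    finally show "(\<Sum>j\<in>{1..k}. if j \<in> Eset k \<tau> i then sqrt (2 * c j) * g i else 0) = Fcomp k \<tau> c i * g i"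
      by (simp add: Fcomp_def sum_distrib_right)
  qed
  finally have expo: "(\<Sum>j\<in>{1..k}. sqrt (2 * c j) * \<bar>psum k g (\<tau> j) - psum k g (\<tau> (j - 1))\<bar>)
      = (\<Sum>i\<in>{1..k}. Fcomp k \<tau> c i * g i)" .
  have "(\<Prod>j\<in>{1..k}. laplace_density (sqrt (2 * c j)) (psum k g (\<tau> j) - psum k g (\<tau> (j - 1))))
      = (\<Prod>j\<in>{1..k}. sqrt (2 * c j) / 2) * exp (- (\<Sum>j\<in>{1..k}. sqrt (2 * c j) * \<bar>psum k g (\<tau> j) - psum k g (\<tau> (j - 1))\<bar>))"
    unfolding laplace_density_def prod.distrib sum_negf[symmetric] by (simp add: exp_sum)
  also have "\<dots> = (1 / 2 ^ k) * (\<Prod>j\<in>{1..k}. sqrt (2 * c j)) * (\<Prod>i\<in>{1..k}. exp (- (Fcomp k \<tau> c i * g i)))"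
    unfolding expo sum_negf[symmetric] by (simp add: exp_sum prod_dividef)
  also have "\<dots> = (1 / 2 ^ k) * (\<Prod>i\<in>{1..k}. sqrt (2 * c i) * exp (- (Fcomp k \<tau> c i * g i)))"
    by (simp add: prod.distrib)
  \<comment> \<open>Each factor is completed to an exponential density by its normalising constant
    \<open>Fcomp k \<tau> c i\<close>; compensating for it produces the quotient in
    \<open>wt\<close>.\<close>
  also have "(\<Prod>i\<in>{1..k}. sqrt (2 * c i) * exp (- (Fcomp k \<tau> c i * g i)))
      = (\<Prod>i\<in>{1..k}. sqrt (2 * c i) / Fcomp k \<tau> c i * exponential_density (Fcomp k \<tau> c i) (g i))"
  proof (rule prod.cong[OF refl])
    fix i assume "i \<in> {1..k}"
    then have "0 < Fcomp k \<tau> c i" "0 < g i" using Fcomp_pos[OF \<tau> _ c] g by auto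
    then show "sqrt (2 * c i) * exp (- (Fcomp k \<tau> c i * g i))
        = sqrt (2 * c i) / Fcomp k \<tau> c i * exponential_density (Fcomp k \<tau> c i) (g i)"
      by (simp add: exponential_density_def mult.commute)
  qed
  also have "(1 / 2 ^ k) * \<dots> = wt k \<tau> c * (\<Prod>i\<in>{1..k}. exponential_density (Fcomp k \<tau> c i) (g i))"
    by (simp only: wt_def prod.distrib mult.assoc)
  finally show ?thesis .
qed

section \<open>Gaps of a walk with Laplace steps\<close>

text \<open>Position 1 is the empty sum, so the walk starts at 0. Indices run from 1 to fit
  \<open>gaps\<close>, whereas \<open>psum\<close> and the permutations index the same points from
  0.\<close>

definition pos :: "nat \<Rightarrow> (nat \<Rightarrow> real) \<Rightarrow> nat \<Rightarrow> real" where
  "pos k y = (\<lambda>j\<in>{1..Suc k}. \<Sum>i\<in>{1..<j}. y i)"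

lemma measurable_pos [measurable]:
  "pos k \<in> PiM {1..k} (\<lambda>_. borel) \<rightarrow>\<^sub>M PiM {1..Suc k} (\<lambda>_. borel)"
  unfolding pos_def[abs_def] by (intro measurable_restrict borel_measurable_sum measurable_component_singleton) auto

definition exp_law :: "nat \<Rightarrow> (nat \<Rightarrow> real) \<Rightarrow> (nat \<Rightarrow> real) measure" where
  "exp_law k c = PiM {1..k} (\<lambda>i. density lborel (\<lambda>x. ennreal (exponential_density (c i) x)))"

definition laplace_law :: "nat \<Rightarrow> (nat \<Rightarrow> real) \<Rightarrow> (nat \<Rightarrow> real) measure" where
  "laplace_law k c = PiM {1..k} (\<lambda>i. density lborel (\<lambda>x. ennreal (laplace_density (sqrt (2 * c i)) x)))"

lemma sets_exp_law [measurable_cong, simp]: "sets (exp_law k c) = sets (PiM {1..k} (\<lambda>_. borel))"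
  unfolding exp_law_def by (intro sets_PiM_cong) auto

lemma sets_laplace_law [measurable_cong, simp]: "sets (laplace_law k c) = sets (PiM {1..k} (\<lambda>_. borel))"
  unfolding laplace_law_def by (intro sets_PiM_cong) auto

lemma nn_integral_exp_law:
  assumes [measurable]: "f \<in> borel_measurable (PiM {1..k} (\<lambda>_. borel))"
  shows "(\<integral>\<^sup>+x. f x \<partial>exp_law k c)
       = (\<integral>\<^sup>+x. (\<Prod>i\<in>{1..k}. ennreal (exponential_density (c i) (x i))) * f x \<partial>PiM {1..k} (\<lambda>_. lborel))"
proof -
  have "exp_law k c = density (PiM {1..k} (\<lambda>_. lborel)) (\<lambda>x. \<Prod>i\<in>{1..k}. ennreal (exponential_density (c i) (x i)))"
    unfolding exp_law_def by (rule PiM_density_lborel) auto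
  then show ?thesis
    by (simp only:) (rule nn_integral_density, measurable)
qed

lemma nn_integral_laplace_law:
  assumes [measurable]: "f \<in> borel_measurable (PiM {1..k} (\<lambda>_. borel))"
  shows "(\<integral>\<^sup>+x. f x \<partial>laplace_law k c)
       = (\<integral>\<^sup>+x. (\<Prod>i\<in>{1..k}. ennreal (laplace_density (sqrt (2 * c i)) (x i))) * f x \<partial>PiM {1..k} (\<lambda>_. lborel))"
proof -
  have "laplace_law k c = density (PiM {1..k} (\<lambda>_. lborel)) (\<lambda>x. \<Prod>i\<in>{1..k}. ennreal (laplace_density (sqrt (2 * c i)) (x i)))"
    unfolding laplace_law_def by (rule PiM_density_lborel) auto
  then show ?thesis
    by (simp only:) (rule nn_integral_density, measurable)
qed

text \<open>A window of length 1 has mass 1 wherever it is moved, so it can be integrated out even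
  when its shift depends on other coordinates.\<close>

lemma nn_integral_unit_window:
  "(\<integral>\<^sup>+t. indicator {0..1} (t + a) * C \<partial>lborel) = (C::ennreal)" for a :: real
proof -
  have "(\<integral>\<^sup>+t. indicator {0..1} (t + a) * C \<partial>lborel) = (\<integral>\<^sup>+t. C * indicator {-a..1-a} t \<partial>lborel)"
    by (intro nn_integral_cong) (auto split: split_indicator)
  also have "\<dots> = C" by (subst nn_integral_cmult_indicator) auto
  finally show ?thesis .
qed

text \<open>The extra coordinate makes the \<open>k + 1\<close> positions exchangeable under Lebesgue measure.\<close>
lemma nn_integral_add_coordinate:
  assumes [measurable]: "G \<in> borel_measurable (PiM {1..k} (\<lambda>_. borel))"
    and a: "\<And>x y. a (x(0 := y)) = a x" and [measurable]: "a \<in> borel_measurable (PiM {0..k} (\<lambda>_. borel))"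
  shows "(\<integral>\<^sup>+y. indicator {0..1} (y 0 + a y :: real) * G (restrict y {1..k}) \<partial>lebesgue_PiM k)
       = (\<integral>\<^sup>+x. G x \<partial>PiM {1..k} (\<lambda>_. lborel))"
proof -
  have ins: "insert 0 {1..k} = {0..k}" by auto
  have [measurable]: "(\<lambda>y. restrict y {1..k}) \<in> PiM {0..k} (\<lambda>_. borel :: real measure) \<rightarrow>\<^sub>M PiM {1..k} (\<lambda>_. borel)"
    by (intro measurable_restrict_subset) auto
  have [measurable]: "(\<lambda>y. y 0) \<in> borel_measurable (PiM {0..k} (\<lambda>_. borel :: real measure))"
    by (intro measurable_component_singleton) auto
  have "(\<integral>\<^sup>+y. indicator {0..1} (y 0 + a y) * G (restrict y {1..k}) \<partial>lebesgue_PiM k)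
      = (\<integral>\<^sup>+x. (\<integral>\<^sup>+t. indicator {0..1} ((x(0 := t)) 0 + a (x(0 := t))) * G (restrict (x(0 := t)) {1..k}) \<partial>lborel) \<partial>PiM {1..k} (\<lambda>_. lborel))"
  proof -
    have "(\<lambda>y. indicator {0..1} (y 0 + a y) * G (restrict y {1..k})) \<in> borel_measurable (PiM (insert 0 {1..k}) (\<lambda>_. lborel))"
      unfolding ins by measurable
    then show ?thesis
      unfolding ins[symmetric] by (intro lborel_PiM.product_nn_integral_insert) auto
  qed
  also have "\<dots> = (\<integral>\<^sup>+x. G x \<partial>PiM {1..k} (\<lambda>_. lborel))"
  proof (rule nn_integral_cong)
    fix x :: "nat \<Rightarrow> real" assume "x \<in> space (PiM {1..k} (\<lambda>_. lborel))"
    then have "restrict (x(0 := t)) {1..k} = x" for t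
      by (auto simp: space_PiM PiE_def extensional_def fun_eq_iff)
    then show "(\<integral>\<^sup>+t. indicator {0..1} ((x(0 := t)) 0 + a (x(0 := t))) * G (restrict (x(0 := t)) {1..k}) \<partial>lborel) = G x"
      by (simp add: a nn_integral_unit_window)
  qed
  finally show ?thesis .
qed

lemma measurable_of_bool_rank_perm [measurable]:
  "(\<lambda>z. of_bool (rank_perm k z \<tau>) :: ennreal) \<in> borel_measurable (PiM {0..k} (\<lambda>_. borel))"
proof -
  have [measurable]: "Measurable.pred (PiM {0..k} (\<lambda>_. borel)) (\<lambda>z. rank_perm k z \<tau>)"
    unfolding rank_perm_def
    by (intro pred_intros_finite pred_intros_logic borel_measurable_less measurable_component_singleton) auto
  show ?thesis unfolding of_bool_def by measurable
qed

lemma bij_betw_Suc_permutation: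
  assumes \<tau>: "\<tau> permutes {0..k}"
  shows "bij_betw (\<lambda>j. Suc (\<tau> (j - 1))) {1..Suc k} {1..Suc k}"
proof (rule bij_betw_byWitness[where f' = "\<lambda>j. Suc (inv \<tau> (j - 1))"])
  show "(\<lambda>j. Suc (\<tau> (j - 1))) ` {1..Suc k} \<subseteq> {1..Suc k}"
    using permutes_in_image[OF \<tau>, of "_ - 1"] by (fastforce simp: image_subset_iff)
  show "(\<lambda>j. Suc (inv \<tau> (j - 1))) ` {1..Suc k} \<subseteq> {1..Suc k}"
    using permutes_in_image[OF permutes_inv[OF \<tau>], of "_ - 1"] by (fastforce simp: image_subset_iff)
qed (auto simp: permutes_inverses[OF \<tau>])

text \<open>\<open>w\<close> lists the heights in increasing order and \<open>\<tau>\<close> says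
  which height is visited at each time; sorting undoes \<open>\<tau>\<close>.\<close>

lemma gaps_rank_perm:
  assumes \<tau>: "\<tau> permutes {0..k}" and w: "rank_perm k w id"
  shows "gaps k (\<lambda>j\<in>{1..Suc k}. w (\<tau> (j - 1))) = (\<lambda>i\<in>{1..k}. w i - w (i - 1))"
proof -
  have in_k: "\<tau> j \<in> {0..k} \<longleftrightarrow> j \<in> {0..k}" for j using permutes_in_image[OF \<tau>] .
  note bij = bij_betw_Suc_permutation[OF \<tau>]
  have "gaps k (\<lambda>j\<in>{1..Suc k}. w (\<tau> (j - 1))) = gaps k (\<lambda>j\<in>{1..Suc k}. w (j - 1))"
  proof (rule gaps_permute_shift[OF bij, where c=0])
    fix j assume j: "j \<in> {1..Suc k}"
    then have "\<tau> (j - 1) \<in> {0..k}" using in_k[of "j - 1"] by auto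
    then show "(\<lambda>j\<in>{1..Suc k}. w (\<tau> (j - 1))) j = (\<lambda>j\<in>{1..Suc k}. w (j - 1)) (Suc (\<tau> (j - 1))) + 0"
      using j by auto
  qed
  also have "\<dots> = (\<lambda>i\<in>{1..k}. (\<lambda>j\<in>{1..Suc k}. w (j - 1)) (Suc i) - (\<lambda>j\<in>{1..Suc k}. w (j - 1)) i)"
  proof (rule gaps_increasing)
    fix i j assume ij: "i \<in> {1..Suc k}" "j \<in> {1..Suc k}" "i \<le> j"
    then have "i - 1 \<in> {0..k}" "j - 1 \<in> {0..k}" by auto
    then have "\<not> w (j - 1) < w (i - 1)"
      using w ij by (auto simp: rank_perm_def)
    then show "(\<lambda>j\<in>{1..Suc k}. w (j - 1)) i \<le> (\<lambda>j\<in>{1..Suc k}. w (j - 1)) j" using ij by simp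
  qed
  also have "\<dots> = (\<lambda>i\<in>{1..k}. w i - w (i - 1))" by (rule restrict_ext) auto
  finally show ?thesis .
qed

lemma rank_perm_psum: "rank_perm k (psum k g) id \<longleftrightarrow> (\<forall>i\<in>{1..k}. 0 < g i)"
proof
  assume r: "rank_perm k (psum k g) id"
  show "\<forall>i\<in>{1..k}. 0 < g i"
  proof
    fix i assume i: "i \<in> {1..k}"
    then have "psum k g (i - 1) < psum k g i" using r by (auto simp: rank_perm_def)
    moreover have "psum k g i - psum k g (i - 1) = (\<Sum>j\<in>{i-1<..i}. g j)" using i by (intro psum_diff) auto
    moreover have "{i-1<..i} = {i}" using i by auto
    ultimately show "0 < g i" by simp
  qed
next
  assume g: "\<forall>i\<in>{1..k}. 0 < g i"
  have *: "psum k g a < psum k g b" if "a < b" "b \<le> k" for a b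
  proof -
    have "psum k g b - psum k g a = (\<Sum>j\<in>{a<..b}. g j)" using that by (intro psum_diff) auto
    also have "\<dots> > 0" using that g by (intro sum_pos) auto
    finally show ?thesis by simp
  qed
  show "rank_perm k (psum k g) id"
    unfolding rank_perm_def
  proof safe
    fix i j assume ij: "i \<in> {0..k}" "j \<in> {0..k}"
    show "id i < id j" if "psum k g i < psum k g j"
      using that *[of j i] ij by (cases i j rule: linorder_cases) auto
    show "psum k g i < psum k g j" if "id i < id j" using that * ij by auto
  qed
qed

text \<open>Steps become positions, these are split according to their ranks, relabelled into
  increasing heights and turned into gaps again; each of these maps preserves Lebesgue measure on
  \<open>k + 1\<close> coordinates. The product of Laplace densities then factors by
  \<open>prod_laplace_density_eq\<close>, and the auxiliary coordinate is integrated out.\<close>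

lemma nn_integral_gaps_laplace_law:
  assumes [measurable]: "f \<in> borel_measurable (PiM {1..k} (\<lambda>_. borel))"
    and c: "\<And>i. i \<in> {1..k} \<Longrightarrow> 0 < c i"
  shows "(\<integral>\<^sup>+y. f (gaps k (pos k y)) \<partial>laplace_law k c)
       = (\<Sum>\<tau> | \<tau> permutes {0..k}. ennreal (wt k \<tau> c) * (\<integral>\<^sup>+x. f x \<partial>exp_law k (Fvec k \<tau> c)))"
proof -
  define p where "p = (\<lambda>i. laplace_density (sqrt (2 * c i)))"
  have p_nonneg: "0 \<le> p i x" if "i \<in> {1..k}" for i x
    using c[OF that] by (simp add: p_def laplace_density_def)
  have [measurable]: "p i \<in> borel_measurable borel" for i by (simp add: p_def)
  \<comment> \<open>\<open>z i\<close> is the position after \<open>i\<close> steps; the window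
    holds the free starting position \<open>z 0\<close>.\<close>
  define H where "H = (\<lambda>z :: nat \<Rightarrow> real. indicator {0..1} (z 0)
      * ((\<Prod>i\<in>{1..k}. ennreal (p i (z i - z (i - 1)))) * f (gaps k (\<lambda>j\<in>{1..Suc k}. z (j - 1)))))"
  have coord [measurable]: "(\<lambda>z. z i) \<in> borel_measurable (PiM {0..k} (\<lambda>_. borel :: real measure))" if "i \<in> {0..k}" for i
    using that by (intro measurable_component_singleton)
  have [measurable]: "(\<lambda>z. \<lambda>j\<in>{1..Suc k}. z (j - 1)) \<in> PiM {0..k} (\<lambda>_. borel :: real measure) \<rightarrow>\<^sub>M PiM {1..Suc k} (\<lambda>_. borel)"
    by (intro measurable_restrict measurable_component_singleton) auto
  have meas_H [measurable]: "H \<in> borel_measurable (PiM {0..k} (\<lambda>_. borel))"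
  proof -
    have [measurable]: "(\<lambda>z. \<Prod>i\<in>{1..k}. ennreal (p i (z i - z (i - 1)))) \<in> borel_measurable (PiM {0..k} (\<lambda>_. borel))"
    proof (rule borel_measurable_prod_ennreal)
      fix i assume "i \<in> {1..k}"
      then have "(\<lambda>z. z i - z (i - 1)) \<in> borel_measurable (PiM {0..k} (\<lambda>_. borel :: real measure))"
        by (intro borel_measurable_diff coord) auto
      then show "(\<lambda>z. ennreal (p i (z i - z (i - 1)))) \<in> borel_measurable (PiM {0..k} (\<lambda>_. borel))"
        by (rule measurable_compose) measurable
    qed
    show ?thesis unfolding H_def by measurable
  qed
  have "(\<integral>\<^sup>+y. f (gaps k (pos k y)) \<partial>laplace_law k c)
      = (\<integral>\<^sup>+y. (\<Prod>i\<in>{1..k}. ennreal (p i (y i))) * f (gaps k (pos k y)) \<partial>PiM {1..k} (\<lambda>_. lborel))"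
    unfolding p_def by (rule nn_integral_laplace_law) measurable
  also have "\<dots> = (\<integral>\<^sup>+y. indicator {0..1} (y 0 + 0)
        * ((\<Prod>i\<in>{1..k}. ennreal (p i ((restrict y {1..k}) i))) * f (gaps k (pos k (restrict y {1..k})))) \<partial>lebesgue_PiM k)"
  proof (rule nn_integral_add_coordinate[where a="\<lambda>_. 0", symmetric])
    show "(\<lambda>y. (\<Prod>i\<in>{1..k}. ennreal (p i (y i))) * f (gaps k (pos k y))) \<in> borel_measurable (PiM {1..k} (\<lambda>_. borel))"
      by measurable
  qed auto
  also have "\<dots> = (\<integral>\<^sup>+y. H (psum k y) \<partial>lebesgue_PiM k)"
  proof (rule nn_integral_cong)
    fix y :: "nat \<Rightarrow> real"
    have "psum k y i - psum k y (i - 1) = y i" if "i \<in> {1..k}" for i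
    proof -
      have "psum k y i - psum k y (i - 1) = (\<Sum>j\<in>{i-1<..i}. y j)" using that by (intro psum_diff) auto
      also have "{i-1<..i} = {i}" using that by auto
      finally show ?thesis by simp
    qed
    moreover have "gaps k (\<lambda>j\<in>{1..Suc k}. psum k y (j - 1)) = gaps k (pos k (restrict y {1..k}))"
    proof (rule gaps_shift[where c="y 0"])
      fix j assume j: "j \<in> {1..Suc k}"
      then have e: "{0..j-1} = insert 0 {1..<j}" by auto
      have "(\<Sum>i\<in>{1..<j}. restrict y {1..k} i) = (\<Sum>i\<in>{1..<j}. y i)"
        using j by (intro sum.cong) auto
      moreover have "psum k y (j - 1) = (\<Sum>i\<in>{0..j-1}. y i)" using j unfolding psum_def by auto
      moreover have "(\<Sum>i\<in>{0..j-1}. y i) = y 0 + (\<Sum>i\<in>{1..<j}. y i)" unfolding e by simp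
      ultimately show "(\<lambda>j\<in>{1..Suc k}. psum k y (j - 1)) j = pos k (restrict y {1..k}) j + y 0"
        using j by (simp add: pos_def)
    qed
    moreover have "psum k y 0 = y 0" by (simp add: psum_def)
    ultimately show "indicator {0..1} (y 0 + 0)
        * ((\<Prod>i\<in>{1..k}. ennreal (p i ((restrict y {1..k}) i))) * f (gaps k (pos k (restrict y {1..k})))) = H (psum k y)"
      unfolding H_def by simp
  qed
  also have "\<dots> = (\<integral>\<^sup>+z. H z \<partial>lebesgue_PiM k)" by (rule nn_integral_psum) measurable
  also have "\<dots> = (\<integral>\<^sup>+z. (\<Sum>\<tau> | \<tau> permutes {0..k}. of_bool (rank_perm k z \<tau>) * H z) \<partial>lebesgue_PiM k)"
  proof (rule nn_integral_cong_AE)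
    \<comment> \<open>Off the null set of ties exactly one permutation describes the ranks, so the
      indicators sum to 1.\<close>
    show "AE z in lebesgue_PiM k. H z = (\<Sum>\<tau> | \<tau> permutes {0..k}. of_bool (rank_perm k z \<tau>) * H z)"
      using AE_inj_on_lebesgue_PiM
    proof eventually_elim
      fix z :: "nat \<Rightarrow> real" assume "inj_on z {0..k}"
      from ex1_rank_perm[OF this] obtain \<sigma> where
        \<sigma>: "\<sigma> permutes {0..k}" "rank_perm k z \<sigma>" "\<And>\<tau>. \<tau> permutes {0..k} \<Longrightarrow> rank_perm k z \<tau> \<Longrightarrow> \<tau> = \<sigma>"
        by auto
      have "(\<Sum>\<tau> | \<tau> permutes {0..k}. of_bool (rank_perm k z \<tau>) * H z)
          = (\<Sum>\<tau> | \<tau> permutes {0..k}. if \<tau> = \<sigma> then H z else 0)"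
      proof (rule sum.cong[OF refl])
        fix \<tau> assume "\<tau> \<in> {\<tau>. \<tau> permutes {0..k}}"
        then have "rank_perm k z \<tau> \<longleftrightarrow> \<tau> = \<sigma>" using \<sigma>(2) \<sigma>(3)[of \<tau>] by blast
        then show "of_bool (rank_perm k z \<tau>) * H z = (if \<tau> = \<sigma> then H z else 0)" by simp
      qed
      also have "\<dots> = H z" using \<sigma>(1) by (simp add: finite_permutations)
      finally show "H z = (\<Sum>\<tau> | \<tau> permutes {0..k}. of_bool (rank_perm k z \<tau>) * H z)" by simp
    qed
  qed
  also have "\<dots> = (\<Sum>\<tau> | \<tau> permutes {0..k}. \<integral>\<^sup>+z. of_bool (rank_perm k z \<tau>) * H z \<partial>lebesgue_PiM k)"
    by (rule nn_integral_sum) measurable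
  also have "\<dots> = (\<Sum>\<tau> | \<tau> permutes {0..k}. ennreal (wt k \<tau> c) * (\<integral>\<^sup>+x. f x \<partial>exp_law k (Fvec k \<tau> c)))"
  proof (rule sum.cong[OF refl])
    fix \<tau> assume "\<tau> \<in> {\<tau>. \<tau> permutes {0..k}}"
    then have \<tau>: "\<tau> permutes {0..k}" by simp
    have in_k: "\<tau> j \<in> {0..k} \<longleftrightarrow> j \<in> {0..k}" for j using permutes_in_image[OF \<tau>] .
    \<comment> \<open>\<open>w\<close> now holds the sorted heights and the position at time
      \<open>j\<close> is \<open>w (\<tau> j)\<close>, so the window sits on
      \<open>w (\<tau> 0)\<close>, the height of the starting point.\<close>
    define K where "K = (\<lambda>w. of_bool (rank_perm k w id) * (indicator {0..1} (w (\<tau> 0))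
      * ((\<Prod>i\<in>{1..k}. ennreal (p i (w (\<tau> i) - w (\<tau> (i - 1))))) * f (\<lambda>i\<in>{1..k}. w i - w (i - 1)))))"
    have t0: "\<tau> 0 \<in> {0..k}" using in_k[of 0] by simp
    have K_eq: "of_bool (rank_perm k (\<lambda>j\<in>{0..k}. w (\<tau> j)) \<tau>) * H (\<lambda>j\<in>{0..k}. w (\<tau> j)) = K w" for w
    proof -
      have "rank_perm k (\<lambda>j\<in>{0..k}. w (\<tau> j)) \<tau> \<longleftrightarrow>
          (\<forall>i\<in>\<tau> ` {0..k}. \<forall>j\<in>\<tau> ` {0..k}. w i < w j \<longleftrightarrow> i < j)"
        unfolding rank_perm_def by auto
      then have "rank_perm k (\<lambda>j\<in>{0..k}. w (\<tau> j)) \<tau> \<longleftrightarrow> rank_perm k w id"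
        by (simp add: permutes_image[OF \<tau>] rank_perm_def)
      moreover have "gaps k (\<lambda>j\<in>{1..Suc k}. (\<lambda>j\<in>{0..k}. w (\<tau> j)) (j - 1)) = (\<lambda>i\<in>{1..k}. w i - w (i - 1))"
        if "rank_perm k w id"
      proof -
        have "gaps k (\<lambda>j\<in>{1..Suc k}. (\<lambda>j\<in>{0..k}. w (\<tau> j)) (j - 1)) = gaps k (\<lambda>j\<in>{1..Suc k}. w (\<tau> (j - 1)))"
          by (rule gaps_cong) auto
        then show ?thesis using gaps_rank_perm[OF \<tau> that] by simp
      qed
      moreover have "(\<Prod>i\<in>{1..k}. ennreal (p i ((\<lambda>j\<in>{0..k}. w (\<tau> j)) i - (\<lambda>j\<in>{0..k}. w (\<tau> j)) (i - 1))))
          = (\<Prod>i\<in>{1..k}. ennreal (p i (w (\<tau> i) - w (\<tau> (i - 1)))))"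
        by (rule prod.cong) auto
      ultimately show ?thesis unfolding H_def K_def by auto
    qed
    have [measurable]: "(\<lambda>w. \<lambda>j\<in>{0..k}. w (\<tau> j)) \<in> PiM {0..k} (\<lambda>_. borel) \<rightarrow>\<^sub>M PiM {0..k} (\<lambda>_. borel :: real measure)"
      using in_k by (intro measurable_restrict measurable_component_singleton) auto
    have [measurable]: "K \<in> borel_measurable (PiM {0..k} (\<lambda>_. borel))"
      unfolding K_eq[symmetric, abs_def] by measurable
    define G where "G = (\<lambda>g. of_bool (\<forall>i\<in>{1..k}. 0 < g i)
        * (ennreal (wt k \<tau> c) * (\<Prod>i\<in>{1..k}. ennreal (exponential_density (Fvec k \<tau> c i) (g i))) * f g))"
    have comp [measurable]: "(\<lambda>z. z i) \<in> borel_measurable (PiM {1..k} (\<lambda>_. borel :: real measure))" if "i \<in> {1..k}" for i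
      using that by (intro measurable_component_singleton)
    have [measurable]: "(\<lambda>x. \<Prod>i\<in>{1..k}. ennreal (exponential_density (d i) (x i))) \<in> borel_measurable (PiM {1..k} (\<lambda>_. borel))" for d
      by measurable
    have [measurable]: "Measurable.pred (PiM {1..k} (\<lambda>_. borel)) (\<lambda>g. \<forall>i\<in>{1..k}. (0::real) < g i)"
      by measurable
    have [measurable]: "G \<in> borel_measurable (PiM {1..k} (\<lambda>_. borel))"
      unfolding G_def of_bool_def by measurable
    have "(\<integral>\<^sup>+z. of_bool (rank_perm k z \<tau>) * H z \<partial>lebesgue_PiM k) = (\<integral>\<^sup>+w. K w \<partial>lebesgue_PiM k)"
      unfolding K_eq[symmetric] by (rule nn_integral_permute[OF \<tau>, symmetric]) measurable
    also have "\<dots> = (\<integral>\<^sup>+g. K (psum k g) \<partial>lebesgue_PiM k)"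
      by (rule nn_integral_psum[symmetric]) measurable
    \<comment> \<open>In gap coordinates the start exceeds the lowest height \<open>g 0\<close> by
      the sum of the gaps below it. The window is thus shifted by a quantity free of
      \<open>g 0\<close>, as \<open>nn_integral_add_coordinate\<close> requires.\<close>
    also have "\<dots> = (\<integral>\<^sup>+g. indicator {0..1} (g 0 + (\<Sum>i\<in>{1..\<tau> 0}. g i)) * G (restrict g {1..k}) \<partial>lebesgue_PiM k)"
    proof (rule nn_integral_cong)
      fix g :: "nat \<Rightarrow> real"
      have start: "psum k g (\<tau> 0) = g 0 + (\<Sum>i\<in>{1..\<tau> 0}. g i)"
        using t0 by (simp add: psum_def sum.atLeast_Suc_atMost)
      show "K (psum k g) = indicator {0..1} (g 0 + (\<Sum>i\<in>{1..\<tau> 0}. g i)) * G (restrict g {1..k})"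
      proof (cases "\<forall>i\<in>{1..k}. 0 < g i")
        case False
        then show ?thesis by (auto simp: K_def G_def rank_perm_psum)
      next
        case True
        have diff: "(\<lambda>i\<in>{1..k}. psum k g i - psum k g (i - 1)) = restrict g {1..k}"
        proof (rule restrict_ext)
          fix i assume i: "i \<in> {1..k}"
          have "psum k g i - psum k g (i - 1) = (\<Sum>j\<in>{i-1<..i}. g j)" using i by (intro psum_diff) auto
          also have "{i-1<..i} = {i}" using i by auto
          finally show "psum k g i - psum k g (i - 1) = g i" by simp
        qed
        have exp_nonneg: "0 \<le> exponential_density (Fcomp k \<tau> c i) (g i)" if "i \<in> {1..k}" for i
        proof -
          have "0 < Fcomp k \<tau> c i" by (rule Fcomp_pos[OF \<tau> that c])
          then show ?thesis by (rule exponential_density_nonneg)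
        qed
        have "(\<Prod>i\<in>{1..k}. ennreal (p i (psum k g (\<tau> i) - psum k g (\<tau> (i - 1)))))
            = ennreal (\<Prod>i\<in>{1..k}. p i (psum k g (\<tau> i) - psum k g (\<tau> (i - 1))))"
          using p_nonneg by (intro prod_ennreal)
        also have "\<dots> = ennreal (wt k \<tau> c * (\<Prod>i\<in>{1..k}. exponential_density (Fcomp k \<tau> c i) (g i)))"
          unfolding p_def using True by (subst prod_laplace_density_eq[OF \<tau> c]) auto
        also have "\<dots> = ennreal (wt k \<tau> c) * ennreal (\<Prod>i\<in>{1..k}. exponential_density (Fcomp k \<tau> c i) (g i))"
          using exp_nonneg by (intro ennreal_mult prod_nonneg wt_nonneg[OF \<tau> c]) auto
        also have "ennreal (\<Prod>i\<in>{1..k}. exponential_density (Fcomp k \<tau> c i) (g i))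
            = (\<Prod>i\<in>{1..k}. ennreal (exponential_density (Fcomp k \<tau> c i) (g i)))"
          using exp_nonneg by (intro prod_ennreal[symmetric])
        also have "\<dots> = (\<Prod>i\<in>{1..k}. ennreal (exponential_density (Fvec k \<tau> c i) (restrict g {1..k} i)))"
          by (intro prod.cong) (auto simp: Fvec_def)
        finally show ?thesis
          using True unfolding K_def G_def rank_perm_psum diff start by simp
      qed
    qed
    also have "\<dots> = (\<integral>\<^sup>+x. G x \<partial>PiM {1..k} (\<lambda>_. lborel))"
    proof (rule nn_integral_add_coordinate)
      show "(\<lambda>g. \<Sum>i\<in>{1..\<tau> 0}. g i :: real) \<in> borel_measurable (PiM {0..k} (\<lambda>_. borel))"
        using t0 by (intro borel_measurable_sum coord) auto
      show "G \<in> borel_measurable (PiM {1..k} (\<lambda>_. borel))" by measurable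
    qed auto
    also have "\<dots> = (\<integral>\<^sup>+x. ennreal (wt k \<tau> c) * ((\<Prod>i\<in>{1..k}. ennreal (exponential_density (Fvec k \<tau> c i) (x i))) * f x) \<partial>PiM {1..k} (\<lambda>_. lborel))"
    proof (rule nn_integral_cong_AE)
      have "AE x in PiM {1..k} (\<lambda>_. lborel). \<forall>i\<in>{1..k}. x i \<noteq> (0::real)"
        by (intro AE_finite_allI AE_PiM_lborel_neq) auto
      then show "AE x in PiM {1..k} (\<lambda>_. lborel). G x
          = ennreal (wt k \<tau> c) * ((\<Prod>i\<in>{1..k}. ennreal (exponential_density (Fvec k \<tau> c i) (x i))) * f x)"
      proof eventually_elim
        fix x :: "nat \<Rightarrow> real" assume x: "\<forall>i\<in>{1..k}. x i \<noteq> 0"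
        show "G x = ennreal (wt k \<tau> c) * ((\<Prod>i\<in>{1..k}. ennreal (exponential_density (Fvec k \<tau> c i) (x i))) * f x)"
        proof (cases "\<forall>i\<in>{1..k}. 0 < x i")
          case True
          then show ?thesis by (simp add: G_def mult.assoc)
        next
          case False
          then obtain i where i: "i \<in> {1..k}" "x i < 0" using x by force
          then have "(\<Prod>i\<in>{1..k}. ennreal (exponential_density (Fvec k \<tau> c i) (x i))) = 0"
            by (intro prod_zero) (auto simp: exponential_density_def intro!: bexI[of _ i])
          moreover have "(\<forall>i\<in>{1..k}. 0 < x i) = False" using False by blast
          ultimately show ?thesis by (simp only: G_def of_bool_eq mult_zero_left mult_zero_right)
        qed
      qed
    qed
    also have "\<dots> = ennreal (wt k \<tau> c) * (\<integral>\<^sup>+x. f x \<partial>exp_law k (Fvec k \<tau> c))"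
      unfolding nn_integral_exp_law[OF assms(1)] by (rule nn_integral_cmult) measurable
    finally show "(\<integral>\<^sup>+z. of_bool (rank_perm k z \<tau>) * H z \<partial>lebesgue_PiM k)
        = ennreal (wt k \<tau> c) * (\<integral>\<^sup>+x. f x \<partial>exp_law k (Fvec k \<tau> c))" .
  qed
  finally show ?thesis .
qed

section \<open>The gap chain and its intertwining with Q\<close>

lemma distr_PiM_map:
  assumes I: "finite I" and M: "\<And>i. prob_space (M i)" and f [measurable]: "\<And>i. f i \<in> M i \<rightarrow>\<^sub>M N i"
  shows "distr (PiM I M) (PiM I N) (\<lambda>x. \<lambda>i\<in>I. f i (x i)) = PiM I (\<lambda>i. distr (M i) (N i) (f i))"
proof -
  interpret M: product_prob_space M I using M by (simp add: product_prob_space_def product_sigma_finite_def product_prob_space_axioms_def prob_space_imp_sigma_finite)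
  interpret D: product_sigma_finite "\<lambda>i. distr (M i) (N i) (f i)"
    using M f by (intro product_sigma_finite.intro prob_space_imp_sigma_finite prob_space.prob_space_distr)
  have [measurable]: "(\<lambda>x. \<lambda>i\<in>I. f i (x i)) \<in> PiM I M \<rightarrow>\<^sub>M PiM I N"
  proof (rule measurable_restrict)
    fix i assume "i \<in> I"
    then have "(\<lambda>x. x i) \<in> PiM I M \<rightarrow>\<^sub>M M i" by (rule measurable_component_singleton)
    then show "(\<lambda>x. f i (x i)) \<in> PiM I M \<rightarrow>\<^sub>M N i" by (rule measurable_compose[OF _ f])
  qed
  show ?thesis
  proof (rule D.PiM_eqI[OF I])
    show "sets (distr (PiM I M) (PiM I N) (\<lambda>x. \<lambda>i\<in>I. f i (x i))) = sets (PiM I (\<lambda>i. distr (M i) (N i) (f i)))"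
      by (simp cong: sets_PiM_cong)
    fix A assume "\<And>i. i \<in> I \<Longrightarrow> A i \<in> sets (distr (M i) (N i) (f i))"
    then have A: "i \<in> I \<Longrightarrow> A i \<in> sets (N i)" for i by simp
    have "emeasure (distr (PiM I M) (PiM I N) (\<lambda>x. \<lambda>i\<in>I. f i (x i))) (Pi\<^sub>E I A)
        = emeasure (PiM I M) ((\<lambda>x. \<lambda>i\<in>I. f i (x i)) -` Pi\<^sub>E I A \<inter> space (PiM I M))"
      using I A by (intro emeasure_distr sets_PiM_I_finite) auto
    also have "(\<lambda>x. \<lambda>i\<in>I. f i (x i)) -` Pi\<^sub>E I A \<inter> space (PiM I M)
        = Pi\<^sub>E I (\<lambda>i. f i -` A i \<inter> space (M i))"
      by (auto simp: space_PiM PiE_iff)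
    also have "emeasure (PiM I M) \<dots> = (\<Prod>i\<in>I. emeasure (M i) (f i -` A i \<inter> space (M i)))"
      using I A by (intro M.emeasure_PiM) (auto intro: measurable_sets[OF f])
    also have "\<dots> = (\<Prod>i\<in>I. emeasure (distr (M i) (N i) (f i)) (A i))"
      using A by (intro prod.cong refl emeasure_distr[symmetric] f)
    finally show "emeasure (distr (PiM I M) (PiM I N) (\<lambda>x. \<lambda>i\<in>I. f i (x i))) (Pi\<^sub>E I A)
        = (\<Prod>i\<in>I. emeasure (distr (M i) (N i) (f i)) (A i))" .
  qed
qed

definition normal_law :: "nat \<Rightarrow> (nat \<Rightarrow> real) measure" where
  "normal_law k = PiM {1..k} (\<lambda>_. density lborel (\<lambda>x. ennreal (std_normal_density x)))"

lemma sets_normal_law [measurable_cong, simp]: "sets (normal_law k) = sets (PiM {1..k} (\<lambda>_. borel))"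
  unfolding normal_law_def by (intro sets_PiM_cong) auto

lemma prob_space_normal_law: "prob_space (normal_law k)"
  unfolding normal_law_def by (intro prob_space_PiM prob_space_normal_density) simp

lemma prob_space_exp_law:
  assumes "\<And>i. i \<in> {1..k} \<Longrightarrow> 0 < c i"
  shows "prob_space (exp_law k c)"
  unfolding exp_law_def using assms by (intro prob_space_PiM prob_space_exponential_density)

text \<open>Gaussian increments over times of lengths \<open>g\<close>, written with a noise
  \<open>z\<close> whose law does not depend on \<open>g\<close>; this makes the integrand of the
  step kernel jointly measurable.\<close>

definition scale :: "nat \<Rightarrow> (nat \<Rightarrow> real) \<Rightarrow> (nat \<Rightarrow> real) \<Rightarrow> nat \<Rightarrow> real" where
  "scale k g z = (\<lambda>i\<in>{1..k}. sqrt (g i) * z i)"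

lemma measurable_scale [measurable]:
  "(\<lambda>p. scale k (fst p) (snd p)) \<in> PiM {1..k} (\<lambda>_. borel) \<Otimes>\<^sub>M PiM {1..k} (\<lambda>_. borel) \<rightarrow>\<^sub>M PiM {1..k} (\<lambda>_. borel)"
  unfolding scale_def
  by (intro measurable_restrict borel_measurable_times
        measurable_compose[OF _ borel_measurable_sqrt]
        measurable_compose[OF measurable_fst measurable_component_singleton]
        measurable_compose[OF measurable_snd measurable_component_singleton])

lemma measurable_scale_right [measurable]:
  "scale k g \<in> PiM {1..k} (\<lambda>_. borel) \<rightarrow>\<^sub>M PiM {1..k} (\<lambda>_. borel)"
  unfolding scale_def[abs_def]
  by (intro measurable_restrict borel_measurable_times measurable_component_singleton) auto

text \<open>Tested on boxes, the double integral factors over the coordinates, and each factor is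
  the one-dimensional mixture.\<close>

lemma nn_integral_exp_normal:
  assumes c: "\<And>i. i \<in> {1..k} \<Longrightarrow> 0 < c i"
    and F [measurable]: "F \<in> borel_measurable (PiM {1..k} (\<lambda>_. borel))"
  shows "(\<integral>\<^sup>+g. (\<integral>\<^sup>+z. F (scale k g z) \<partial>normal_law k) \<partial>exp_law k c) = (\<integral>\<^sup>+y. F y \<partial>laplace_law k c)"
proof -
  interpret std: prob_space std_normal_distribution by (rule prob_space_normal_density) simp
  interpret E: prob_space "exp_law k c" by (rule prob_space_exp_law[OF c])
  interpret Z: prob_space "normal_law k" by (rule prob_space_normal_law)
  interpret EP: product_sigma_finite "\<lambda>i. density lborel (\<lambda>x. ennreal (exponential_density (c i) x))"
    by (rule product_sigma_finite_density_lborel) auto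
  interpret ZP: product_sigma_finite "\<lambda>_::nat. density lborel (\<lambda>x. ennreal (std_normal_density x))"
    by (rule product_sigma_finite_density_lborel) auto
  interpret LP: product_sigma_finite "\<lambda>i. density lborel (\<lambda>x. ennreal (laplace_density (sqrt (2 * c i)) x))"
    by (rule product_sigma_finite_density_lborel) auto
  define P where "P = exp_law k c \<Otimes>\<^sub>M normal_law k"
  have sets_P [measurable_cong]: "sets P = sets (PiM {1..k} (\<lambda>_. borel) \<Otimes>\<^sub>M PiM {1..k} (\<lambda>_. borel))"
    unfolding P_def by (intro sets_pair_measure_cong) auto
  have Fub: "(\<integral>\<^sup>+p. F (scale k (fst p) (snd p)) \<partial>P) = (\<integral>\<^sup>+g. (\<integral>\<^sup>+z. F (scale k g z) \<partial>normal_law k) \<partial>exp_law k c)"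
    if [measurable]: "F \<in> borel_measurable (PiM {1..k} (\<lambda>_. borel))" for F :: "(nat \<Rightarrow> real) \<Rightarrow> ennreal"
  proof -
    have "(\<lambda>p. F (scale k (fst p) (snd p))) \<in> borel_measurable (exp_law k c \<Otimes>\<^sub>M normal_law k)"
      unfolding P_def[symmetric] by measurable
    from Z.nn_integral_fst[OF this] show ?thesis unfolding P_def by simp
  qed
  have "distr P (PiM {1..k} (\<lambda>_. borel)) (\<lambda>p. scale k (fst p) (snd p)) = laplace_law k c"
    unfolding laplace_law_def
  proof (rule LP.PiM_eqI)
    show "sets (distr P (PiM {1..k} (\<lambda>_. borel)) (\<lambda>p. scale k (fst p) (snd p)))
        = sets (PiM {1..k} (\<lambda>i. density lborel (\<lambda>x. ennreal (laplace_density (sqrt (2 * c i)) x))))"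
      by (simp cong: sets_PiM_cong)
    fix A :: "nat \<Rightarrow> real set"
    assume "\<And>i. i \<in> {1..k} \<Longrightarrow> A i \<in> sets (density lborel (\<lambda>x. ennreal (laplace_density (sqrt (2 * c i)) x)))"
    then have A [measurable]: "i \<in> {1..k} \<Longrightarrow> A i \<in> sets borel" for i by simp
    have [measurable]: "Pi\<^sub>E {1..k} A \<in> sets (PiM {1..k} (\<lambda>_. borel))"
      using A by (intro sets_PiM_I_finite) auto
    have "emeasure (distr P (PiM {1..k} (\<lambda>_. borel)) (\<lambda>p. scale k (fst p) (snd p))) (Pi\<^sub>E {1..k} A)
        = (\<integral>\<^sup>+y. indicator (Pi\<^sub>E {1..k} A) y \<partial>distr P (PiM {1..k} (\<lambda>_. borel)) (\<lambda>p. scale k (fst p) (snd p)))"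
      by simp
    also have "\<dots> = (\<integral>\<^sup>+p. indicator (Pi\<^sub>E {1..k} A) (scale k (fst p) (snd p)) \<partial>P)"
      by (rule nn_integral_distr) measurable
    also have "\<dots> = (\<integral>\<^sup>+g. (\<integral>\<^sup>+z. indicator (Pi\<^sub>E {1..k} A) (scale k g z) \<partial>normal_law k) \<partial>exp_law k c)"
      by (rule Fub) measurable
    also have "\<dots> = (\<integral>\<^sup>+g. (\<integral>\<^sup>+z. (\<Prod>i\<in>{1..k}. indicator (A i) (sqrt (g i) * z i)) \<partial>normal_law k) \<partial>exp_law k c)"
      by (intro nn_integral_cong) (auto simp: scale_def indicator_def PiE_iff intro!: prod.neutral[symmetric])
    also have "\<dots> = (\<integral>\<^sup>+g. (\<Prod>i\<in>{1..k}. \<integral>\<^sup>+z. indicator (A i) (sqrt (g i) * z) \<partial>std_normal_distribution) \<partial>exp_law k c)"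
      unfolding normal_law_def by (intro nn_integral_cong ZP.product_nn_integral_prod) auto
    also have "\<dots> = (\<Prod>i\<in>{1..k}. \<integral>\<^sup>+t. (\<integral>\<^sup>+z. indicator (A i) (sqrt t * z) \<partial>std_normal_distribution)
        \<partial>density lborel (\<lambda>x. ennreal (exponential_density (c i) x)))"
      unfolding exp_law_def
      by (rule EP.product_nn_integral_prod) (auto intro!: std.borel_measurable_nn_integral)
    also have "\<dots> = (\<Prod>i\<in>{1..k}. emeasure (density lborel (\<lambda>x. ennreal (laplace_density (sqrt (2 * c i)) x))) (A i))"
    proof (rule prod.cong[OF refl])
      fix i assume i: "i \<in> {1..k}"
      have "(\<integral>\<^sup>+t. (\<integral>\<^sup>+z. indicator (A i) (sqrt t * z) \<partial>std_normal_distribution)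
          \<partial>density lborel (\<lambda>x. ennreal (exponential_density (c i) x)))
         = (\<integral>\<^sup>+x. indicator (A i) x \<partial>density lborel (\<lambda>x. ennreal (laplace_density (sqrt (2 * c i)) x)))"
        using c[OF i] A[OF i] by (intro exponential_mixture_of_normal) auto
      then show "(\<integral>\<^sup>+t. (\<integral>\<^sup>+z. indicator (A i) (sqrt t * z) \<partial>std_normal_distribution)
          \<partial>density lborel (\<lambda>x. ennreal (exponential_density (c i) x)))
         = emeasure (density lborel (\<lambda>x. ennreal (laplace_density (sqrt (2 * c i)) x))) (A i)"
        using A[OF i] by simp
    qed
    finally show "emeasure (distr P (PiM {1..k} (\<lambda>_. borel)) (\<lambda>p. scale k (fst p) (snd p))) (Pi\<^sub>E {1..k} A)
        = (\<Prod>i\<in>{1..k}. emeasure (density lborel (\<lambda>x. ennreal (laplace_density (sqrt (2 * c i)) x))) (A i))" .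
  qed simp
  then have "(\<integral>\<^sup>+y. F y \<partial>laplace_law k c)
      = (\<integral>\<^sup>+y. F y \<partial>distr P (PiM {1..k} (\<lambda>_. borel)) (\<lambda>p. scale k (fst p) (snd p)))" by simp
  also have "\<dots> = (\<integral>\<^sup>+p. F (scale k (fst p) (snd p)) \<partial>P)"
    by (rule nn_integral_distr) measurable
  finally show ?thesis using Fub[OF F] by simp
qed

section \<open>Test functions with values in the unit interval, and the intertwining
  relation\<close>

definition unit_fn :: "nat \<Rightarrow> ((nat \<Rightarrow> real) \<Rightarrow> real) \<Rightarrow> bool" where
  "unit_fn k f \<longleftrightarrow> f \<in> borel_measurable (PiM {1..k} (\<lambda>_. borel)) \<and> (\<forall>x. 0 \<le> f x \<and> f x \<le> 1)"

lemma unit_fnD: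
  assumes "unit_fn k f"
  shows "f \<in> borel_measurable (PiM {1..k} (\<lambda>_. borel))" "0 \<le> f x" "f x \<le> 1"
  using assms by (auto simp: unit_fn_def)

text \<open>The bounds guarantee integrability, so real-valued and nonnegative integrals can be
  exchanged freely; Tonelli and changes of variables are carried out with the latter.\<close>

lemma (in prob_space) unit_fn_integrable:
  assumes "unit_fn k f" and [measurable]: "X \<in> M \<rightarrow>\<^sub>M PiM {1..k} (\<lambda>_. borel)"
  shows "integrable M (\<lambda>\<omega>. f (X \<omega>))"
    and "0 \<le> (\<integral>\<omega>. f (X \<omega>) \<partial>M)" and "(\<integral>\<omega>. f (X \<omega>) \<partial>M) \<le> 1"
    and "(\<integral>\<^sup>+\<omega>. ennreal (f (X \<omega>)) \<partial>M) = ennreal (\<integral>\<omega>. f (X \<omega>) \<partial>M)"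
proof -
  note [measurable] = unit_fnD(1)[OF assms(1)]
  note b = unit_fnD(2,3)[OF assms(1)]
  show int: "integrable M (\<lambda>\<omega>. f (X \<omega>))"
    using b by (intro integrable_const_bound[where B=1]) auto
  show "0 \<le> (\<integral>\<omega>. f (X \<omega>) \<partial>M)" using b by simp
  have "(\<integral>\<omega>. f (X \<omega>) \<partial>M) \<le> (\<integral>\<omega>. 1 \<partial>M)"
    using b int by (intro integral_mono) auto
  then show "(\<integral>\<omega>. f (X \<omega>) \<partial>M) \<le> 1" by (simp add: prob_space)
  show "(\<integral>\<^sup>+\<omega>. ennreal (f (X \<omega>)) \<partial>M) = ennreal (\<integral>\<omega>. f (X \<omega>) \<partial>M)"
    using b int by (intro nn_integral_eq_integral) auto
qed

text \<open>One step of the gap chain started from the gaps \<open>g\<close>.\<close>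
definition Pop :: "nat \<Rightarrow> ((nat \<Rightarrow> real) \<Rightarrow> real) \<Rightarrow> (nat \<Rightarrow> real) \<Rightarrow> real" where
  "Pop k f g = (\<integral>z. f (gaps k (pos k (scale k g z))) \<partial>normal_law k)"

lemma ennreal_Pop:
  assumes "unit_fn k f"
  shows "ennreal (Pop k f g) = (\<integral>\<^sup>+z. ennreal (f (gaps k (pos k (scale k g z)))) \<partial>normal_law k)"
  unfolding Pop_def
  by (rule prob_space.unit_fn_integrable(4)[OF prob_space_normal_law assms, symmetric]) measurable

lemma unit_fn_Pop:
  assumes "unit_fn k f"
  shows "unit_fn k (Pop k f)"
proof -
  interpret Z: prob_space "normal_law k" by (rule prob_space_normal_law)
  note [measurable] = unit_fnD(1)[OF assms]
  have X: "(\<lambda>z. gaps k (pos k (scale k g z))) \<in> normal_law k \<rightarrow>\<^sub>M PiM {1..k} (\<lambda>_. borel)" for g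
    by measurable
  have "(\<lambda>p. f (gaps k (pos k (scale k (fst p) (snd p))))) \<in> borel_measurable (PiM {1..k} (\<lambda>_. borel) \<Otimes>\<^sub>M normal_law k)"
    by measurable
  then have "Pop k f \<in> borel_measurable (PiM {1..k} (\<lambda>_. borel))"
    unfolding Pop_def by (intro Z.borel_measurable_lebesgue_integral) (simp add: case_prod_beta')
  moreover have "0 \<le> Pop k f g" for g
    unfolding Pop_def by (rule Z.unit_fn_integrable(2)[OF assms X])
  moreover have "Pop k f g \<le> 1" for g
    unfolding Pop_def by (rule Z.unit_fn_integrable(3)[OF assms X])
  ultimately show ?thesis unfolding unit_fn_def by blast
qed

lemma unit_fn_Pop_iterate: "unit_fn k f \<Longrightarrow> unit_fn k ((Pop k ^^ n) f)"
  by (induction n) (auto intro: unit_fn_Pop)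

text \<open>The intertwining in dual form, on functions: exponential gaps with rates
  \<open>c\<close> give Laplace steps with parameters \<open>sqrt (2 * c i)\<close>, and sorting
  that walk gives the mixture over permutations. The equality of nonnegative integrals returns to
  the reals because both sides are nonnegative.\<close>

lemma integral_exp_law_Pop:
  assumes f: "unit_fn k f" and c: "\<And>i. i \<in> {1..k} \<Longrightarrow> 0 < c i"
  shows "(\<integral>g. Pop k f g \<partial>exp_law k c) = Qop k (\<lambda>c. \<integral>x. f x \<partial>exp_law k c) c"
proof -
  note [measurable] = unit_fnD(1)[OF f]
  have id: "(\<lambda>x. x) \<in> exp_law k c \<rightarrow>\<^sub>M PiM {1..k} (\<lambda>_. borel)" for c by measurable
  have F: "0 < Fvec k \<tau> c i" if "\<tau> permutes {0..k}" "i \<in> {1..k}" for \<tau> i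
    using Fcomp_pos[OF that c] that by (simp add: Fvec_def)
  have nonneg: "0 \<le> (\<integral>x. f x \<partial>exp_law k d)" for d
    using unit_fnD(2)[OF f] by simp
  have "ennreal (\<integral>g. Pop k f g \<partial>exp_law k c) = (\<integral>\<^sup>+g. ennreal (Pop k f g) \<partial>exp_law k c)"
    by (rule prob_space.unit_fn_integrable(4)[OF prob_space_exp_law[OF c] unit_fn_Pop[OF f] id, symmetric])
  also have "\<dots> = (\<integral>\<^sup>+g. (\<integral>\<^sup>+z. ennreal (f (gaps k (pos k (scale k g z)))) \<partial>normal_law k) \<partial>exp_law k c)"
    by (simp add: ennreal_Pop[OF f])
  also have "\<dots> = (\<integral>\<^sup>+y. ennreal (f (gaps k (pos k y))) \<partial>laplace_law k c)"
    by (rule nn_integral_exp_normal[OF c]) measurable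
  also have "\<dots> = (\<Sum>\<tau> | \<tau> permutes {0..k}. ennreal (wt k \<tau> c) * (\<integral>\<^sup>+x. ennreal (f x) \<partial>exp_law k (Fvec k \<tau> c)))"
    by (rule nn_integral_gaps_laplace_law[OF _ c]) measurable
  also have "\<dots> = (\<Sum>\<tau> | \<tau> permutes {0..k}. ennreal (wt k \<tau> c * (\<integral>x. f x \<partial>exp_law k (Fvec k \<tau> c))))"
  proof (rule sum.cong[OF refl])
    fix \<tau> assume "\<tau> \<in> {\<tau>. \<tau> permutes {0..k}}"
    then have \<tau>: "\<tau> permutes {0..k}" by simp
    have "(\<integral>\<^sup>+x. ennreal (f x) \<partial>exp_law k (Fvec k \<tau> c)) = ennreal (\<integral>x. f x \<partial>exp_law k (Fvec k \<tau> c))"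
      by (rule prob_space.unit_fn_integrable(4)[OF prob_space_exp_law[OF F[OF \<tau>]] f id])
    then show "ennreal (wt k \<tau> c) * (\<integral>\<^sup>+x. ennreal (f x) \<partial>exp_law k (Fvec k \<tau> c))
        = ennreal (wt k \<tau> c * (\<integral>x. f x \<partial>exp_law k (Fvec k \<tau> c)))"
      by (simp only: ennreal_mult[OF wt_nonneg[OF \<tau> c] nonneg])
  qed
  also have "\<dots> = ennreal (Qop k (\<lambda>c. \<integral>x. f x \<partial>exp_law k c) c)"
    unfolding Qop_def using wt_nonneg[OF _ c] nonneg by (intro sum_ennreal) auto
  finally have eq: "ennreal (\<integral>g. Pop k f g \<partial>exp_law k c) = ennreal (Qop k (\<lambda>c. \<integral>x. f x \<partial>exp_law k c) c)" .
  have "0 \<le> (\<integral>g. Pop k f g \<partial>exp_law k c)" using unit_fnD(2)[OF unit_fn_Pop[OF f]] by simp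
  moreover have "0 \<le> Qop k (\<lambda>c. \<integral>x. f x \<partial>exp_law k c) c"
    unfolding Qop_def using wt_nonneg[OF _ c] nonneg by (intro sum_nonneg mult_nonneg_nonneg) auto
  ultimately show ?thesis using eq by simp
qed

text \<open>The induction must vary \<open>c\<close>, since each application of \<open>Qop\<close>
  moves the rates to \<open>Fvec k \<tau> c\<close>; these remain positive.\<close>

lemma integral_exp_law_Pop_iterate:
  assumes "unit_fn k f" and "\<And>i. i \<in> {1..k} \<Longrightarrow> 0 < c i"
  shows "(\<integral>g. (Pop k ^^ n) f g \<partial>exp_law k c) = (Qop k ^^ n) (\<lambda>c. \<integral>x. f x \<partial>exp_law k c) c"
  using assms(2)
proof (induction n arbitrary: c)
  case (Suc n)
  have "(\<integral>g. (Pop k ^^ Suc n) f g \<partial>exp_law k c) = Qop k (\<lambda>c. \<integral>x. (Pop k ^^ n) f x \<partial>exp_law k c) c"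
    using integral_exp_law_Pop[OF unit_fn_Pop_iterate[OF assms(1)] Suc.prems] by simp
  also have "\<dots> = Qop k ((Qop k ^^ n) (\<lambda>c. \<integral>x. f x \<partial>exp_law k c)) c"
    unfolding Qop_def[of k _ c]
  proof (rule sum.cong[OF refl])
    fix \<tau> assume "\<tau> \<in> {\<tau>. \<tau> permutes {0..k}}"
    then have \<tau>: "\<tau> permutes {0..k}" by simp
    have "0 < Fvec k \<tau> c i" if "i \<in> {1..k}" for i
      using Fcomp_pos[OF \<tau> that Suc.prems] that by (simp add: Fvec_def)
    from Suc.IH[OF this] show "wt k \<tau> c * (\<integral>x. (Pop k ^^ n) f x \<partial>exp_law k (Fvec k \<tau> c))
        = wt k \<tau> c * (Qop k ^^ n) (\<lambda>c. \<integral>x. f x \<partial>exp_law k c) (Fvec k \<tau> c)" by simp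
  qed
  finally show ?case by simp
qed simp

section \<open>Iterated Brownian motions\<close>

text \<open>Evaluation \<open>(b, x) \<mapsto> b x\<close> is not measurable for the product \<open>\<sigma>\<close>-algebra on paths; this
  limit along a grid is, and it agrees with evaluation on continuous paths.\<close>
definition grid_eval :: "(real \<Rightarrow> real) \<Rightarrow> real \<Rightarrow> real" where
  "grid_eval b x = lim (\<lambda>m. b (of_int \<lfloor>x * real (Suc m)\<rfloor> / real (Suc m)))"

lemma grid_eval_continuous:
  assumes "continuous_on UNIV b"
  shows "grid_eval b x = b x"
proof -
  have "(\<lambda>m. of_int \<lfloor>x * real (Suc m)\<rfloor> / real (Suc m)) \<longlonglongrightarrow> x"
  proof (rule tendsto_sandwich)
    show "eventually (\<lambda>m. x - 1 / real (Suc m) \<le> of_int \<lfloor>x * real (Suc m)\<rfloor> / real (Suc m)) sequentially"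
    proof (rule always_eventually, rule allI)
      fix m
      have "x * real (Suc m) - 1 \<le> of_int \<lfloor>x * real (Suc m)\<rfloor>" by linarith
      then have "(x * real (Suc m) - 1) / real (Suc m) \<le> of_int \<lfloor>x * real (Suc m)\<rfloor> / real (Suc m)"
        by (intro divide_right_mono) auto
      then show "x - 1 / real (Suc m) \<le> of_int \<lfloor>x * real (Suc m)\<rfloor> / real (Suc m)"
        by (simp add: diff_divide_distrib del: of_nat_Suc)
    qed
    show "eventually (\<lambda>m. of_int \<lfloor>x * real (Suc m)\<rfloor> / real (Suc m) \<le> x) sequentially"
      by (intro always_eventually allI) (simp add: divide_le_eq del: of_nat_Suc)
    have "(\<lambda>m. x - 1 / real (Suc m)) \<longlonglongrightarrow> x - 0"
      by (intro tendsto_intros LIMSEQ_Suc[OF lim_1_over_n])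
    then show "(\<lambda>m. x - 1 / real (Suc m)) \<longlonglongrightarrow> x" by simp
  qed simp
  moreover have "isCont b x" using assms by (simp add: continuous_on_eq_continuous_at)
  ultimately have "(\<lambda>m. b (of_int \<lfloor>x * real (Suc m)\<rfloor> / real (Suc m))) \<longlonglongrightarrow> b x"
    by (rule isCont_tendsto_compose[rotated])
  then show ?thesis unfolding grid_eval_def by (rule limI)
qed

abbreviation path_space :: "(real \<Rightarrow> real) measure" where
  "path_space \<equiv> PiM UNIV (\<lambda>_. borel)"

text \<open>For each \<open>m\<close> the grid argument takes countably many values, and at a fixed
  value evaluation is a coordinate of the path.\<close>

lemma measurable_grid_eval:
  assumes b: "b \<in> N \<rightarrow>\<^sub>M path_space" and x [measurable]: "x \<in> borel_measurable N"
  shows "(\<lambda>p. grid_eval (b p) (x p)) \<in> borel_measurable N"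
proof -
  have [measurable]: "(\<lambda>p. b p (of_int \<lfloor>x p * real (Suc m)\<rfloor> / real (Suc m))) \<in> borel_measurable N" for m
  proof (rule measurable_compose_countable[where f="\<lambda>i p. b p (of_int i / real (Suc m))" and g="\<lambda>p. \<lfloor>x p * real (Suc m)\<rfloor>"])
    show "(\<lambda>p. b p (of_int i / real (Suc m))) \<in> borel_measurable N" for i
      by (rule measurable_compose[OF b measurable_component_singleton]) simp
    show "(\<lambda>p. \<lfloor>x p * real (Suc m)\<rfloor>) \<in> N \<rightarrow>\<^sub>M count_space UNIV" by measurable
  qed
  show ?thesis unfolding grid_eval_def by measurable
qed

primrec grid_comp :: "(nat \<Rightarrow> real \<Rightarrow> real) \<Rightarrow> nat \<Rightarrow> real \<Rightarrow> real" where
  "grid_comp b 0 x = x"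
| "grid_comp b (Suc n) x = grid_eval (b (Suc n)) (grid_comp b n x)"

lemma measurable_grid_comp:
  "n \<le> N \<Longrightarrow> (\<lambda>b. grid_comp b n x) \<in> borel_measurable (PiM {1..N} (\<lambda>_. path_space))"
proof (induction n)
  case (Suc n)
  then have "(\<lambda>b. b (Suc n)) \<in> PiM {1..N} (\<lambda>_. path_space) \<rightarrow>\<^sub>M path_space"
    by (intro measurable_component_singleton) auto
  then show ?case using Suc by (auto intro!: measurable_grid_eval)
qed simp

lemma distr_scale_normal_law:
  assumes g: "\<And>i. i \<in> {1..k} \<Longrightarrow> 0 < g i"
  shows "distr (normal_law k) (PiM {1..k} (\<lambda>_. borel)) (scale k g)
       = PiM {1..k} (\<lambda>i. density lborel (\<lambda>x. ennreal (normal_density 0 (sqrt (g i)) x)))"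
proof -
  interpret std: prob_space std_normal_distribution by (rule prob_space_normal_density) simp
  have "distr (normal_law k) (PiM {1..k} (\<lambda>_. borel)) (scale k g)
      = PiM {1..k} (\<lambda>i. distr std_normal_distribution borel (\<lambda>z. sqrt (g i) * z))"
    unfolding normal_law_def scale_def[abs_def]
    by (rule distr_PiM_map) (auto intro: std.prob_space_axioms)
  also have "\<dots> = PiM {1..k} (\<lambda>i. density lborel (\<lambda>x. ennreal (normal_density 0 (sqrt (g i)) x)))"
  proof (rule PiM_cong[OF refl])
    fix i assume i: "i \<in> {1..k}"
    have "distributed std_normal_distribution lborel (\<lambda>z. z) std_normal_density"
      unfolding distributed_def by (auto intro!: distr_id2)
    from std.normal_density_affine[OF this, of "sqrt (g i)" 0]
    have "distributed std_normal_distribution lborel (\<lambda>z. sqrt (g i) * z) (normal_density 0 (sqrt (g i)))"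
      using g[OF i] by simp
    then have "distr std_normal_distribution lborel (\<lambda>z. sqrt (g i) * z) = density lborel (\<lambda>x. ennreal (normal_density 0 (sqrt (g i)) x))"
      by (rule distributed_distr_eq_density)
    moreover have "distr std_normal_distribution borel (\<lambda>z. sqrt (g i) * z) = distr std_normal_distribution lborel (\<lambda>z. sqrt (g i) * z)"
      by (rule distr_cong) auto
    ultimately show "distr std_normal_distribution borel (\<lambda>z. sqrt (g i) * z) = density lborel (\<lambda>x. ennreal (normal_density 0 (sqrt (g i)) x))"
      by simp
  qed
  finally show ?thesis .
qed

lemma pred_inj_on [measurable]:
  "Measurable.pred (PiM {1..Suc k} (\<lambda>_. borel)) (\<lambda>x :: nat \<Rightarrow> real. inj_on x {1..Suc k})"
proof -
  have *: "Measurable.pred (PiM {1..Suc k} (\<lambda>_. borel)) (\<lambda>x :: nat \<Rightarrow> real. x i = x j)"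
    if "i \<in> {1..Suc k}" "j \<in> {1..Suc k}" for i j
  proof -
    from that have "(\<lambda>x. x i) \<in> borel_measurable (PiM {1..Suc k} (\<lambda>_. borel :: real measure))"
      "(\<lambda>x. x j) \<in> borel_measurable (PiM {1..Suc k} (\<lambda>_. borel :: real measure))"
      by (auto intro: measurable_component_singleton)
    then show ?thesis unfolding pred_def by (rule borel_measurable_eq)
  qed
  show ?thesis
    unfolding inj_on_def by (intro pred_intros_finite pred_intros_logic *) auto
qed

locale iterated_BM = prob_space M for M :: "'a measure" +
  fixes B :: "nat \<Rightarrow> 'a \<Rightarrow> real \<Rightarrow> real" and k :: nat
  assumes k_pos: "k \<ge> 1"
    and BM: "\<And>n. n \<ge> 1 \<Longrightarrow> two_sided_BM M (B n)"
    and B_indep: "indep_vars (\<lambda>_. path_space) B {1..}"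
begin

definition Ipos :: "nat \<Rightarrow> (nat \<Rightarrow> real) \<Rightarrow> 'a \<Rightarrow> nat \<Rightarrow> real" where
  "Ipos n t \<omega> = (\<lambda>i\<in>{1..Suc k}. Icomp B n \<omega> (t i))"

lemma B_continuous: "n \<ge> 1 \<Longrightarrow> \<omega> \<in> space M \<Longrightarrow> continuous_on UNIV (B n \<omega>)"
  using BM unfolding two_sided_BM_def by blast

lemma measurable_B_path: "n \<ge> 1 \<Longrightarrow> B n \<in> M \<rightarrow>\<^sub>M path_space"
  using B_indep unfolding indep_vars_def by auto

lemma measurable_B [measurable (raw)]: "n \<ge> 1 \<Longrightarrow> (\<lambda>\<omega>. B n \<omega> x) \<in> borel_measurable M"
  using BM unfolding two_sided_BM_def by blast

lemma grid_comp_eq_Icomp: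
  assumes "\<omega> \<in> space M"
  shows "n \<le> N \<Longrightarrow> grid_comp (\<lambda>i\<in>{1..N}. B i \<omega>) n x = Icomp B n \<omega> x"
  by (induction n) (auto simp: grid_eval_continuous[OF B_continuous[OF _ assms]])

lemma Ipos_eq_grid_comp:
  assumes "\<omega> \<in> space M" "n \<le> N"
  shows "Ipos n t \<omega> = (\<lambda>i\<in>{1..Suc k}. grid_comp (\<lambda>i\<in>{1..N}. B i \<omega>) n (t i))"
  unfolding Ipos_def using grid_comp_eq_Icomp[OF assms] by (intro restrict_ext) simp

lemma measurable_B_restrict: "(\<lambda>\<omega>. \<lambda>i\<in>{1..N}. B i \<omega>) \<in> M \<rightarrow>\<^sub>M PiM {1..N} (\<lambda>_. path_space)"
  by (intro measurable_restrict measurable_B_path) auto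

lemma measurable_grid_comp_vec:
  "n \<le> N \<Longrightarrow> (\<lambda>b. \<lambda>i\<in>{1..Suc k}. grid_comp b n (t i)) \<in> PiM {1..N} (\<lambda>_. path_space) \<rightarrow>\<^sub>M PiM {1..Suc k} (\<lambda>_. borel)"
  by (intro measurable_restrict measurable_grid_comp)

lemma measurable_Ipos [measurable]: "Ipos n t \<in> M \<rightarrow>\<^sub>M PiM {1..Suc k} (\<lambda>_. borel)"
  using measurable_compose[OF measurable_B_restrict measurable_grid_comp_vec[OF le_refl]]
  by (rule measurable_cong[THEN iffD1, rotated]) (rule Ipos_eq_grid_comp[OF _ le_refl, symmetric])

text \<open>The newest motion is independent of the earlier ones, so the joint law is a product and
  the two can be sampled separately. The map \<open>\<Psi>\<close> evaluates along a grid in order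
  to be measurable on all paths.\<close>

lemma nn_integral_Ipos_Suc:
  assumes F [measurable]: "F \<in> borel_measurable (PiM {1..Suc k} (\<lambda>_. borel))"
  shows "(\<integral>\<^sup>+\<omega>. F (Ipos (Suc n) t \<omega>) \<partial>M)
       = (\<integral>\<^sup>+\<omega>. (\<integral>\<^sup>+\<omega>'. F (\<lambda>i\<in>{1..Suc k}. B (Suc n) \<omega>' (Ipos n t \<omega> i)) \<partial>M) \<partial>M)"
proof -
  define S1 where "S1 = PiM {1..n} (\<lambda>_. path_space)"
  define S2 where "S2 = PiM {Suc n} (\<lambda>_. path_space)"
  define U where "U = (\<lambda>\<omega>. \<lambda>i\<in>{1..n}. B i \<omega>)"
  define V where "V = (\<lambda>\<omega>. \<lambda>i\<in>{Suc n}. B i \<omega>)"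
  define G where "G = (\<lambda>b. \<lambda>i\<in>{1..Suc k}. grid_comp b n (t i))"
  define \<Psi> where "\<Psi> = (\<lambda>p. \<lambda>i\<in>{1..Suc k}. grid_eval (snd p (Suc n)) (G (fst p) i))"
  have U [measurable]: "U \<in> M \<rightarrow>\<^sub>M S1" unfolding U_def S1_def by (rule measurable_B_restrict)
  have V [measurable]: "V \<in> M \<rightarrow>\<^sub>M S2"
    unfolding V_def S2_def by (intro measurable_restrict measurable_B_path) auto
  have G: "G \<in> S1 \<rightarrow>\<^sub>M PiM {1..Suc k} (\<lambda>_. borel)"
    unfolding G_def S1_def by (rule measurable_grid_comp_vec) simp
  have ev: "(\<lambda>b. b (Suc n)) \<in> S2 \<rightarrow>\<^sub>M path_space"
    unfolding S2_def by (intro measurable_component_singleton) auto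
  have \<Psi> [measurable]: "\<Psi> \<in> S1 \<Otimes>\<^sub>M S2 \<rightarrow>\<^sub>M PiM {1..Suc k} (\<lambda>_. borel)"
    unfolding \<Psi>_def
    by (intro measurable_restrict measurable_grid_eval measurable_compose[OF measurable_snd ev]
          measurable_compose[OF measurable_compose[OF measurable_fst G] measurable_component_singleton])
  interpret DV: prob_space "distr M S2 V" by (rule prob_space_distr) measurable
  have "indep_var S1 U S2 V"
    unfolding S1_def S2_def U_def V_def by (rule indep_var_restrict[OF B_indep]) auto
  then have dist: "distr M (S1 \<Otimes>\<^sub>M S2) (\<lambda>\<omega>. (U \<omega>, V \<omega>)) = distr M S1 U \<Otimes>\<^sub>M distr M S2 V"
    by (simp add: indep_var_distribution_eq)
  have G_eq: "G (U \<omega>) = Ipos n t \<omega>" if "\<omega> \<in> space M" for \<omega>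
    unfolding G_def U_def using Ipos_eq_grid_comp[OF that le_refl] by simp
  \<comment> \<open>Only the path \<open>V \<omega>\<close> has to be continuous here;
    \<open>u\<close> is arbitrary, which allows the earlier motions and the newest one to be taken
    at different sample points.\<close>
  have \<Psi>_eq: "\<Psi> (u, V \<omega>) = (\<lambda>i\<in>{1..Suc k}. B (Suc n) \<omega> (G u i))" if "\<omega> \<in> space M" for \<omega> u
    unfolding \<Psi>_def V_def using grid_eval_continuous[OF B_continuous[OF _ that]] by auto
  have "(\<integral>\<^sup>+\<omega>. F (Ipos (Suc n) t \<omega>) \<partial>M) = (\<integral>\<^sup>+\<omega>. F (\<Psi> (U \<omega>, V \<omega>)) \<partial>M)"
  proof (rule nn_integral_cong)
    fix \<omega> assume "\<omega> \<in> space M"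
    then have "\<Psi> (U \<omega>, V \<omega>) = Ipos (Suc n) t \<omega>" by (auto simp: \<Psi>_eq G_eq Ipos_def)
    then show "F (Ipos (Suc n) t \<omega>) = F (\<Psi> (U \<omega>, V \<omega>))" by simp
  qed
  also have "\<dots> = (\<integral>\<^sup>+p. F (\<Psi> p) \<partial>distr M (S1 \<Otimes>\<^sub>M S2) (\<lambda>\<omega>. (U \<omega>, V \<omega>)))"
    by (rule nn_integral_distr[symmetric]) measurable
  also have "\<dots> = (\<integral>\<^sup>+u. (\<integral>\<^sup>+v. F (\<Psi> (u, v)) \<partial>distr M S2 V) \<partial>distr M S1 U)"
    unfolding dist by (rule DV.nn_integral_fst[symmetric]) measurable
  also have "\<dots> = (\<integral>\<^sup>+\<omega>. (\<integral>\<^sup>+v. F (\<Psi> (U \<omega>, v)) \<partial>distr M S2 V) \<partial>M)"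
    by (rule nn_integral_distr) measurable
  also have "\<dots> = (\<integral>\<^sup>+\<omega>. (\<integral>\<^sup>+\<omega>'. F (\<lambda>i\<in>{1..Suc k}. B (Suc n) \<omega>' (Ipos n t \<omega> i)) \<partial>M) \<partial>M)"
  proof (rule nn_integral_cong)
    fix \<omega> assume \<omega>: "\<omega> \<in> space M"
    then have [simp]: "U \<omega> \<in> space S1" by (rule measurable_space[OF U])
    have "(\<lambda>v. F (\<Psi> (U \<omega>, v))) \<in> borel_measurable S2" by measurable
    then have "(\<integral>\<^sup>+v. F (\<Psi> (U \<omega>, v)) \<partial>distr M S2 V) = (\<integral>\<^sup>+\<omega>'. F (\<Psi> (U \<omega>, V \<omega>')) \<partial>M)"
      by (intro nn_integral_distr V) simp
    also have "\<dots> = (\<integral>\<^sup>+\<omega>'. F (\<lambda>i\<in>{1..Suc k}. B (Suc n) \<omega>' (Ipos n t \<omega> i)) \<partial>M)"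
      by (intro nn_integral_cong) (simp only: \<Psi>_eq G_eq[OF \<omega>])
    finally show "(\<integral>\<^sup>+v. F (\<Psi> (U \<omega>, v)) \<partial>distr M S2 V)
        = (\<integral>\<^sup>+\<omega>'. F (\<lambda>i\<in>{1..Suc k}. B (Suc n) \<omega>' (Ipos n t \<omega> i)) \<partial>M)" .
  qed
  finally show ?thesis .
qed

text \<open>A Gaussian increment over a nondegenerate interval has no atom at 0.\<close>

lemma AE_B_neq:
  assumes n: "n \<ge> 1" and "a \<noteq> b"
  shows "AE \<omega> in M. B n \<omega> a \<noteq> B n \<omega> b"
proof -
  have *: "AE \<omega> in M. B n \<omega> a \<noteq> B n \<omega> b" if ab: "a < b" for a b
  proof -
    define t where "t = (\<lambda>i::nat. if i = 0 then a else b)"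
    have "\<forall>i<1. t i < t (Suc i)" using ab by (simp add: t_def)
    then have "distributed M lborel (\<lambda>\<omega>. B n \<omega> (t (Suc 0)) - B n \<omega> (t 0)) (normal_density 0 (sqrt (t (Suc 0) - t 0)))"
      using BM[OF n] unfolding two_sided_BM_def by (metis less_one)
    then have D: "distributed M lborel (\<lambda>\<omega>. B n \<omega> b - B n \<omega> a) (normal_density 0 (sqrt (b - a)))"
      by (simp add: t_def)
    have "emeasure M ((\<lambda>\<omega>. B n \<omega> b - B n \<omega> a) -` {0} \<inter> space M)
        = (\<integral>\<^sup>+x. ennreal (normal_density 0 (sqrt (b - a)) x) * indicator {0} x \<partial>lborel)"
      by (rule distributed_emeasure[OF D]) auto
    also have "\<dots> = (\<integral>\<^sup>+x. 0 \<partial>(lborel :: real measure))"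
    proof (rule nn_integral_cong_AE)
      have "AE x in lborel. x \<noteq> (0::real)" by (rule AE_lborel_singleton)
      then show "AE x in lborel. ennreal (normal_density 0 (sqrt (b - a)) x) * indicator {0} x = 0"
        by eventually_elim auto
    qed
    finally have "emeasure M ((\<lambda>\<omega>. B n \<omega> b - B n \<omega> a) -` {0} \<inter> space M) = 0" by simp
    moreover have "(\<lambda>\<omega>. B n \<omega> b - B n \<omega> a) -` {0} \<inter> space M \<in> sets M"
      using distributed_measurable[OF D] by (rule measurable_sets) auto
    ultimately show ?thesis by (intro AE_I[OF _ _ ]) auto
  qed
  show ?thesis
  proof (cases "a < b")
    case False
    then have "AE \<omega> in M. B n \<omega> b \<noteq> B n \<omega> a" using \<open>a \<noteq> b\<close> by (intro *) auto
    then show ?thesis by eventually_elim simp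
  qed (rule *)
qed

text \<open>Distinctness has to survive each step, because the independence of Brownian increments
  is available only along strictly increasing times.\<close>

lemma AE_inj_on_Ipos:
  assumes "inj_on t {1..Suc k}"
  shows "AE \<omega> in M. inj_on (Ipos n t \<omega>) {1..Suc k}"
proof (induction n)
  case 0
  show ?case using assms by (auto simp: Ipos_def inj_on_def)
next
  case (Suc n)
  define F where "F = (\<lambda>x :: nat \<Rightarrow> real. of_bool (\<not> inj_on x {1..Suc k}) :: ennreal)"
  have [measurable]: "F \<in> borel_measurable (PiM {1..Suc k} (\<lambda>_. borel))"
    unfolding F_def of_bool_def by measurable
  have "(\<integral>\<^sup>+\<omega>. F (Ipos (Suc n) t \<omega>) \<partial>M)
      = (\<integral>\<^sup>+\<omega>. (\<integral>\<^sup>+\<omega>'. F (\<lambda>i\<in>{1..Suc k}. B (Suc n) \<omega>' (Ipos n t \<omega> i)) \<partial>M) \<partial>M)"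
    by (rule nn_integral_Ipos_Suc) measurable
  also have "\<dots> = (\<integral>\<^sup>+\<omega>. 0 \<partial>M)"
  proof (rule nn_integral_cong_AE)
    show "AE \<omega> in M. (\<integral>\<^sup>+\<omega>'. F (\<lambda>i\<in>{1..Suc k}. B (Suc n) \<omega>' (Ipos n t \<omega> i)) \<partial>M) = 0"
      using Suc
    proof eventually_elim
      fix \<omega> assume inj: "inj_on (Ipos n t \<omega>) {1..Suc k}"
      have "AE \<omega>' in M. \<forall>i\<in>{1..Suc k}. \<forall>j\<in>{1..Suc k}. i \<noteq> j \<longrightarrow> B (Suc n) \<omega>' (Ipos n t \<omega> i) \<noteq> B (Suc n) \<omega>' (Ipos n t \<omega> j)"
      proof (intro AE_finite_allI finite_atLeastAtMost)
        fix i j assume ij: "i \<in> {1..Suc k}" "j \<in> {1..Suc k}"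
        show "AE \<omega>' in M. i \<noteq> j \<longrightarrow> B (Suc n) \<omega>' (Ipos n t \<omega> i) \<noteq> B (Suc n) \<omega>' (Ipos n t \<omega> j)"
        proof (cases "i = j")
          case False
          then have "Ipos n t \<omega> i \<noteq> Ipos n t \<omega> j" using inj ij by (auto dest: inj_onD)
          then show ?thesis using AE_B_neq[of "Suc n"] by simp
        qed simp
      qed
      then have "AE \<omega>' in M. F (\<lambda>i\<in>{1..Suc k}. B (Suc n) \<omega>' (Ipos n t \<omega> i)) = 0"
      proof eventually_elim
        fix \<omega>' assume *: "\<forall>i\<in>{1..Suc k}. \<forall>j\<in>{1..Suc k}. i \<noteq> j \<longrightarrow> B (Suc n) \<omega>' (Ipos n t \<omega> i) \<noteq> B (Suc n) \<omega>' (Ipos n t \<omega> j)"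
        have "inj_on (\<lambda>i\<in>{1..Suc k}. B (Suc n) \<omega>' (Ipos n t \<omega> i)) {1..Suc k}"
        proof (rule inj_onI, rule ccontr)
          fix i j assume "i \<in> {1..Suc k}" "j \<in> {1..Suc k}" "i \<noteq> j"
            "(\<lambda>i\<in>{1..Suc k}. B (Suc n) \<omega>' (Ipos n t \<omega> i)) i = (\<lambda>i\<in>{1..Suc k}. B (Suc n) \<omega>' (Ipos n t \<omega> i)) j"
          then show False using *[rule_format, of i j] by simp
        qed
        then show "F (\<lambda>i\<in>{1..Suc k}. B (Suc n) \<omega>' (Ipos n t \<omega> i)) = 0" by (simp only: F_def of_bool_eq not_True_eq_False)
      qed
      then show "(\<integral>\<^sup>+\<omega>'. F (\<lambda>i\<in>{1..Suc k}. B (Suc n) \<omega>' (Ipos n t \<omega> i)) \<partial>M) = 0"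
        by (subst nn_integral_cong_AE[where v="\<lambda>_. 0"]) auto
    qed
  qed
  finally have "(\<integral>\<^sup>+\<omega>. F (Ipos (Suc n) t \<omega>) \<partial>M) = 0" by simp
  then have "AE \<omega> in M. F (Ipos (Suc n) t \<omega>) = 0"
    by (subst (asm) nn_integral_0_iff_AE) auto
  then show ?case by eventually_elim (auto simp: F_def)
qed

text \<open>The values at the sorted points form a walk whose increments are independent Gaussians
  with the gaps as variances. \<open>gaps\<close> sees neither the labels of the points nor the
  value at the lowest one, so only \<open>gaps k x\<close> enters.\<close>

lemma nn_integral_gaps_B:
  assumes n: "n \<ge> 1" and x: "inj_on x {1..Suc k}"
    and f [measurable]: "f \<in> borel_measurable (PiM {1..k} (\<lambda>_. borel))"
  shows "(\<integral>\<^sup>+\<omega>. f (gaps k (\<lambda>j\<in>{1..Suc k}. B n \<omega> (x j))) \<partial>M)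
       = (\<integral>\<^sup>+z. f (gaps k (pos k (scale k (gaps k x) z))) \<partial>normal_law k)"
proof -
  have "inj_on (\<lambda>j. x (Suc j)) {0..k}"
  proof (rule inj_onI)
    fix i j assume "i \<in> {0..k}" "j \<in> {0..k}" "x (Suc i) = x (Suc j)"
    then have "Suc i = Suc j" by (intro inj_onD[OF x]) auto
    then show "i = j" by simp
  qed
  from ex1_rank_perm[OF this] obtain \<tau> where
    \<tau>: "\<tau> permutes {0..k}" and r: "rank_perm k (\<lambda>j. x (Suc j)) \<tau>" by blast
  \<comment> \<open>The increasing rearrangement of the points, indexed from 0.\<close>
  define s where "s = (\<lambda>i. x (Suc (inv \<tau> i)))"
  have in_inv: "inv \<tau> i \<in> {0..k}" if "i \<in> {0..k}" for i
    using permutes_in_image[OF permutes_inv[OF \<tau>], of i] that by blast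
  have s_rank: "rank_perm k s id"
    unfolding rank_perm_def
  proof (intro ballI)
    fix i j assume "i \<in> {0..k}" "j \<in> {0..k}"
    then have "inv \<tau> i \<in> {0..k}" "inv \<tau> j \<in> {0..k}" using in_inv by auto
    then show "s i < s j \<longleftrightarrow> id i < id j"
      using r by (auto simp: rank_perm_def s_def permutes_inverses[OF \<tau>])
  qed
  have x_s: "x j = s (\<tau> (j - 1))" if "j \<in> {1..Suc k}" for j
    using that by (simp add: s_def permutes_inverses[OF \<tau>])
  define g where "g = gaps k x"
  have "g = gaps k (\<lambda>j\<in>{1..Suc k}. s (\<tau> (j - 1)))"
    unfolding g_def using x_s by (intro gaps_cong) auto
  then have g: "g = (\<lambda>i\<in>{1..k}. s i - s (i - 1))"
    using gaps_rank_perm[OF \<tau> s_rank] by simp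
  have s_less: "s i < s (Suc i)" if "i < k" for i
    using s_rank that by (auto simp: rank_perm_def)
  have g_pos: "0 < g i" if "i \<in> {1..k}" for i
    using s_less[of "i - 1"] that by (auto simp: g)
  define D where "D = (\<lambda>i \<omega>. B n \<omega> (s (Suc i)) - B n \<omega> (s i))"
  have "\<forall>i<k. s i < s (Suc i)" using s_less by simp
  then have D_indep: "indep_vars (\<lambda>_. borel) D {..<k}"
    and D_dist: "\<And>i. i < k \<Longrightarrow> distributed M lborel (D i) (normal_density 0 (sqrt (s (Suc i) - s i)))"
    using BM[OF n] unfolding two_sided_BM_def D_def by blast+
  have [measurable]: "D i \<in> borel_measurable M" for i
    unfolding D_def using n by measurable
  have law: "distr M (PiM {1..k} (\<lambda>_. borel)) (\<lambda>\<omega>. \<lambda>i\<in>{1..k}. D (i - 1) \<omega>)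
      = distr (normal_law k) (PiM {1..k} (\<lambda>_. borel)) (scale k g)"
  proof -
    \<comment> \<open>The description of independence by a product law asks for a nonempty index
      set; \<open>k \<ge> 1\<close> provides it.\<close>
    have "0 \<in> {..<k}" using k_pos by simp
    then have k_ne: "{..<k} \<noteq> {}" by blast
    have "distr M (PiM {..<k} (\<lambda>_. borel)) (\<lambda>\<omega>. \<lambda>i\<in>{..<k}. D i \<omega>) = PiM {..<k} (\<lambda>i. distr M borel (D i))"
      using D_indep k_ne by (subst (asm) indep_vars_iff_distr_eq_PiM') auto
    moreover have "distr (PiM {..<k} (\<lambda>i. distr M borel (D i))) (PiM {1..k} (\<lambda>i. distr M borel (D (i - 1))))
          (\<lambda>y. \<lambda>i\<in>{1..k}. y (i - 1)) = PiM {1..k} (\<lambda>i. distr M borel (D (i - 1)))"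
      by (rule distr_PiM_reindex) (auto simp: inj_on_def prob_space_distr)
    ultimately have "PiM {1..k} (\<lambda>i. distr M borel (D (i - 1)))
        = distr (distr M (PiM {..<k} (\<lambda>_. borel)) (\<lambda>\<omega>. \<lambda>i\<in>{..<k}. D i \<omega>))
            (PiM {1..k} (\<lambda>i. distr M borel (D (i - 1)))) (\<lambda>y. \<lambda>i\<in>{1..k}. y (i - 1))"
      by simp
    also have "\<dots> = distr (distr M (PiM {..<k} (\<lambda>_. borel)) (\<lambda>\<omega>. \<lambda>i\<in>{..<k}. D i \<omega>))
            (PiM {1..k} (\<lambda>_. borel)) (\<lambda>y. \<lambda>i\<in>{1..k}. y (i - 1))"
      by (intro distr_cong sets_PiM_cong) auto
    also have "\<dots> = distr M (PiM {1..k} (\<lambda>_. borel)) (\<lambda>\<omega>. \<lambda>i\<in>{1..k}. D (i - 1) \<omega>)"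
    proof -
      have meas: "(\<lambda>y. \<lambda>i\<in>{1..k}. y (i - 1)) \<in> PiM {..<k} (\<lambda>_. borel) \<rightarrow>\<^sub>M PiM {1..k} (\<lambda>_. borel :: real measure)"
        by (intro measurable_restrict measurable_component_singleton) auto
      have meas_D: "(\<lambda>\<omega>. \<lambda>i\<in>{..<k}. D i \<omega>) \<in> M \<rightarrow>\<^sub>M PiM {..<k} (\<lambda>_. borel)"
        by measurable
      have comp: "(\<lambda>y. \<lambda>i\<in>{1..k}. y (i - 1)) \<circ> (\<lambda>\<omega>. \<lambda>i\<in>{..<k}. D i \<omega>) = (\<lambda>\<omega>. \<lambda>i\<in>{1..k}. D (i - 1) \<omega>)"
      proof
        fix \<omega>
        have "(\<lambda>i\<in>{..<k}. D i \<omega>) (i - 1) = D (i - 1) \<omega>" if "i \<in> {1..k}" for i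
        proof -
          have "i - 1 \<in> {..<k}" using that by auto
          then show ?thesis by (rule restrict_apply')
        qed
        then show "((\<lambda>y. \<lambda>i\<in>{1..k}. y (i - 1)) \<circ> (\<lambda>\<omega>. \<lambda>i\<in>{..<k}. D i \<omega>)) \<omega> = (\<lambda>i\<in>{1..k}. D (i - 1) \<omega>)"
          unfolding comp_def by (intro restrict_ext)
      qed
      show ?thesis unfolding distr_distr[OF meas meas_D] comp ..
    qed
    finally have "distr M (PiM {1..k} (\<lambda>_. borel)) (\<lambda>\<omega>. \<lambda>i\<in>{1..k}. D (i - 1) \<omega>)
        = PiM {1..k} (\<lambda>i. distr M borel (D (i - 1)))" ..
    also have "\<dots> = PiM {1..k} (\<lambda>i. density lborel (\<lambda>x. ennreal (normal_density 0 (sqrt (g i)) x)))"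
    proof (rule PiM_cong[OF refl])
      fix i assume i: "i \<in> {1..k}"
      then have "distributed M lborel (D (i - 1)) (normal_density 0 (sqrt (s (Suc (i - 1)) - s (i - 1))))"
        by (intro D_dist) auto
      then have "distributed M lborel (D (i - 1)) (normal_density 0 (sqrt (g i)))"
        using i by (simp add: g)
      from distributed_distr_eq_density[OF this]
      have "distr M lborel (D (i - 1)) = density lborel (\<lambda>x. ennreal (normal_density 0 (sqrt (g i)) x))" .
      moreover have "distr M borel (D (i - 1)) = distr M lborel (D (i - 1))" by (rule distr_cong) auto
      ultimately show "distr M borel (D (i - 1)) = density lborel (\<lambda>x. ennreal (normal_density 0 (sqrt (g i)) x))"
        by simp
    qed
    also have "\<dots> = distr (normal_law k) (PiM {1..k} (\<lambda>_. borel)) (scale k g)"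
      by (rule distr_scale_normal_law[symmetric]) (rule g_pos)
    finally show ?thesis .
  qed
  have tele: "pos k (\<lambda>i\<in>{1..k}. D (i - 1) \<omega>) (Suc m) = B n \<omega> (s m) - B n \<omega> (s 0)" if "m \<le> k" for m \<omega>
  proof -
    have "pos k (\<lambda>i\<in>{1..k}. D (i - 1) \<omega>) (Suc m) = (\<Sum>i\<in>{1..<Suc m}. D (i - 1) \<omega>)"
      using that unfolding pos_def by (auto intro!: sum.cong)
    also have "\<dots> = (\<Sum>i<m. D i \<omega>)"
      by (rule sum.reindex_bij_witness[of _ Suc "\<lambda>i. i - 1"]) auto
    also have "\<dots> = B n \<omega> (s m) - B n \<omega> (s 0)"
      unfolding D_def by (rule sum_lessThan_telescope)
    finally show ?thesis .
  qed
  have gaps_eq: "gaps k (\<lambda>j\<in>{1..Suc k}. B n \<omega> (x j)) = gaps k (pos k (\<lambda>i\<in>{1..k}. D (i - 1) \<omega>))" for \<omega>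
  proof (rule gaps_permute_shift[OF bij_betw_Suc_permutation[OF \<tau>], where c="B n \<omega> (s 0)"])
    fix j assume j: "j \<in> {1..Suc k}"
    then have "\<tau> (j - 1) \<in> {0..k}" using permutes_in_image[OF \<tau>, of "j - 1"] by auto
    then show "(\<lambda>j\<in>{1..Suc k}. B n \<omega> (x j)) j = pos k (\<lambda>i\<in>{1..k}. D (i - 1) \<omega>) (Suc (\<tau> (j - 1))) + B n \<omega> (s 0)"
      using j x_s[OF j] tele[of "\<tau> (j - 1)" \<omega>] by auto
  qed
  have "(\<integral>\<^sup>+\<omega>. f (gaps k (\<lambda>j\<in>{1..Suc k}. B n \<omega> (x j))) \<partial>M)
      = (\<integral>\<^sup>+y. f (gaps k (pos k y)) \<partial>distr M (PiM {1..k} (\<lambda>_. borel)) (\<lambda>\<omega>. \<lambda>i\<in>{1..k}. D (i - 1) \<omega>))"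
    unfolding gaps_eq by (rule nn_integral_distr[symmetric]) measurable
  also have "\<dots> = (\<integral>\<^sup>+z. f (gaps k (pos k (scale k g z))) \<partial>normal_law k)"
    unfolding law by (rule nn_integral_distr) measurable
  finally show ?thesis unfolding g_def .
qed

text \<open>Integrating out the outermost motion turns \<open>f\<close> into \<open>Pop k f\<close>
  evaluated at the gaps one step earlier. Hence the induction ranges over all \<open>f\<close>, and
  the operator is peeled off next to \<open>f\<close>.\<close>

lemma integral_gaps_Ipos:
  assumes f: "unit_fn k f" and t: "inj_on t {1..Suc k}"
  shows "(\<integral>\<omega>. f (gaps k (Ipos n t \<omega>)) \<partial>M) = (Pop k ^^ n) f (gaps k t)"
  using f
proof (induction n arbitrary: f)
  case 0
  have "gaps k (Ipos 0 t \<omega>) = gaps k t" for \<omega> by (rule gaps_cong) (simp add: Ipos_def)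
  then show ?case by (simp add: prob_space)
next
  case (Suc n)
  note [measurable] = unit_fnD(1)[OF Suc.prems] unit_fnD(1)[OF unit_fn_Pop[OF Suc.prems]]
  have meas: "(\<lambda>\<omega>. gaps k (Ipos n t \<omega>)) \<in> M \<rightarrow>\<^sub>M PiM {1..k} (\<lambda>_. borel)" for n by measurable
  have "ennreal (\<integral>\<omega>. f (gaps k (Ipos (Suc n) t \<omega>)) \<partial>M) = (\<integral>\<^sup>+\<omega>. ennreal (f (gaps k (Ipos (Suc n) t \<omega>))) \<partial>M)"
    by (rule unit_fn_integrable(4)[OF Suc.prems meas, symmetric])
  also have "\<dots> = (\<integral>\<^sup>+\<omega>. (\<integral>\<^sup>+\<omega>'. ennreal (f (gaps k (\<lambda>i\<in>{1..Suc k}. B (Suc n) \<omega>' (Ipos n t \<omega> i)))) \<partial>M) \<partial>M)"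
    by (rule nn_integral_Ipos_Suc) measurable
  also have "\<dots> = (\<integral>\<^sup>+\<omega>. ennreal (Pop k f (gaps k (Ipos n t \<omega>))) \<partial>M)"
  proof (rule nn_integral_cong_AE)
    show "AE \<omega> in M. (\<integral>\<^sup>+\<omega>'. ennreal (f (gaps k (\<lambda>i\<in>{1..Suc k}. B (Suc n) \<omega>' (Ipos n t \<omega> i)))) \<partial>M)
        = ennreal (Pop k f (gaps k (Ipos n t \<omega>)))"
      using AE_inj_on_Ipos[OF t]
    proof eventually_elim
      fix \<omega> assume inj: "inj_on (Ipos n t \<omega>) {1..Suc k}"
      show "(\<integral>\<^sup>+\<omega>'. ennreal (f (gaps k (\<lambda>i\<in>{1..Suc k}. B (Suc n) \<omega>' (Ipos n t \<omega> i)))) \<partial>M)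
        = ennreal (Pop k f (gaps k (Ipos n t \<omega>)))"
        unfolding ennreal_Pop[OF Suc.prems] by (rule nn_integral_gaps_B[OF _ inj]) (simp, measurable)
    qed
  qed
  also have "\<dots> = ennreal (\<integral>\<omega>. Pop k f (gaps k (Ipos n t \<omega>)) \<partial>M)"
    by (rule unit_fn_integrable(4)[OF unit_fn_Pop[OF Suc.prems] meas])
  also have "(\<integral>\<omega>. Pop k f (gaps k (Ipos n t \<omega>)) \<partial>M) = (Pop k ^^ n) (Pop k f) (gaps k t)"
    by (rule Suc.IH[OF unit_fn_Pop[OF Suc.prems]])
  also have "(Pop k ^^ n) (Pop k f) = (Pop k ^^ Suc n) f" by (simp add: funpow_swap1)
  finally have "ennreal (\<integral>\<omega>. f (gaps k (Ipos (Suc n) t \<omega>)) \<partial>M) = ennreal ((Pop k ^^ Suc n) f (gaps k t))" .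
  then show ?case
    using unit_fn_integrable(2)[OF Suc.prems meas] unit_fnD(2)[OF unit_fn_Pop_iterate[OF Suc.prems]]
    by (simp del: funpow.simps)
qed

end

section \<open>Test functions and passage to the limit\<close>

definition clamp01 :: "real \<Rightarrow> real" where
  "clamp01 u = max 0 (min 1 u)"

lemma clamp01_bounds: "0 \<le> clamp01 u" "clamp01 u \<le> 1"
  by (auto simp: clamp01_def)

lemma continuous_on_clamp01 [continuous_intros]:
  "continuous_on A f \<Longrightarrow> continuous_on A (\<lambda>x. clamp01 (f x))"
  unfolding clamp01_def by (intro continuous_intros)

lemma tendsto_clamp01 [tendsto_intros]:
  "(f \<longlongrightarrow> l) F \<Longrightarrow> ((\<lambda>x. clamp01 (f x)) \<longlongrightarrow> clamp01 l) F"
  unfolding clamp01_def by (intro tendsto_intros)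

lemma borel_measurable_clamp01 [measurable]: "clamp01 \<in> borel_measurable borel"
  unfolding clamp01_def[abs_def] by measurable

lemma clamp01_limit: "(\<lambda>m. clamp01 (real m * u)) \<longlonglongrightarrow> (if 0 < u then 1 else 0)"
proof (cases "0 < u")
  case True
  then obtain m0 where m0: "1 < real m0 * u" using reals_Archimedean3 by blast
  have "eventually (\<lambda>m. clamp01 (real m * u) = 1) sequentially"
  proof (rule eventually_sequentiallyI[of m0])
    fix m assume "m0 \<le> m"
    then have "real m0 * u \<le> real m * u" using True by (intro mult_right_mono) auto
    then show "clamp01 (real m * u) = 1" using m0 by (simp add: clamp01_def)
  qed
  then show ?thesis using True by (simp add: tendsto_eventually)
next
  case False
  then have "clamp01 (real m * u) = 0" for m
  proof -
    have "real m * u \<le> 0" using False by (intro mult_nonneg_nonpos) auto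
    then show ?thesis by (simp add: clamp01_def)
  qed
  then show ?thesis using False by simp
qed

text \<open>Continuous functions that increase, as \<open>m\<close> grows, to the indicator of the
  open orthant \<open>x i < a i\<close>.\<close>

definition box_fn :: "nat \<Rightarrow> (nat \<Rightarrow> real) \<Rightarrow> nat \<Rightarrow> (nat \<Rightarrow> real) \<Rightarrow> real" where
  "box_fn k a m x = (\<Prod>i\<in>{1..k}. clamp01 (real m * (a i - x i)))"

lemma unit_fn_box_fn: "unit_fn k (box_fn k a m)"
  unfolding unit_fn_def
proof (intro conjI allI)
  show "box_fn k a m \<in> borel_measurable (PiM {1..k} (\<lambda>_. borel))"
    unfolding box_fn_def[abs_def] by measurable
  show "0 \<le> box_fn k a m x" "box_fn k a m x \<le> 1" for x
    unfolding box_fn_def by (intro prod_nonneg prod_le_1 conjI clamp01_bounds)+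
qed

lemma continuous_on_box_fn: "continuous_on A (box_fn k a m)"
  unfolding box_fn_def[abs_def] by (intro continuous_intros)

lemma bcontI:
  assumes "continuous_on (PiE I (\<lambda>_. UNIV)) f" "\<And>x. 0 \<le> f x" "\<And>x. f x \<le> 1"
  shows "bcont I f"
  using assms unfolding bcont_def by (auto intro!: exI[of _ 1])

text \<open>By dominated convergence the integrals tend to the masses of open orthants, which are
  stable under intersection and generate the product sigma-algebra. So these explicit functions
  suffice to compare two laws.\<close>

lemma measure_eq_by_box_fn:
  assumes P: "prob_space P" "sets P = sets (PiM {1..k} (\<lambda>_. borel))"
    and Q: "prob_space Q" "sets Q = sets (PiM {1..k} (\<lambda>_. borel))"
    and eq: "\<And>a m. (\<integral>x. box_fn k a m x \<partial>P) = (\<integral>x. box_fn k a m x \<partial>Q)"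
  shows "P = Q"
proof -
  define \<E> where "\<E> = {PiE {1..k} (\<lambda>i. {..<a i}) | a :: nat \<Rightarrow> real. True}"
  have lim: "(\<lambda>m. \<integral>x. box_fn k a m x \<partial>R) \<longlonglongrightarrow> measure R (PiE {1..k} (\<lambda>i. {..<a i}))"
    if R: "prob_space R" and sets_R [measurable_cong]: "sets R = sets (PiM {1..k} (\<lambda>_. borel))"
    for R :: "(nat \<Rightarrow> real) measure" and a :: "nat \<Rightarrow> real"
  proof -
    interpret R: prob_space R by fact
    have box: "PiE {1..k} (\<lambda>i. {..<a i}) \<in> sets R" unfolding sets_R by (intro sets_PiM_I_finite) auto
    have sp: "space R = PiE {1..k} (\<lambda>_. UNIV)" using sets_eq_imp_space_eq[OF sets_R] by (simp add: space_PiM)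
    have "(\<lambda>m. \<integral>x. box_fn k a m x \<partial>R) \<longlonglongrightarrow> (\<integral>x. indicator (PiE {1..k} (\<lambda>i. {..<a i})) x \<partial>R)"
    proof (rule integral_dominated_convergence[where w="\<lambda>_. 1"])
      show "AE x in R. (\<lambda>m. box_fn k a m x) \<longlonglongrightarrow> indicator (PiE {1..k} (\<lambda>i. {..<a i})) x"
      proof (rule AE_I2)
        fix x assume "x \<in> space R"
        then have "indicator (PiE {1..k} (\<lambda>i. {..<a i})) x = (\<Prod>i\<in>{1..k}. if 0 < a i - x i then 1 else 0 :: real)"
          unfolding sp by (auto simp: indicator_def PiE_iff intro!: prod.neutral[symmetric])
        then show "(\<lambda>m. box_fn k a m x) \<longlonglongrightarrow> indicator (PiE {1..k} (\<lambda>i. {..<a i})) x"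
          unfolding box_fn_def by (simp only:) (intro tendsto_prod clamp01_limit)
      qed
      show "AE x in R. norm (box_fn k a m x) \<le> 1" for m
        using unit_fnD(2,3)[OF unit_fn_box_fn] by simp
      show "box_fn k a m \<in> borel_measurable R" for m
        using unit_fnD(1)[OF unit_fn_box_fn] by (simp cong: measurable_cong_sets add: sets_R)
      show "indicator (PiE {1..k} (\<lambda>i. {..<a i})) \<in> borel_measurable R" using box by simp
    qed simp
    also have "(\<integral>x. indicator (PiE {1..k} (\<lambda>i. {..<a i})) x \<partial>R) = measure R (PiE {1..k} (\<lambda>i. {..<a i}))"
      using box by simp
    finally show ?thesis .
  qed
  have gen: "sets (PiM {1..k} (\<lambda>_. borel :: real measure)) = sigma_sets (PiE {1..k} (\<lambda>_. UNIV)) \<E>"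
  proof -
    have "sets (PiM {1..k} (\<lambda>_. borel :: real measure))
        = sets (PiM {1..k} (\<lambda>_. sigma UNIV (range lessThan :: real set set)))"
      by (simp add: borel_Iio)
    also have "\<dots> = sets (sigma (PiE {1..k} (\<lambda>_. UNIV))
        {{f\<in>PiE {1..k} (\<lambda>_. UNIV). \<forall>i\<in>j. f i \<in> A i} | A j. j \<in> {{1..k}} \<and> A \<in> Pi j (\<lambda>_. range lessThan :: real set set)})"
    proof (rule sets_PiM_sigma)
      fix i
      have "(\<Union>n. {..<real n}) = UNIV" using reals_Archimedean2 by auto
      then show "\<exists>S\<subseteq>range lessThan. countable S \<and> (UNIV :: real set) = \<Union>S"
        by (intro exI[of _ "range (\<lambda>n. {..<real n})"]) auto
    qed auto
    also have "{{f\<in>PiE {1..k} (\<lambda>_. UNIV). \<forall>i\<in>j. f i \<in> A i} | A j. j \<in> {{1..k}} \<and> A \<in> Pi j (\<lambda>_. range lessThan :: real set set)} = \<E>"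
    proof (intro equalityI subsetI)
      fix X assume "X \<in> {{f\<in>PiE {1..k} (\<lambda>_. UNIV). \<forall>i\<in>j. f i \<in> A i} | A j. j \<in> {{1..k}} \<and> A \<in> Pi j (\<lambda>_. range lessThan :: real set set)}"
      then obtain A where A: "A \<in> Pi {1..k} (\<lambda>_. range lessThan :: real set set)"
        and X: "X = {f\<in>PiE {1..k} (\<lambda>_. UNIV). \<forall>i\<in>{1..k}. f i \<in> A i}" by blast
      from A have "\<forall>i\<in>{1..k}. \<exists>a. A i = {..<a}" by blast
      then obtain a where a: "\<And>i. i \<in> {1..k} \<Longrightarrow> A i = {..<a i}" by metis
      have "X = PiE {1..k} (\<lambda>i. {..<a i})"
        unfolding X by (auto simp: PiE_iff extensional_def a)
      then show "X \<in> \<E>" unfolding \<E>_def by blast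
    next
      fix X assume "X \<in> \<E>"
      then obtain a where X: "X = PiE {1..k} (\<lambda>i. {..<a i :: real})" unfolding \<E>_def by blast
      have "X = {f\<in>PiE {1..k} (\<lambda>_. UNIV). \<forall>i\<in>{1..k}. f i \<in> (\<lambda>i. {..<a i}) i}"
        unfolding X by (auto simp: PiE_iff extensional_def)
      moreover have "(\<lambda>i. {..<a i}) \<in> Pi {1..k} (\<lambda>_. range lessThan :: real set set)" by auto
      ultimately show "X \<in> {{f\<in>PiE {1..k} (\<lambda>_. UNIV). \<forall>i\<in>j. f i \<in> A i} | A j. j \<in> {{1..k}} \<and> A \<in> Pi j (\<lambda>_. range lessThan :: real set set)}"
        by (intro CollectI exI[of _ "\<lambda>i. {..<a i}"] exI[of _ "{1..k}"] conjI) simp_all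
    qed
    also have "sets (sigma (PiE {1..k} (\<lambda>_. UNIV)) \<E>) = sigma_sets (PiE {1..k} (\<lambda>_. UNIV)) \<E>"
      by (rule sets_measure_of) (auto simp: \<E>_def PiE_iff)
    finally show ?thesis .
  qed
  interpret P: prob_space P by fact
  interpret Q: prob_space Q by fact
  show ?thesis
  proof (rule measure_eqI_generator_eq[where E=\<E> and \<Omega>="PiE {1..k} (\<lambda>_. UNIV)"
        and A="\<lambda>n::nat. PiE {1..k} (\<lambda>_. {..<real n})"])
    show "Int_stable \<E>"
    proof (rule Int_stableI)
      fix X Y assume "X \<in> \<E>" "Y \<in> \<E>"
      then obtain a b where "X = PiE {1..k} (\<lambda>i. {..<a i})" "Y = PiE {1..k} (\<lambda>i. {..<b i})"
        unfolding \<E>_def by blast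
      then have "X \<inter> Y = PiE {1..k} (\<lambda>i. {..<min (a i) (b i)})"
        by (auto simp: PiE_iff)
      then show "X \<inter> Y \<in> \<E>"
        unfolding \<E>_def by (intro CollectI exI[of _ "\<lambda>i. min (a i) (b i)"] conjI TrueI)
    qed
    show "\<E> \<subseteq> Pow (PiE {1..k} (\<lambda>_. UNIV))" by (auto simp: \<E>_def PiE_iff)
    show "emeasure P X = emeasure Q X" if "X \<in> \<E>" for X
    proof -
      obtain a where X: "X = PiE {1..k} (\<lambda>i. {..<a i})" using \<open>X \<in> \<E>\<close> unfolding \<E>_def by blast
      have "measure P X = measure Q X"
        unfolding X using LIMSEQ_unique[OF lim[OF P] lim[OF Q, folded eq]] .
      then show ?thesis by (simp add: P.emeasure_eq_measure Q.emeasure_eq_measure)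
    qed
    show "sets P = sigma_sets (PiE {1..k} (\<lambda>_. UNIV)) \<E>" "sets Q = sigma_sets (PiE {1..k} (\<lambda>_. UNIV)) \<E>"
      using P(2) Q(2) gen by auto
    show "range (\<lambda>n. PiE {1..k} (\<lambda>_. {..<real n})) \<subseteq> \<E>"
    proof (rule image_subsetI)
      fix n :: nat
      show "PiE {1..k} (\<lambda>_. {..<real n}) \<in> \<E>"
        unfolding \<E>_def by (intro CollectI exI[of _ "\<lambda>_. real n"] conjI TrueI refl)
    qed
    show "(\<Union>n. PiE {1..k} (\<lambda>_. {..<real n})) = PiE {1..k} (\<lambda>_. UNIV)"
    proof (intro equalityI subsetI)
      fix x :: "nat \<Rightarrow> real" assume x: "x \<in> PiE {1..k} (\<lambda>_. UNIV)"
      obtain n where n: "(\<Sum>i\<in>{1..k}. \<bar>x i\<bar>) < real n" using reals_Archimedean2 by blast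
      have "x i < real n" if "i \<in> {1..k}" for i
      proof -
        have "\<bar>x i\<bar> \<le> (\<Sum>i\<in>{1..k}. \<bar>x i\<bar>)" using that by (intro member_le_sum) auto
        then show ?thesis using n by linarith
      qed
      then have "x \<in> PiE {1..k} (\<lambda>_. {..<real n})" using x by (simp add: PiE_iff)
      then show "x \<in> (\<Union>n. PiE {1..k} (\<lambda>_. {..<real n}))" by blast
    qed (auto simp: PiE_iff)
    show "emeasure P (PiE {1..k} (\<lambda>_. {..<real n})) \<noteq> \<infinity>" for n by simp
  qed
qed

section \<open>Scaling of exponential laws, and rates that Q keeps at 2 or above\<close>

lemma exp_law_scale:
  assumes c: "\<And>i. i \<in> {1..k} \<Longrightarrow> 0 < c i"
  shows "exp_law k c = distr (exp_law k (\<lambda>_. 1)) (PiM {1..k} (\<lambda>_. borel)) (\<lambda>e. \<lambda>i\<in>{1..k}. e i / c i)"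
proof -
  have p: "prob_space (density lborel (\<lambda>x. ennreal (exponential_density 1 x)))"
    by (rule prob_space_exponential_density) simp
  have "distr (exp_law k (\<lambda>_. 1)) (PiM {1..k} (\<lambda>_. borel)) (\<lambda>e. \<lambda>i\<in>{1..k}. e i / c i)
      = PiM {1..k} (\<lambda>i. distr (density lborel (\<lambda>x. ennreal (exponential_density 1 x))) borel (\<lambda>x. x / c i))"
    unfolding exp_law_def by (rule distr_PiM_map[where f="\<lambda>i x. x / c i"]) (auto intro: p)
  also have "\<dots> = exp_law k c"
    unfolding exp_law_def
  proof (rule PiM_cong[OF refl])
    fix i assume i: "i \<in> {1..k}"
    have ci: "0 < c i" using c[OF i] .
    show "distr (density lborel (\<lambda>x. ennreal (exponential_density 1 x))) borel (\<lambda>x. x / c i)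
        = density lborel (\<lambda>x. ennreal (exponential_density (c i) x))"
    proof (rule measure_eqI)
      fix A assume "A \<in> sets (distr (density lborel (\<lambda>x. ennreal (exponential_density 1 x))) borel (\<lambda>x. x / c i))"
      then have [measurable]: "A \<in> sets borel" by simp
      have "emeasure (distr (density lborel (\<lambda>x. ennreal (exponential_density 1 x))) borel (\<lambda>x. x / c i)) A
          = (\<integral>\<^sup>+x. indicator A x \<partial>distr (density lborel (\<lambda>x. ennreal (exponential_density 1 x))) borel (\<lambda>x. x / c i))"
        by simp
      also have "\<dots> = (\<integral>\<^sup>+x. indicator A (x / c i) \<partial>density lborel (\<lambda>x. ennreal (exponential_density 1 x)))"
        by (rule nn_integral_distr) auto
      also have "\<dots> = (\<integral>\<^sup>+x. ennreal (exponential_density 1 x) * indicator A (x / c i) \<partial>lborel)"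
        by (rule nn_integral_density) auto
      also have "\<dots> = ennreal \<bar>c i\<bar> * (\<integral>\<^sup>+x. ennreal (exponential_density 1 (0 + c i * x)) * indicator A ((0 + c i * x) / c i) \<partial>lborel)"
        using ci by (intro nn_integral_real_affine) auto
      also have "\<dots> = (\<integral>\<^sup>+x. ennreal (c i) * (ennreal (exponential_density 1 (c i * x)) * indicator A x) \<partial>lborel)"
        using ci by (subst nn_integral_cmult[symmetric]) auto
      also have "\<dots> = (\<integral>\<^sup>+x. ennreal (exponential_density (c i) x) * indicator A x \<partial>lborel)"
      proof (rule nn_integral_cong)
        fix x
        have "c i * exponential_density 1 (c i * x) = exponential_density (c i) x"
          using ci by (simp add: exponential_density_def mult_less_0_iff mult.commute)
        then show "ennreal (c i) * (ennreal (exponential_density 1 (c i * x)) * indicator A x)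
            = ennreal (exponential_density (c i) x) * indicator A x"
          using ci by (simp add: mult.assoc[symmetric] ennreal_mult'[symmetric])
      qed
      also have "\<dots> = emeasure (density lborel (\<lambda>x. ennreal (exponential_density (c i) x))) A"
        by (subst emeasure_density) auto
      finally show "emeasure (distr (density lborel (\<lambda>x. ennreal (exponential_density 1 x))) borel (\<lambda>x. x / c i)) A
          = emeasure (density lborel (\<lambda>x. ennreal (exponential_density (c i) x))) A" .
    qed simp
  qed
  finally show ?thesis by simp
qed

lemma AE_exp_law_pos:
  assumes c: "\<And>i. i \<in> {1..k} \<Longrightarrow> 0 < c i"
  shows "AE g in exp_law k c. \<forall>i\<in>{1..k}. 0 < g i"
proof (intro AE_finite_allI finite_atLeastAtMost)
  fix i assume i: "i \<in> {1..k}"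
  have "AE x in lborel. x \<noteq> (0::real)" by (rule AE_lborel_singleton)
  then have "AE x in lborel. 0 < ennreal (exponential_density (c i) x) \<longrightarrow> 0 < x"
    by eventually_elim (auto simp: exponential_density_def split: if_splits)
  then have "AE x in density lborel (\<lambda>x. ennreal (exponential_density (c i) x)). 0 < x"
    by (subst AE_density) auto
  also have "density lborel (\<lambda>x. ennreal (exponential_density (c i) x))
      = distr (exp_law k c) (density lborel (\<lambda>x. ennreal (exponential_density (c i) x))) (\<lambda>g. g i)"
    unfolding exp_law_def
    by (rule distr_PiM_component[symmetric]) (use c i prob_space_exponential_density in auto)
  finally show "AE g in exp_law k c. 0 < g i"
  proof (subst (asm) AE_distr_iff)
    have "(\<lambda>g. g i) \<in> exp_law k c \<rightarrow>\<^sub>M (borel :: real measure)"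
      using i by (simp cong: measurable_cong_sets)
    then show "(\<lambda>g. g i) \<in> exp_law k c \<rightarrow>\<^sub>M density lborel (\<lambda>x. ennreal (exponential_density (c i) x))"
      by (simp cong: measurable_cong_sets)
  qed auto
qed

text \<open>Some jump crosses each level, and \<open>sqrt (2 * u)\<close> is at least 2 when
  \<open>u\<close> is; the other terms only add.\<close>

lemma Fvec_ge_2:
  assumes \<tau>: "\<tau> permutes {0..k}" and c: "\<forall>i\<in>{1..k}. 2 \<le> c i"
  shows "\<forall>i\<in>{1..k}. 2 \<le> Fvec k \<tau> c i"
proof
  fix i assume i: "i \<in> {1..k}"
  obtain j where j: "j \<in> Eset k \<tau> i" using Eset_nonempty[OF \<tau> i] by blast
  have E: "Eset k \<tau> i \<subseteq> {1..k}" by (auto simp: Eset_def)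
  have nonneg: "0 \<le> sqrt (2 * c l)" if "l \<in> Eset k \<tau> i" for l using E that c by fastforce
  have "2 \<le> c j" using E j c by blast
  then have "sqrt (2 * 2) \<le> sqrt (2 * c j)" by (intro real_sqrt_le_mono) auto
  then have "2 \<le> sqrt (2 * c j)" by simp
  also have "\<dots> \<le> Fcomp k \<tau> c i"
    unfolding Fcomp_def using j nonneg E by (intro member_le_sum) (auto intro: finite_subset)
  finally show "2 \<le> Fvec k \<tau> c i" using i by (simp add: Fvec_def)
qed

text \<open>The iterates evaluate \<open>f\<close> only at rates reachable from \<open>c\<close>,
  and these stay in the region by \<open>Fvec_ge_2\<close>; \<open>f\<close> may thus be altered
  elsewhere.\<close>

lemma Qop_iterate_cong:
  assumes eq: "\<And>c. \<forall>i\<in>{1..k}. 2 \<le> c i \<Longrightarrow> f c = f' c" and c: "\<forall>i\<in>{1..k}. 2 \<le> c i"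
  shows "(Qop k ^^ n) f c = (Qop k ^^ n) f' c"
  using c
proof (induction n arbitrary: c)
  case (Suc n)
  show ?case
    by (simp add: Qop_def[of k _ c], rule sum.cong) (use Suc Fvec_ge_2 in auto)
qed (simp add: eq)

lemma Qop_iterate_0: "(Qop k ^^ n) (\<lambda>_. 0) = (\<lambda>_. 0)"
  by (induction n) (auto simp: Qop_def fun_eq_iff)

lemma measurable_Fcomp:
  "(\<lambda>c. Fcomp k \<tau> c i) \<in> borel_measurable (PiM {1..k} (\<lambda>_. borel))"
  unfolding Fcomp_def
proof (rule borel_measurable_sum)
  fix j assume "j \<in> Eset k \<tau> i"
  then have "(\<lambda>c. c j) \<in> borel_measurable (PiM {1..k} (\<lambda>_. borel :: real measure))"
    by (intro measurable_component_singleton) (auto simp: Eset_def)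
  then show "(\<lambda>c. sqrt (2 * c j)) \<in> borel_measurable (PiM {1..k} (\<lambda>_. borel))" by measurable
qed

lemma measurable_Qop:
  assumes f: "f \<in> borel_measurable (PiM {1..k} (\<lambda>_. borel))"
  shows "Qop k f \<in> borel_measurable (PiM {1..k} (\<lambda>_. borel))"
proof -
  have "Fvec k \<tau> \<in> PiM {1..k} (\<lambda>_. borel) \<rightarrow>\<^sub>M PiM {1..k} (\<lambda>_. borel)" for \<tau>
    unfolding Fvec_def[abs_def] by (intro measurable_restrict measurable_Fcomp)
  from measurable_compose[OF this f] have [measurable]: "(\<lambda>c. f (Fvec k \<tau> c)) \<in> borel_measurable (PiM {1..k} (\<lambda>_. borel))" for \<tau> .
  have [measurable]: "wt k \<tau> \<in> borel_measurable (PiM {1..k} (\<lambda>_. borel))" for \<tau>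
    unfolding wt_def[abs_def]
    by (intro borel_measurable_times borel_measurable_const borel_measurable_prod borel_measurable_divide
          measurable_Fcomp measurable_compose[OF _ borel_measurable_sqrt] measurable_component_singleton)
  show ?thesis unfolding Qop_def[abs_def] by measurable
qed

lemma measurable_Qop_iterate:
  "f \<in> borel_measurable (PiM {1..k} (\<lambda>_. borel)) \<Longrightarrow> (Qop k ^^ n) f \<in> borel_measurable (PiM {1..k} (\<lambda>_. borel))"
proof (induction n)
  case (Suc n)
  then show ?case using measurable_Qop[of "(Qop k ^^ n) f"] by simp
qed simp

text \<open>Since test functions must be continuous on all of \<open>\<real>\<^sup>k\<close>, the rates are cut off at 1; this is
  harmless because the kernel preserves \<open>{c. \<forall>i. 2 \<le> c i}\<close>.\<close>
definition cut_mix :: "nat \<Rightarrow> ((nat \<Rightarrow> real) \<Rightarrow> real) \<Rightarrow> (nat \<Rightarrow> real) \<Rightarrow> real" where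
  "cut_mix k h c = (\<integral>e. h (\<lambda>i\<in>{1..k}. e i / max 1 (c i)) \<partial>exp_law k (\<lambda>_. 1))"

lemma measurable_ratio:
  "(\<lambda>p. \<lambda>i\<in>{1..k}. fst p i / g (snd p i)) \<in> PiM {1..k} (\<lambda>_. borel) \<Otimes>\<^sub>M PiM {1..k} (\<lambda>_. borel) \<rightarrow>\<^sub>M PiM {1..k} (\<lambda>_. borel :: real measure)"
  if "g \<in> borel_measurable (borel :: real measure)"
  by (intro measurable_restrict borel_measurable_divide measurable_compose[OF _ that]
        measurable_compose[OF measurable_fst measurable_component_singleton]
        measurable_compose[OF measurable_snd measurable_component_singleton])

lemma measurable_ratio_left:
  "(\<lambda>e. \<lambda>i\<in>{1..k}. e i / d i) \<in> PiM {1..k} (\<lambda>_. borel) \<rightarrow>\<^sub>M PiM {1..k} (\<lambda>_. borel :: real measure)"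
  by (intro measurable_restrict borel_measurable_divide measurable_component_singleton borel_measurable_const)

lemma cut_mix_eq:
  assumes h: "unit_fn k h" and c: "\<forall>i\<in>{1..k}. 1 \<le> c i"
  shows "cut_mix k h c = (\<integral>x. h x \<partial>exp_law k c)"
proof -
  have "0 < c i" if "i \<in> {1..k}" for i using c that by force
  then have e: "exp_law k c = distr (exp_law k (\<lambda>_. 1)) (PiM {1..k} (\<lambda>_. borel)) (\<lambda>e. \<lambda>i\<in>{1..k}. e i / c i)"
    by (rule exp_law_scale)
  have "(\<integral>x. h x \<partial>exp_law k c) = (\<integral>e. h (\<lambda>i\<in>{1..k}. e i / c i) \<partial>exp_law k (\<lambda>_. 1))"
    unfolding e
  proof (rule integral_distr)
    show "(\<lambda>e. \<lambda>i\<in>{1..k}. e i / c i) \<in> exp_law k (\<lambda>_. 1) \<rightarrow>\<^sub>M PiM {1..k} (\<lambda>_. borel)"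
      using measurable_ratio_left by (simp cong: measurable_cong_sets)
  qed (rule unit_fnD(1)[OF h])
  also have "\<dots> = cut_mix k h c"
  proof -
    have "(\<lambda>i\<in>{1..k}. e i / c i) = (\<lambda>i\<in>{1..k}. e i / max 1 (c i))" for e :: "nat \<Rightarrow> real"
      using c by (intro restrict_ext) auto
    then show ?thesis unfolding cut_mix_def by simp
  qed
  finally show ?thesis by simp
qed

text \<open>The law of \<open>e\<close> is fixed and the rates enter only through denominators that
  are at least 1, so the integrand is continuous in \<open>c\<close> for each \<open>e\<close>, and
  dominated convergence applies.\<close>

lemma bcont_cut_mix: "bcont {1..k} (cut_mix k (box_fn k a m))"
proof (rule bcontI)
  interpret E: prob_space "exp_law k (\<lambda>_. 1)" by (rule prob_space_exp_law) simp
  note u = unit_fn_box_fn[of k a m]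
  have meas: "(\<lambda>e. \<lambda>i\<in>{1..k}. e i / max 1 (c i)) \<in> exp_law k (\<lambda>_. 1) \<rightarrow>\<^sub>M PiM {1..k} (\<lambda>_. borel)" for c :: "nat \<Rightarrow> real"
    using measurable_ratio_left by (simp cong: measurable_cong_sets)
  show "0 \<le> cut_mix k (box_fn k a m) c" "cut_mix k (box_fn k a m) c \<le> 1" for c
    unfolding cut_mix_def using E.unit_fn_integrable(2,3)[OF u meas] by auto
  show "continuous_on (PiE {1..k} (\<lambda>_. UNIV)) (cut_mix k (box_fn k a m))"
    \<comment> \<open>Sequences suffice: a countable product of real lines is first
      countable.\<close>
    unfolding continuous_on_def tendsto_at_iff_sequentially comp_def
  proof (intro ballI allI impI)
    fix c :: "nat \<Rightarrow> real" and X :: "nat \<Rightarrow> nat \<Rightarrow> real"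
    assume X: "X \<longlonglongrightarrow> c"
    have coord: "(\<lambda>n. X n i) \<longlonglongrightarrow> c i" for i
    proof -
      have "isCont (\<lambda>x :: nat \<Rightarrow> real. x i) c"
        using continuous_on_coordinate[of UNIV i] continuous_on_eq_continuous_at[OF open_UNIV] by blast
      then show ?thesis using X by (rule isCont_tendsto_compose)
    qed
    show "(\<lambda>n. cut_mix k (box_fn k a m) (X n)) \<longlonglongrightarrow> cut_mix k (box_fn k a m) c"
      unfolding cut_mix_def
    proof (rule integral_dominated_convergence[where w="\<lambda>_. 1"])
      show "AE e in exp_law k (\<lambda>_. 1). (\<lambda>n. box_fn k a m (\<lambda>i\<in>{1..k}. e i / max 1 (X n i)))
          \<longlonglongrightarrow> box_fn k a m (\<lambda>i\<in>{1..k}. e i / max 1 (c i))"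
      proof (rule AE_I2)
        fix e :: "nat \<Rightarrow> real"
        have "(\<lambda>n. \<Prod>i\<in>{1..k}. clamp01 (real m * (a i - e i / max 1 (X n i))))
            \<longlonglongrightarrow> (\<Prod>i\<in>{1..k}. clamp01 (real m * (a i - e i / max 1 (c i))))"
          by (intro tendsto_intros coord) auto
        then show "(\<lambda>n. box_fn k a m (\<lambda>i\<in>{1..k}. e i / max 1 (X n i)))
          \<longlonglongrightarrow> box_fn k a m (\<lambda>i\<in>{1..k}. e i / max 1 (c i))"
          unfolding box_fn_def by simp
      qed
      show "AE e in exp_law k (\<lambda>_. 1). norm (box_fn k a m (\<lambda>i\<in>{1..k}. e i / max 1 (X n i))) \<le> 1" for n
        using unit_fnD(2,3)[OF u] by simp
      show "(\<lambda>e. box_fn k a m (\<lambda>i\<in>{1..k}. e i / max 1 (c i))) \<in> borel_measurable (exp_law k (\<lambda>_. 1))"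
        "(\<lambda>e. box_fn k a m (\<lambda>i\<in>{1..k}. e i / max 1 (X n i))) \<in> borel_measurable (exp_law k (\<lambda>_. 1))" for n
        by (rule measurable_compose[OF meas unit_fnD(1)[OF u]])+
    qed simp
  qed
qed

lemma measurable_cut_mix:
  assumes h: "unit_fn k h"
  shows "cut_mix k h \<in> borel_measurable (PiM {1..k} (\<lambda>_. borel))"
proof -
  interpret E: prob_space "exp_law k (\<lambda>_. 1)" by (rule prob_space_exp_law) simp
  have "(\<lambda>p. (snd p, fst p)) \<in> PiM {1..k} (\<lambda>_. borel) \<Otimes>\<^sub>M exp_law k (\<lambda>_. 1) \<rightarrow>\<^sub>M PiM {1..k} (\<lambda>_. borel) \<Otimes>\<^sub>M PiM {1..k} (\<lambda>_. borel :: real measure)"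
    by measurable
  from measurable_compose[OF this measurable_ratio[of "max 1"]]
  have "(\<lambda>p. \<lambda>i\<in>{1..k}. snd p i / max 1 (fst p i)) \<in> PiM {1..k} (\<lambda>_. borel) \<Otimes>\<^sub>M exp_law k (\<lambda>_. 1) \<rightarrow>\<^sub>M PiM {1..k} (\<lambda>_. borel)"
    by simp
  from measurable_compose[OF this unit_fnD(1)[OF h]] show ?thesis
    unfolding cut_mix_def[abs_def]
    by (intro E.borel_measurable_lebesgue_integral) (simp add: case_prod_beta')
qed

theorem theorem1:
  fixes k :: nat
    and M :: "'a measure" and B :: "nat \<Rightarrow> 'a \<Rightarrow> real \<Rightarrow> real"
    and \<mu> :: "(nat \<Rightarrow> real) measure"
    and \<nu> :: "(nat \<Rightarrow> real) measure"
    and N :: "'b measure" and E :: "nat \<Rightarrow> 'b \<Rightarrow> real" and C :: "'b \<Rightarrow> nat \<Rightarrow> real"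
  assumes k: "k \<ge> 1"
    \<comment> \<open>B_1, B_2, ... i.i.d. two-sided standard Brownian motions\<close>
    and M: "prob_space M"
    and BM: "\<And>n. n \<ge> 1 \<Longrightarrow> two_sided_BM M (B n)"
    and Bindep: "prob_space.indep_vars M (\<lambda>_. PiM UNIV (\<lambda>_. borel)) B {1..}"
    \<comment> \<open>\<mu> = \<mu>_{k+1}: the limit law of (I^(n)(t_1),...,I^(n)(t_{k+1}))\<close>
    and \<mu>_prob: "prob_space \<mu>"
    and \<mu>_sets: "sets \<mu> = sets (PiM {1..Suc k} (\<lambda>_. borel))"
    and \<mu>_lim: "\<And>t f. inj_on t {1..Suc k} \<Longrightarrow> (\<forall>i\<in>{1..Suc k}. t i \<noteq> 0) \<Longrightarrow>
        bcont {1..Suc k} f \<Longrightarrow>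
        (\<lambda>n. \<integral>\<omega>. f (\<lambda>i\<in>{1..Suc k}. Icomp B n \<omega> (t i)) \<partial>M) \<longlonglongrightarrow> (\<integral>x. f x \<partial>\<mu>)"
    \<comment> \<open>\<nu> = \<nu>_k: the limit of \<nu>0 Q^n, a probability measure on (0,\<infinity>)^k\<close>
    and \<nu>_prob: "prob_space \<nu>"
    and \<nu>_sets: "sets \<nu> = sets (PiM {1..k} (\<lambda>_. borel))"
    and \<nu>_pos: "AE c in \<nu>. \<forall>i\<in>{1..k}. 0 < c i"
    and \<nu>_lim: "\<And>\<nu>0 f. prob_space \<nu>0 \<Longrightarrow> sets \<nu>0 = sets (PiM {1..k} (\<lambda>_. borel)) \<Longrightarrow>
        (AE c in \<nu>0. \<forall>i\<in>{1..k}. 2 \<le> c i \<and> c i \<le> 2 * (real k)\<^sup>2) \<Longrightarrow>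
        bcont {1..k} f \<Longrightarrow>
        (\<lambda>n. \<integral>c. (Qop k ^^ n) f c \<partial>\<nu>0) \<longlonglongrightarrow> (\<integral>c. f c \<partial>\<nu>)"
    \<comment> \<open>E_1..E_k i.i.d. Exp(1), independent of C with law \<nu>\<close>
    and N: "prob_space N"
    and E_exp: "\<And>i. i \<in> {1..k} \<Longrightarrow> distributed N lborel (E i) (exponential_density 1)"
    and E_indep: "prob_space.indep_vars N (\<lambda>_. borel) E {1..k}"
    and C_meas: "C \<in> N \<rightarrow>\<^sub>M PiM {1..k} (\<lambda>_. borel)"
    and C_law: "distr N (PiM {1..k} (\<lambda>_. borel)) C = \<nu>"
    and EC_indep: "prob_space.indep_var N (PiM {1..k} (\<lambda>_. borel)) (\<lambda>\<omega>. \<lambda>i\<in>{1..k}. E i \<omega>)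
                      (PiM {1..k} (\<lambda>_. borel)) C"
  shows "distr \<mu> (PiM {1..k} (\<lambda>_. borel)) (gaps k)
       = distr N (PiM {1..k} (\<lambda>_. borel)) (\<lambda>\<omega>. \<lambda>i\<in>{1..k}. E i \<omega> / C \<omega> i)"
proof -
  interpret N: prob_space N by fact
  interpret BM: iterated_BM M B k
    by (intro iterated_BM.intro iterated_BM_axioms.intro M k BM Bindep)
  define S where "S = PiM {1..k} (\<lambda>_. borel :: real measure)"
  \<comment> \<open>The lowest corner of the cube of starting rates allowed for
    \<open>\<nu>\<close>; it belongs to the cube because \<open>k \<ge> 1\<close>. Being
    extensional, it is a point of \<open>S\<close>.\<close>
  define c0 where "c0 = (\<lambda>i\<in>{1..k}. 2 :: real)"
  have c0_S: "c0 \<in> space S" by (simp add: S_def c0_def space_PiM)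
  have c0_ge: "\<forall>i\<in>{1..k}. 2 \<le> c0 i" by (simp add: c0_def)
  have c0_pos: "\<And>i. i \<in> {1..k} \<Longrightarrow> 0 < c0 i" by (simp add: c0_def)
  \<comment> \<open>For the point mass at \<open>c0\<close>, integrating the iterated operator is
    evaluating it at \<open>c0\<close>.\<close>
  have Q_lim: "(\<lambda>n. (Qop k ^^ n) f c0) \<longlonglongrightarrow> (\<integral>c. f c \<partial>\<nu>)"
    if f: "bcont {1..k} f" "f \<in> borel_measurable (PiM {1..k} (\<lambda>_. borel))" for f
  proof -
    have "(\<lambda>n. \<integral>c. (Qop k ^^ n) f c \<partial>return S c0) \<longlonglongrightarrow> (\<integral>c. f c \<partial>\<nu>)"
    proof (rule \<nu>_lim[OF _ _ _ f(1)])
      show "prob_space (return S c0)" by (rule prob_space_return[OF c0_S])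
      show "sets (return S c0) = sets (PiM {1..k} (\<lambda>_. borel))" by (simp add: S_def)
      have "(1::real) \<le> (real k)\<^sup>2" using k by simp
      then have *: "\<forall>i\<in>{1..k}. 2 \<le> c0 i \<and> c0 i \<le> 2 * (real k)\<^sup>2" by (simp add: c0_def)
      have [measurable]: "(\<lambda>c. c i) \<in> borel_measurable S" if "i \<in> {1..k}" for i
        unfolding S_def using that by (rule measurable_component_singleton)
      have "Measurable.pred S (\<lambda>c. \<forall>i\<in>{1..k}. 2 \<le> c i \<and> c i \<le> 2 * (real k)\<^sup>2)" by measurable
      then show "AE c in return S c0. \<forall>i\<in>{1..k}. 2 \<le> c i \<and> c i \<le> 2 * (real k)\<^sup>2"
        using * c0_S by (subst AE_return)
    qed
    moreover have "(\<integral>c. (Qop k ^^ n) f c \<partial>return S c0) = (Qop k ^^ n) f c0" for n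
      using measurable_Qop_iterate[OF f(2), of n] c0_S by (intro integral_return) (auto simp: S_def)
    ultimately show ?thesis by simp
  qed
  interpret \<nu>: prob_space \<nu> by fact
  \<comment> \<open>The lower bound is recovered from the limit: \<open>clamp01 (2 - c i)\<close>
    vanishes on rates of at least 2, a region that Q never leaves, so its integral against
    \<open>\<nu>\<close> is 0. On this region the cutoff in \<open>cut_mix\<close> has no
    effect.\<close>
  have \<nu>_ge: "AE c in \<nu>. \<forall>i\<in>{1..k}. 2 \<le> c i"
  proof (intro AE_finite_allI finite_atLeastAtMost)
    fix i assume i: "i \<in> {1..k}"
    define f where "f = (\<lambda>c :: nat \<Rightarrow> real. clamp01 (2 - c i))"
    have f_meas: "f \<in> borel_measurable (PiM {1..k} (\<lambda>_. borel))"
      unfolding f_def by (intro measurable_compose[OF _ borel_measurable_clamp01]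
          borel_measurable_diff borel_measurable_const measurable_component_singleton i)
    have "bcont {1..k} f"
      unfolding f_def by (intro bcontI continuous_intros clamp01_bounds)
    then have "(\<lambda>n. (Qop k ^^ n) f c0) \<longlonglongrightarrow> (\<integral>c. f c \<partial>\<nu>)" using f_meas by (rule Q_lim)
    moreover have "(Qop k ^^ n) f c0 = (Qop k ^^ n) (\<lambda>_. 0) c0" for n
    proof (rule Qop_iterate_cong[OF _ c0_ge])
      fix c :: "nat \<Rightarrow> real" assume "\<forall>i\<in>{1..k}. 2 \<le> c i"
      then have "2 \<le> c i" using i by blast
      then show "f c = 0" by (auto simp: f_def clamp01_def max_def min_def)
    qed
    ultimately have "(\<integral>c. f c \<partial>\<nu>) = 0"
      by (simp add: Qop_iterate_0 LIMSEQ_const_iff)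
    moreover have f_meas': "f \<in> borel_measurable \<nu>"
      using f_meas by (simp cong: measurable_cong_sets add: \<nu>_sets)
    moreover have "integrable \<nu> f"
      using f_meas' clamp01_bounds by (intro \<nu>.integrable_const_bound[where B=1]) (auto simp: f_def)
    ultimately have "AE c in \<nu>. f c = 0"
      using clamp01_bounds by (subst (asm) integral_nonneg_eq_0_iff_AE) (auto simp: f_def)
    then show "AE c in \<nu>. 2 \<le> c i"
      by eventually_elim (auto simp: f_def clamp01_def max_def min_def split: if_splits)
  qed
  have meas_gaps: "gaps k \<in> \<mu> \<rightarrow>\<^sub>M PiM {1..k} (\<lambda>_. borel)"
    using measurable_gaps[of k] by (simp cong: measurable_cong_sets add: \<mu>_sets)
  have E_meas: "E i \<in> borel_measurable N" if "i \<in> {1..k}" for i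
    using distributed_measurable[OF E_exp[OF that]] by simp
  have Evec: "(\<lambda>\<omega>. \<lambda>i\<in>{1..k}. E i \<omega>) \<in> N \<rightarrow>\<^sub>M S"
    unfolding S_def by (intro measurable_restrict E_meas)
  have C_S: "C \<in> N \<rightarrow>\<^sub>M S" using C_meas by (simp add: S_def)
  have Evec_law: "distr N S (\<lambda>\<omega>. \<lambda>i\<in>{1..k}. E i \<omega>) = exp_law k (\<lambda>_. 1)"
  proof -
    have "{1..k} \<noteq> {}" using k by auto
    then have "distr N S (\<lambda>\<omega>. \<lambda>i\<in>{1..k}. E i \<omega>) = PiM {1..k} (\<lambda>i. distr N borel (E i))"
      using E_indep N.indep_vars_iff_distr_eq_PiM'[where I="{1..k}" and M'="\<lambda>_. borel" and X=E] E_meas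
      unfolding S_def by blast
    also have "\<dots> = exp_law k (\<lambda>_. 1)"
      unfolding exp_law_def
    proof (rule PiM_cong[OF refl])
      fix i assume "i \<in> {1..k}"
      from distributed_distr_eq_density[OF E_exp[OF this]]
      have "distr N lborel (E i) = density lborel (\<lambda>x. ennreal (exponential_density 1 x))" .
      moreover have "distr N borel (E i) = distr N lborel (E i)" by (rule distr_cong) auto
      ultimately show "distr N borel (E i) = density lborel (\<lambda>x. ennreal (exponential_density 1 x))" by simp
    qed
    finally show ?thesis .
  qed
  have joint: "distr N (S \<Otimes>\<^sub>M S) (\<lambda>\<omega>. (\<lambda>i\<in>{1..k}. E i \<omega>, C \<omega>)) = exp_law k (\<lambda>_. 1) \<Otimes>\<^sub>M \<nu>"
    using EC_indep C_law Evec_law unfolding N.indep_var_distribution_eq S_def by simp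
  have meas_ratio: "(\<lambda>\<omega>. \<lambda>i\<in>{1..k}. E i \<omega> / C \<omega> i) \<in> N \<rightarrow>\<^sub>M PiM {1..k} (\<lambda>_. borel)"
    by (intro measurable_restrict borel_measurable_divide E_meas
        measurable_compose[OF C_meas measurable_component_singleton])
  show ?thesis
  proof (rule measure_eq_by_box_fn)
    show "prob_space (distr \<mu> (PiM {1..k} (\<lambda>_. borel)) (gaps k))"
      by (rule prob_space.prob_space_distr[OF \<mu>_prob meas_gaps])
    show "prob_space (distr N (PiM {1..k} (\<lambda>_. borel)) (\<lambda>\<omega>. \<lambda>i\<in>{1..k}. E i \<omega> / C \<omega> i))"
      by (rule N.prob_space_distr[OF meas_ratio])
    fix a m
    define h where "h = box_fn k a m"
    have h: "unit_fn k h" unfolding h_def by (rule unit_fn_box_fn)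
    define L where "L = (\<integral>x. h (gaps k x) \<partial>\<mu>)"
    \<comment> \<open>Every vector of positive gaps comes from admissible starting points, so the
      limit is the same constant \<open>L\<close> for all of them.\<close>
    have P_lim: "(\<lambda>n. (Pop k ^^ n) h g) \<longlonglongrightarrow> L"
      if g: "g \<in> extensional {1..k}" "\<forall>i\<in>{1..k}. 0 < g i" for g
    proof -
      \<comment> \<open>The summand 1 keeps all points positive, as the limit hypothesis asks for
        nonzero times.\<close>
      define t where "t = (\<lambda>j. 1 + (\<Sum>i\<in>{1..<j}. g i))"
      have t_less: "t i < t j" if "i < j" "1 \<le> i" "j \<le> Suc k" for i j
      proof -
        have "(\<Sum>l\<in>{1..<j}. g l) = (\<Sum>l\<in>{1..<i}. g l) + (\<Sum>l\<in>{i..<j}. g l)"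
          using that by (simp add: sum.atLeastLessThan_concat)
        moreover have "0 < (\<Sum>l\<in>{i..<j}. g l)" using that g(2) by (intro sum_pos) auto
        ultimately show ?thesis by (simp add: t_def)
      qed
      have inj: "inj_on t {1..Suc k}"
      proof (rule inj_onI)
        fix i j assume "i \<in> {1..Suc k}" "j \<in> {1..Suc k}" "t i = t j"
        then show "i = j" using t_less[of i j] t_less[of j i] by (cases i j rule: linorder_cases) auto
      qed
      have pos: "\<forall>i\<in>{1..Suc k}. t i \<noteq> 0"
      proof
        fix j assume "j \<in> {1..Suc k}"
        then have "0 \<le> (\<Sum>i\<in>{1..<j}. g i)" using g(2) by (intro sum_nonneg less_imp_le) auto
        then show "t j \<noteq> 0" by (simp add: t_def)
      qed
      have "gaps k t = (\<lambda>i\<in>{1..k}. t (Suc i) - t i)"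
      proof (rule gaps_increasing)
        fix i j assume "i \<in> {1..Suc k}" "j \<in> {1..Suc k}" "i \<le> j"
        then show "t i \<le> t j" using t_less[of i j] by (cases "i = j") (auto intro: less_imp_le)
      qed
      also have "\<dots> = g"
      proof
        fix i show "(\<lambda>i\<in>{1..k}. t (Suc i) - t i) i = g i"
          using g(1) by (cases "i \<in> {1..k}") (auto simp: t_def extensional_def)
      qed
      finally have gaps_t: "gaps k t = g" .
      have "bcont {1..Suc k} (\<lambda>x. h (gaps k x))"
      proof (rule bcontI)
        show "continuous_on (PiE {1..Suc k} (\<lambda>_. UNIV)) (\<lambda>x. h (gaps k x))"
          unfolding h_def by (rule continuous_on_compose2[OF continuous_on_box_fn continuous_on_gaps]) auto
      qed (use unit_fnD[OF h] in auto)
      from \<mu>_lim[OF inj pos this]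
      have "(\<lambda>n. \<integral>\<omega>. h (gaps k (BM.Ipos n t \<omega>)) \<partial>M) \<longlonglongrightarrow> L"
        unfolding L_def BM.Ipos_def .
      then show ?thesis unfolding BM.integral_gaps_Ipos[OF h inj] gaps_t .
    qed
    \<comment> \<open>The start is now averaged over exponential gaps of rate 2. These are almost
      surely positive, so the pointwise limit \<open>L\<close> applies.\<close>
    have "(\<lambda>n. \<integral>g. (Pop k ^^ n) h g \<partial>exp_law k c0) \<longlonglongrightarrow> (\<integral>g. L \<partial>exp_law k c0)"
    proof (rule integral_dominated_convergence[where w="\<lambda>_. 1"])
      interpret Ex: prob_space "exp_law k c0" by (rule prob_space_exp_law[OF c0_pos])
      show "integrable (exp_law k c0) (\<lambda>_. 1 :: real)" by simp
      show "(Pop k ^^ n) h \<in> borel_measurable (exp_law k c0)" for n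
        using unit_fnD(1)[OF unit_fn_Pop_iterate[OF h]] by (simp cong: measurable_cong_sets)
      have "AE g in exp_law k c0. \<forall>i\<in>{1..k}. 0 < g i" by (rule AE_exp_law_pos[OF c0_pos])
      then show "AE g in exp_law k c0. (\<lambda>n. (Pop k ^^ n) h g) \<longlonglongrightarrow> L"
        using AE_space[of "exp_law k c0"]
      proof eventually_elim
        fix g assume "\<forall>i\<in>{1..k}. 0 < g i" "g \<in> space (exp_law k c0)"
        moreover from this have "g \<in> extensional {1..k}" by (simp add: exp_law_def space_PiM PiE_def)
        ultimately show "(\<lambda>n. (Pop k ^^ n) h g) \<longlonglongrightarrow> L" by (intro P_lim)
      qed
      show "AE g in exp_law k c0. norm ((Pop k ^^ n) h g) \<le> 1" for n
        using unit_fnD(2,3)[OF unit_fn_Pop_iterate[OF h]] by simp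
    qed simp
    moreover have "(\<integral>g. L \<partial>exp_law k c0) = L"
      using prob_space.prob_space[OF prob_space_exp_law[OF c0_pos]] by simp
    \<comment> \<open>Intertwining turns the chain of gaps into the chain of rates;
      \<open>cut_mix\<close> agrees with the exponential integral at all rates visited from
      \<open>c0\<close>.\<close>
    moreover have "(\<integral>g. (Pop k ^^ n) h g \<partial>exp_law k c0) = (Qop k ^^ n) (cut_mix k h) c0" for n
    proof -
      have "(\<integral>g. (Pop k ^^ n) h g \<partial>exp_law k c0) = (Qop k ^^ n) (\<lambda>c. \<integral>x. h x \<partial>exp_law k c) c0"
        by (rule integral_exp_law_Pop_iterate[OF h c0_pos])
      also have "\<dots> = (Qop k ^^ n) (cut_mix k h) c0"
      proof (rule Qop_iterate_cong[OF _ c0_ge])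
        fix c :: "nat \<Rightarrow> real" assume "\<forall>i\<in>{1..k}. 2 \<le> c i"
        then have "\<forall>i\<in>{1..k}. 1 \<le> c i" by force
        then show "(\<integral>x. h x \<partial>exp_law k c) = cut_mix k h c" by (rule cut_mix_eq[OF h, symmetric])
      qed
      finally show ?thesis .
    qed
    ultimately have "(\<lambda>n. (Qop k ^^ n) (cut_mix k h) c0) \<longlonglongrightarrow> L" by (simp only:)
    moreover have "(\<lambda>n. (Qop k ^^ n) (cut_mix k h) c0) \<longlonglongrightarrow> (\<integral>c. cut_mix k h c \<partial>\<nu>)"
      using bcont_cut_mix measurable_cut_mix[OF h] unfolding h_def by (rule Q_lim)
    ultimately have L_eq: "L = (\<integral>c. cut_mix k h c \<partial>\<nu>)" by (rule LIMSEQ_unique)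
    \<comment> \<open>Conditioning on \<open>C\<close>: by independence the exponentials are
      integrated first with the rates fixed, and almost surely these rates are at least 2, where the
      cutoff is invisible.\<close>
    have mix: "(\<integral>\<omega>. h (\<lambda>i\<in>{1..k}. E i \<omega> / C \<omega> i) \<partial>N) = (\<integral>c. cut_mix k h c \<partial>\<nu>)"
    proof -
      interpret Ex: prob_space "exp_law k (\<lambda>_. 1)" by (rule prob_space_exp_law) simp
      interpret pair: pair_sigma_finite "exp_law k (\<lambda>_. 1)" \<nu> ..
      have sets_pair: "sets (exp_law k (\<lambda>_. 1) \<Otimes>\<^sub>M \<nu>) = sets (S \<Otimes>\<^sub>M S)"
        by (intro sets_pair_measure_cong) (simp_all add: S_def \<nu>_sets)
      have r: "(\<lambda>p. \<lambda>i\<in>{1..k}. fst p i / snd p i) \<in> S \<Otimes>\<^sub>M S \<rightarrow>\<^sub>M S"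
        using measurable_ratio[of "\<lambda>x. x" k] by (simp add: S_def)
      have hr: "(\<lambda>p. h (\<lambda>i\<in>{1..k}. fst p i / snd p i)) \<in> borel_measurable (S \<Otimes>\<^sub>M S)"
        using measurable_compose[OF r, of h borel] unit_fnD(1)[OF h] by (simp add: S_def)
      have "ennreal (\<integral>\<omega>. h (\<lambda>i\<in>{1..k}. E i \<omega> / C \<omega> i) \<partial>N)
          = (\<integral>\<^sup>+\<omega>. ennreal (h (\<lambda>i\<in>{1..k}. E i \<omega> / C \<omega> i)) \<partial>N)"
        by (rule N.unit_fn_integrable(4)[OF h meas_ratio, symmetric])
      also have "\<dots> = (\<integral>\<^sup>+\<omega>. ennreal (h (\<lambda>i\<in>{1..k}. fst (\<lambda>i\<in>{1..k}. E i \<omega>, C \<omega>) i / snd (\<lambda>i\<in>{1..k}. E i \<omega>, C \<omega>) i)) \<partial>N)"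
      proof -
        have "(\<lambda>i\<in>{1..k}. fst (\<lambda>i\<in>{1..k}. E i \<omega>, C \<omega>) i / snd (\<lambda>i\<in>{1..k}. E i \<omega>, C \<omega>) i) = (\<lambda>i\<in>{1..k}. E i \<omega> / C \<omega> i)" for \<omega>
          by (rule restrict_ext) simp
        then show ?thesis by simp
      qed
      also have "\<dots> = (\<integral>\<^sup>+p. ennreal (h (\<lambda>i\<in>{1..k}. fst p i / snd p i)) \<partial>(exp_law k (\<lambda>_. 1) \<Otimes>\<^sub>M \<nu>))"
        unfolding joint[symmetric]
        by (rule nn_integral_distr[symmetric])
           (use Evec C_S hr in \<open>auto intro!: measurable_Pair\<close>)
      also have "\<dots> = (\<integral>\<^sup>+c. (\<integral>\<^sup>+e. ennreal (h (\<lambda>i\<in>{1..k}. e i / c i)) \<partial>exp_law k (\<lambda>_. 1)) \<partial>\<nu>)"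
      proof -
        have "(\<lambda>p. ennreal (h (\<lambda>i\<in>{1..k}. fst p i / snd p i))) \<in> borel_measurable (exp_law k (\<lambda>_. 1) \<Otimes>\<^sub>M \<nu>)"
          using measurable_compose[OF hr measurable_ennreal]
          unfolding measurable_cong_sets[OF sets_pair refl] .
        from pair.nn_integral_snd[OF this] show ?thesis by simp
      qed
      also have "\<dots> = (\<integral>\<^sup>+c. ennreal (cut_mix k h c) \<partial>\<nu>)"
      proof (rule nn_integral_cong_AE)
        show "AE c in \<nu>. (\<integral>\<^sup>+e. ennreal (h (\<lambda>i\<in>{1..k}. e i / c i)) \<partial>exp_law k (\<lambda>_. 1)) = ennreal (cut_mix k h c)"
          using \<nu>_ge
        proof eventually_elim
          fix c :: "nat \<Rightarrow> real" assume c: "\<forall>i\<in>{1..k}. 2 \<le> c i"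
          have "(\<lambda>e. \<lambda>i\<in>{1..k}. e i / c i) \<in> exp_law k (\<lambda>_. 1) \<rightarrow>\<^sub>M PiM {1..k} (\<lambda>_. borel)"
            using measurable_ratio_left by (simp cong: measurable_cong_sets)
          then have "(\<integral>\<^sup>+e. ennreal (h (\<lambda>i\<in>{1..k}. e i / c i)) \<partial>exp_law k (\<lambda>_. 1))
              = ennreal (\<integral>e. h (\<lambda>i\<in>{1..k}. e i / c i) \<partial>exp_law k (\<lambda>_. 1))"
            by (rule Ex.unit_fn_integrable(4)[OF h])
          moreover have "(\<lambda>i\<in>{1..k}. e i / c i) = (\<lambda>i\<in>{1..k}. e i / max 1 (c i))" for e :: "nat \<Rightarrow> real"
          proof (rule restrict_ext)
            fix i assume "i \<in> {1..k}"
            then have "2 \<le> c i" using c by blast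
            then show "e i / c i = e i / max 1 (c i)" by simp
          qed
          ultimately show "(\<integral>\<^sup>+e. ennreal (h (\<lambda>i\<in>{1..k}. e i / c i)) \<partial>exp_law k (\<lambda>_. 1)) = ennreal (cut_mix k h c)"
            by (simp add: cut_mix_def)
        qed
      qed
      also have "\<dots> = ennreal (\<integral>c. cut_mix k h c \<partial>\<nu>)"
      proof (rule \<nu>.unit_fn_integrable(4)[where X="\<lambda>c. c"])
        have "0 \<le> cut_mix k h c" "cut_mix k h c \<le> 1" for c
          unfolding cut_mix_def
          by (rule Ex.unit_fn_integrable(2,3)[OF h], use measurable_ratio_left in \<open>simp cong: measurable_cong_sets\<close>)+
        then show "unit_fn k (cut_mix k h)" using measurable_cut_mix[OF h] by (simp add: unit_fn_def)
        show "(\<lambda>c. c) \<in> \<nu> \<rightarrow>\<^sub>M PiM {1..k} (\<lambda>_. borel)" by (simp cong: measurable_cong_sets add: \<nu>_sets)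
      qed
      finally have eq: "ennreal (\<integral>\<omega>. h (\<lambda>i\<in>{1..k}. E i \<omega> / C \<omega> i) \<partial>N) = ennreal (\<integral>c. cut_mix k h c \<partial>\<nu>)" .
      have "0 \<le> cut_mix k h c" for c unfolding cut_mix_def using unit_fnD(2)[OF h] by simp
      then show ?thesis using eq unit_fnD(2)[OF h] by simp
    qed
    show "(\<integral>x. box_fn k a m x \<partial>distr \<mu> (PiM {1..k} (\<lambda>_. borel)) (gaps k))
        = (\<integral>x. box_fn k a m x \<partial>distr N (PiM {1..k} (\<lambda>_. borel)) (\<lambda>\<omega>. \<lambda>i\<in>{1..k}. E i \<omega> / C \<omega> i))"
      using L_eq mix integral_distr[OF meas_gaps unit_fnD(1)[OF h]] integral_distr[OF meas_ratio unit_fnD(1)[OF h]]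
      unfolding L_def h_def by simp
  qed simp_all
qed

end
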